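(* Let $p$ be an odd prime. Then $$\sum_{n=0}^{p-1}\frac{\binom{2n}{n}G_n}{128^n}\equiv\begin{cases}4x^2-2p\pmod{p^2}&\text{if } p\equiv1,3\pmod 8 \text{ and } p=x^2+2y^2 \text{ with } x,y\in\mathbb{Z},\\0\pmod{p^2}&\text{if } p\equiv5,7\pmod 8,\end{cases}$$ and $$\sum_{n=0}^{p-1}\frac{\binom{2n}{n}\,n\,G_n}{128^n}\equiv0\pmod{p^2}.$$
   Context: For $n\ge0$, $G_n=\sum_{k=0}^n \binom{2k}{k}^2\binom{2n-2k}{n-k}4^{n-k}$. Congruences between rationals with denominators prime to $p$ are taken in the ring of such rationals. *)

theory Defs
  imports Complex_Main "HOL-Number_Theory.Cong" "HOL-Computational_Algebra.Primes"
begin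

definition G :: "nat \<Rightarrow> nat" where
  "G n = (\<Sum>k=0..n. ((2 * k) choose k)\<^sup>2 * ((2 * n - 2 * k) choose (n - k)) * 4 ^ (n - k))"

text \<open>The ring of rationals having a denominator prime to \<open>p\<close>. The representing fraction need not
  be reduced, but for prime \<open>p\<close> this is the same as asking it of the reduced denominator.\<close>

definition local_ring :: "nat \<Rightarrow> rat set" where
  "local_ring p = {of_int a / of_int b | a b. coprime b (int p)}"

text \<open>Congruence modulo \<open>m\<close> in that ring: both sides must belong to the ring, and
  their difference must lie in the ideal of the ring generated by \<open>m\<close>.\<close>

definition local_cong :: "nat \<Rightarrow> rat \<Rightarrow> rat \<Rightarrow> rat \<Rightarrow> bool" where
  "local_cong p a b m \<longleftrightarrow>
     a \<in> local_ring p \<and> b \<in> local_ring p \<and> (\<exists>c \<in> local_ring p. a - b = m * c)"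

end

theory Submission
  imports Defs "HOL-Number_Theory.Number_Theory" "HOL-Computational_Algebra.Computational_Algebra"
begin

text \<open>
  Let \<open>p = 2 n + 1\<close>. Two Chu--Vandermonde summations turn \<open>G m / 16 ^ m\<close> into
  \<open>\<Sum>k. (m choose k) (- 1) ^ k cb k ^ 2\<close> with \<open>cb k = (2 k choose k) / 4 ^ k\<close>, so that after an exchange of
  summation only the truncated sums \<open>\<Sum>m<p. (m choose k) cb m / 2 ^ m\<close> have to be known modulo \<open>p ^ 2\<close>;
  they satisfy a first-order recurrence in \<open>k\<close>. The result is \<open>W 2 ^ (- n) (1 - (p/4) H n)\<close>, where \<open>H n\<close> is
  the harmonic number and \<open>W\<close> a terminating \<open>\<^sub>3F\<^sub>2\<close> which Clausen's formula makes a square \<open>w ^ 2\<close>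
  (or \<open>2 w ^ 2\<close>) of a \<open>\<^sub>2F\<^sub>1\<close> at \<open>- 1\<close>. For \<open>p\<close> congruent to 5 or 7 modulo 8 already \<open>w\<close> vanishes
  modulo \<open>p\<close>. The second sum reduces to a truncated Ramanujan-type series, evaluated by a
  Wilf--Zeilberger pair.

  For \<open>p = 8 M + 1\<close> and \<open>p = 8 M + 3\<close>, the sum is the square modulo \<open>p ^ 2\<close> of a lacunary binomial sum
  \<open>J\<close> over the \<open>l\<close> in a residue class modulo \<open>N = p - 1\<close>, respectively \<open>N = p + 1\<close>. As a sum of
  \<open>z ^ c (1 \<mp> z) ^ (p n)\<close> over the \<open>N\<close>-th roots of unity \<open>z\<close> modulo \<open>p ^ 2\<close> (in the integers,
  respectively the Gaussian integers), \<open>J\<close> is the \<open>p\<close>-adic shadow of a Jacobi sum: every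
  term is an eighth root of unity, and the symmetry \<open>z \<mapsto> 1 / z\<close> replaces each term by its cube.
  Hence \<open>J\<close> and its conjugate \<open>J'\<close> are \<open>a + b s\<close> and \<open>a - b s\<close> with \<open>s ^ 2 = - 2\<close> and
  small integers \<open>a\<close>, \<open>b\<close>. Since \<open>J J'\<close> is congruent to \<open>p\<close>, the bounds force \<open>p = a ^ 2 + 2 b ^ 2\<close>, and
  \<open>J ^ 2 = (J + J') ^ 2 - J' ^ 2 - 2 J J'\<close> is congruent to \<open>4 a ^ 2 - 2 p\<close> because \<open>p\<close> divides \<open>J'\<close>.
\<close>

subsection \<open>Congruences between \<open>p\<close>-integral rationals\<close>

text \<open>The obstacle is the modulus \<open>p ^ 2\<close>: modulo \<open>p\<close> the term
  \<open>- 2 p\<close> is invisible. Both \<open>J\<close> and the sum are therefore brought to the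
  shape of a unit times \<open>1 + p h\<close>, and the comparison comes down to an identity between
  the first-order parts \<open>h\<close>, which are combinations of harmonic numbers. On the side of
  the roots of unity the lift comes from \<open>p\<close>-th powers: if \<open>x\<close> is
  congruent to 1 modulo \<open>p\<close>, then \<open>x ^ p\<close> is congruent to 1 modulo
  \<open>p ^ 2\<close>. Hence the exponent \<open>p n\<close> instead of \<open>n\<close>. The
  residue class of \<open>J\<close> is chosen so that its leading term is, up to sign,
  \<open>n choose M\<close>, which agrees to first order with the \<open>cb M\<close> to which
  Clausen's formula leads. In the conjugate class no \<open>l\<close> is a multiple of
  \<open>p\<close>, and so \<open>p\<close> divides \<open>J'\<close>. For
  \<open>p = 8 M + 1\<close> characters of order 8 exist on the units modulo \<open>p\<close>. For
  \<open>p = 8 M + 3\<close> the norm-one group of the Gaussian integers modulo \<open>p\<close> has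
  order \<open>8 M + 4\<close> and no element of order 8; the missing factor 2 is supplied by
  \<open>(1 + z) ^ (p n)\<close>, whose square is congruent to \<open>z\<close>.\<close>

definition pcong :: "nat \<Rightarrow> nat \<Rightarrow> rat \<Rightarrow> rat \<Rightarrow> bool" where
  "pcong p k a b \<longleftrightarrow> (\<exists>c\<in>local_ring p. a - b = of_nat p ^ k * c)"

definition rharm :: "nat \<Rightarrow> rat" where
  "rharm k = (\<Sum>j=1..k. 1 / of_nat j)"

lemma rharm_0 [simp]: "rharm 0 = 0"
  by (simp add: rharm_def)

lemma rharm_Suc: "rharm (Suc k) = rharm k + 1 / of_nat (Suc k)"
  by (simp add: rharm_def)

locale odd_prime =
  fixes p n :: nat
  assumes prime_p: "prime p" and p_eq: "p = 2 * n + 1"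
begin

abbreviation cg :: "nat \<Rightarrow> rat \<Rightarrow> rat \<Rightarrow> bool" where
  "cg \<equiv> pcong p"

abbreviation L :: "rat set" where
  "L \<equiv> local_ring p"

lemma odd_p: "odd p"
  by (simp add: p_eq)

lemma p_ge_3: "p \<ge> 3"
  using prime_p odd_p prime_ge_2_nat[of p] by (cases "p = 2") auto

lemma p_gt_0: "p > 0"
  using p_ge_3 by simp

lemma L_I: "coprime b (int p) \<Longrightarrow> of_int a / of_int b \<in> L"
  unfolding local_ring_def by blast

lemma L_E:
  assumes "x \<in> L"
  obtains a b where "x = of_int a / of_int b" "coprime b (int p)" "b \<noteq> 0"
proof -
  obtain a b where ab: "x = of_int a / of_int b" "coprime b (int p)"
    using assms unfolding local_ring_def by blast
  moreover have "b \<noteq> 0"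
    using ab(2) p_ge_3 by auto
  ultimately show ?thesis using that by blast
qed

lemma L_of_int [simp]: "of_int a \<in> L"
  using L_I[of 1 a] by simp

lemma L_of_nat [simp]: "of_nat a \<in> L"
  using L_of_int[of "int a"] by simp

lemma L_0 [simp]: "0 \<in> L" and L_1 [simp]: "1 \<in> L"
  using L_of_int[of 0] L_of_int[of 1] by auto

lemma L_numeral [simp]: "numeral a \<in> L"
  using L_of_nat[of "numeral a"] by simp

lemma L_add [simp, intro]:
  assumes "x \<in> L" "y \<in> L" shows "x + y \<in> L"
proof -
  obtain a b where ab: "x = of_int a / of_int b" "coprime b (int p)" "b \<noteq> 0"
    using assms(1) L_E by blast
  obtain c d where cd: "y = of_int c / of_int d" "coprime d (int p)" "d \<noteq> 0"
    using assms(2) L_E by blast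
  have "x + y = of_int (a * d + c * b) / of_int (b * d)"
    using ab cd by (simp add: field_simps)
  thus ?thesis using L_I[of "b * d" "a * d + c * b"] ab cd by simp
qed

lemma L_mult [simp, intro]:
  assumes "x \<in> L" "y \<in> L" shows "x * y \<in> L"
proof -
  obtain a b where ab: "x = of_int a / of_int b" "coprime b (int p)" "b \<noteq> 0"
    using assms(1) L_E by blast
  obtain c d where cd: "y = of_int c / of_int d" "coprime d (int p)" "d \<noteq> 0"
    using assms(2) L_E by blast
  have "x * y = of_int (a * c) / of_int (b * d)"
    using ab cd by simp
  thus ?thesis using L_I[of "b * d" "a * c"] ab cd by simp
qed

lemma L_minus [simp, intro]: "x \<in> L \<Longrightarrow> - x \<in> L"
  using L_mult[of "-1" x] L_of_int[of "-1"] by simp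

lemma L_diff [simp, intro]: "x \<in> L \<Longrightarrow> y \<in> L \<Longrightarrow> x - y \<in> L"
  using L_add[of x "-y"] L_minus by simp

lemma L_power [simp, intro]: "x \<in> L \<Longrightarrow> x ^ k \<in> L"
  by (induction k) auto

lemma L_sum [intro]: "(\<And>i. i \<in> A \<Longrightarrow> f i \<in> L) \<Longrightarrow> sum f A \<in> L"
  by (induction A rule: infinite_finite_induct) auto

lemma L_prod [intro]: "(\<And>i. i \<in> A \<Longrightarrow> f i \<in> L) \<Longrightarrow> prod f A \<in> L"
  by (induction A rule: infinite_finite_induct) auto

lemma L_inverse_int: "\<not> int p dvd a \<Longrightarrow> inverse (of_int a) \<in> L"
  using L_I[of a 1] prime_imp_coprime[of "int p" a] prime_p
  by (simp add: inverse_eq_divide coprime_commute)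

text \<open>The zero element is excluded explicitly because \<open>inverse 0 = 0\<close>.\<close>

definition unit :: "rat \<Rightarrow> bool" where
  "unit x \<longleftrightarrow> x \<in> L \<and> inverse x \<in> L \<and> x \<noteq> 0"

lemma unit_1 [simp]: "unit 1"
  by (simp add: unit_def)

lemma unit_mult [simp]: "unit x \<Longrightarrow> unit y \<Longrightarrow> unit (x * y)"
  by (auto simp: unit_def)

lemma unit_inverse [simp]: "unit x \<Longrightarrow> unit (inverse x)"
  by (auto simp: unit_def)

lemma unit_divide [simp]: "unit x \<Longrightarrow> unit y \<Longrightarrow> unit (x / y)"
  by (simp add: divide_inverse)

lemma unit_minus [simp]: "unit x \<Longrightarrow> unit (- x)"
  by (auto simp: unit_def)

lemma unit_power [simp]: "unit x \<Longrightarrow> unit (x ^ k)"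
  by (induction k) auto

lemma unit_of_int: "\<not> int p dvd a \<Longrightarrow> unit (of_int a)"
  using L_inverse_int[of a] by (auto simp: unit_def)

lemma unit_L [simp]: "unit x \<Longrightarrow> x \<in> L" and unit_inverse_L [simp]: "unit x \<Longrightarrow> inverse x \<in> L"
  and unit_nonzero: "unit x \<Longrightarrow> x \<noteq> 0"
  by (auto simp: unit_def)

lemma L_divide [simp, intro]: "x \<in> L \<Longrightarrow> unit y \<Longrightarrow> x / y \<in> L"
  by (simp add: divide_inverse)

lemma unit_of_nat: "\<not> p dvd a \<Longrightarrow> unit (of_nat a)"
  using unit_of_int[of "int a"] by simp

lemma unit_of_nat_less: "0 < a \<Longrightarrow> a < p \<Longrightarrow> unit (of_nat a)"
  by (intro unit_of_nat) (auto dest: dvd_imp_le)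

lemma unit_2 [simp]: "unit 2"
  using unit_of_nat_less[of 2] p_ge_3 by simp

lemma unit_4 [simp]: "unit 4" and unit_8 [simp]: "unit 8" and unit_neg1 [simp]: "unit (-1)"
  using unit_power[of 2 2] unit_power[of 2 3] unit_minus[of 1] by simp_all

lemma unit_16 [simp]: "unit 16" and unit_128 [simp]: "unit 128"
  using unit_power[of 2 4] unit_power[of 2 7] by simp_all

lemma unit_fact: "k < p \<Longrightarrow> unit (fact k)"
  using unit_of_nat[of "fact k"] prime_dvd_fact_iff[OF prime_p, of k] by simp

lemma unit_binomial: "k \<le> m \<Longrightarrow> m < p \<Longrightarrow> unit (of_nat (m choose k))"
  by (subst binomial_fact) (auto intro!: unit_divide unit_mult unit_fact)

lemma L_rharm: "k < p \<Longrightarrow> rharm k \<in> L"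
  unfolding rharm_def by (intro L_sum L_divide unit_of_nat_less) auto

lemma cg_refl [simp]: "cg k a a"
  unfolding pcong_def by (intro bexI[of _ 0]) auto

lemma cg_0D: "cg k a b \<Longrightarrow> \<exists>c\<in>L. a = b + of_nat p ^ k * c"
  unfolding pcong_def by (metis add.commute diff_add_cancel)

lemma cg_I: "a = b + of_nat p ^ k * c \<Longrightarrow> c \<in> L \<Longrightarrow> cg k a b"
  unfolding pcong_def by auto

lemma cg_sym: "cg k a b \<Longrightarrow> cg k b a"
  unfolding pcong_def by (metis L_minus minus_diff_eq mult_minus_right)

lemma cg_trans [trans]: "cg k a b \<Longrightarrow> cg k b c \<Longrightarrow> cg k a c"
proof -
  assume "cg k a b" "cg k b c"
  then obtain u v where "u \<in> L" "a = b + of_nat p ^ k * u" "v \<in> L" "b = c + of_nat p ^ k * v"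
    using cg_0D by meson
  thus ?thesis by (intro cg_I[of _ _ _ "u + v"]) (auto simp: algebra_simps)
qed

lemma cg_trans_eq1 [trans]: "cg k a b \<Longrightarrow> b = c \<Longrightarrow> cg k a c"
  and cg_trans_eq2 [trans]: "a = b \<Longrightarrow> cg k b c \<Longrightarrow> cg k a c"
  by simp_all

lemma cg_add: "cg k a b \<Longrightarrow> cg k c d \<Longrightarrow> cg k (a + c) (b + d)"
proof -
  assume "cg k a b" "cg k c d"
  then obtain u v where "u \<in> L" "a = b + of_nat p ^ k * u" "v \<in> L" "c = d + of_nat p ^ k * v"
    using cg_0D by meson
  thus ?thesis by (intro cg_I[of _ _ _ "u + v"]) (auto simp: algebra_simps)
qed

lemma cg_minus: "cg k a b \<Longrightarrow> cg k (- a) (- b)"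
proof -
  assume "cg k a b"
  then obtain u where "u \<in> L" "a = b + of_nat p ^ k * u"
    using cg_0D by meson
  thus ?thesis by (intro cg_I[of _ _ _ "- u"]) (auto simp: algebra_simps)
qed

lemma cg_diff: "cg k a b \<Longrightarrow> cg k c d \<Longrightarrow> cg k (a - c) (b - d)"
  using cg_add[of k a b "-c" "-d"] cg_minus by simp

lemma cg_mult_left: "c \<in> L \<Longrightarrow> cg k a b \<Longrightarrow> cg k (c * a) (c * b)"
proof -
  assume "c \<in> L" "cg k a b"
  then obtain u where "u \<in> L" "a = b + of_nat p ^ k * u"
    using cg_0D by meson
  thus ?thesis using \<open>c \<in> L\<close> by (intro cg_I[of _ _ _ "c * u"]) (auto simp: algebra_simps)
qed

lemma cg_mult_right: "c \<in> L \<Longrightarrow> cg k a b \<Longrightarrow> cg k (a * c) (b * c)"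
  using cg_mult_left[of c k a b] by (simp add: mult.commute)

lemma cg_mult: "cg k a b \<Longrightarrow> cg k c d \<Longrightarrow> a \<in> L \<Longrightarrow> d \<in> L \<Longrightarrow> cg k (a * c) (b * d)"
  using cg_mult_left[of a k c d] cg_mult_right[of d k a b] cg_trans by blast

lemma cg_L: "cg k a b \<Longrightarrow> a \<in> L \<longleftrightarrow> b \<in> L"
proof -
  assume a: "cg k a b"
  have "x \<in> L" if xy: "cg k x y" "y \<in> L" for x y
  proof -
    obtain c where "c \<in> L \<and> x = y + of_nat p ^ k * c" using cg_0D xy(1) by meson
    with \<open>y \<in> L\<close> show ?thesis by simp
  qed
  thus ?thesis using a cg_sym by blast
qed

lemma cg_power: "cg k a b \<Longrightarrow> b \<in> L \<Longrightarrow> cg k (a ^ m) (b ^ m)"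
  by (induction m) (auto intro!: cg_mult simp: cg_L)

lemma cg_sum: "(\<And>i. i \<in> A \<Longrightarrow> cg k (f i) (g i)) \<Longrightarrow> cg k (sum f A) (sum g A)"
  by (induction A rule: infinite_finite_induct) (auto intro: cg_add)

lemma cg_prod:
  "(\<And>i. i \<in> A \<Longrightarrow> cg k (f i) (g i)) \<Longrightarrow> (\<And>i. i \<in> A \<Longrightarrow> g i \<in> L) \<Longrightarrow> cg k (prod f A) (prod g A)"
proof (induction A rule: infinite_finite_induct)
  case (insert x F)
  have "f x \<in> L" using insert.prems cg_L by blast
  thus ?case using insert by (auto intro!: cg_mult L_prod)
qed auto

lemma cg_p [simp]: "c \<in> L \<Longrightarrow> cg 1 (of_nat p * c) 0"
  by (intro cg_I[of _ _ _ c]) auto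

lemma cg_lift: "cg 1 a b \<Longrightarrow> cg 2 (of_nat p * a) (of_nat p * b)"
proof -
  assume "cg 1 a b"
  then obtain u where "u \<in> L" "a = b + of_nat p ^ 1 * u"
    using cg_0D by meson
  thus ?thesis by (intro cg_I[of _ _ _ u]) (auto simp: power2_eq_square algebra_simps)
qed

lemma cg_2_1: "cg 2 a b \<Longrightarrow> cg 1 a b"
proof -
  assume "cg 2 a b"
  then obtain u where "u \<in> L" "a = b + of_nat p ^ 2 * u"
    using cg_0D by meson
  thus ?thesis by (intro cg_I[of _ _ _ "of_nat p * u"]) (auto simp: power2_eq_square)
qed

lemma cg_mult_unit_iff: "unit c \<Longrightarrow> cg k (c * a) (c * b) \<longleftrightarrow> cg k a b"
  using cg_mult_left[of c k a b] cg_mult_left[of "inverse c" k "c * a" "c * b"]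
  by (auto simp: unit_nonzero mult.assoc[symmetric])

text \<open>An element of \<open>L\<close> that is not invertible there has a numerator divisible by
  \<open>p\<close>, so it is congruent to 0. Then \<open>b\<close> would be \<open>p\<close> times
  an element of \<open>L\<close>, and dividing by \<open>b\<close> would put \<open>1 / p\<close>
  into \<open>L\<close>.\<close>

lemma cg_unit: "cg 1 a b \<Longrightarrow> unit b \<Longrightarrow> unit a"
proof -
  assume *: "cg 1 a b" "unit b"
  have a: "a \<in> L" using * cg_L by auto
  have "a \<noteq> 0 \<and> inverse a \<in> L"
  proof -
    obtain x y where xy: "a = of_int x / of_int y" "coprime y (int p)" "y \<noteq> 0"
      using a L_E by blast
    show ?thesis
    proof (cases "int p dvd x")
      case False
      hence "inverse a = of_int y / of_int x" "coprime x (int p)" "x \<noteq> 0"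
        using xy prime_p prime_imp_coprime[of "int p" x] by (auto simp: coprime_commute)
      thus ?thesis using L_I[of x y] xy by auto
    next
      case True
      then obtain z where "x = int p * z" by blast
      hence "cg 1 a 0" using xy L_I[of y z]
        by (intro cg_I[of _ _ _ "of_int z / of_int y"]) auto
      hence "cg 1 b 0" using *(1) cg_sym cg_trans by blast
      then obtain c where c: "c \<in> L" "b = of_nat p * c" using cg_0D[of 1 b 0] by auto
      have "b \<noteq> 0" using *(2) unit_nonzero by blast
      hence e: "c * inverse b * of_nat p = 1"
        using c by (simp add: mult.commute divide_inverse[symmetric])
      have "c * inverse b \<in> L" using c(1) *(2) by (intro L_mult unit_inverse_L)
      then obtain u v where uv: "c * inverse b = of_int u / of_int v" "coprime v (int p)" "v \<noteq> 0"
        using L_E by blast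
      have "of_int u / of_int v * of_nat p = (1 :: rat)" using e unfolding uv(1) .
      hence "of_int (u * int p) = (of_int v :: rat)" using uv(3) by (simp add: field_simps)
      hence "u * int p = v" by (simp only: of_int_eq_iff)
      hence "coprime (u * int p) (int p)" using uv by simp
      hence "int p = 1" by auto
      thus ?thesis using p_ge_3 by simp
    qed
  qed
  thus ?thesis using a unfolding unit_def by blast
qed

lemma cg_inverse:
  assumes "cg k a b" "unit a" "unit b" shows "cg k (inverse a) (inverse b)"
proof -
  have "cg k (inverse a * inverse b * b) (inverse a * inverse b * a)"
    using assms cg_sym by (intro cg_mult_left) auto
  moreover have "a \<noteq> 0" "b \<noteq> 0" using assms unit_nonzero by blast+
  ultimately show ?thesis by (simp add: field_simps)
qed

lemma cg_divide:
  assumes "cg k a b" "cg k c d" "unit c" "unit d" "b \<in> L" shows "cg k (a / c) (b / d)"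
proof -
  have "a \<in> L" using assms cg_L by blast
  thus ?thesis unfolding divide_inverse using assms by (intro cg_mult cg_inverse) auto
qed

text \<open>Denominators in \<open>L\<close> are prime to \<open>p\<close>, so passing from the
  integers to \<open>L\<close> creates no new congruences. Divisibility statements are moved through
  this equivalence in both directions.\<close>

lemma cg_of_int_iff: "cg k (of_int a) (of_int b) \<longleftrightarrow> int p ^ k dvd a - b"
proof
  assume "cg k (of_int a) (of_int b)"
  then obtain c where c: "c \<in> L" "of_int a - of_int b = of_nat p ^ k * c"
    unfolding pcong_def by blast
  obtain u v where uv: "c = of_int u / of_int v" "coprime v (int p)" "v \<noteq> 0"
    using c L_E by blast
  have "of_int ((a - b) * v) = (of_int (int p ^ k * u) :: rat)"
    using c uv by (simp add: field_simps)
  hence "(a - b) * v = int p ^ k * u" by (simp only: of_int_eq_iff)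
  hence "int p ^ k dvd (a - b) * v" by simp
  thus "int p ^ k dvd a - b"
    using uv(2) by (metis coprime_commute coprime_dvd_mult_left_iff coprime_power_left_iff)
next
  assume "int p ^ k dvd a - b"
  then obtain c where "a - b = int p ^ k * c" by blast
  hence "of_int (a - b) = (of_int (int p ^ k * c) :: rat)" by simp
  thus "cg k (of_int a) (of_int b)"
    unfolding pcong_def by (intro bexI[of _ "of_int c"]) auto
qed

lemma cg_of_nat_iff: "cg k (of_nat a) (of_nat b) \<longleftrightarrow> int p ^ k dvd int a - int b"
  using cg_of_int_iff[of k "int a" "int b"] by simp

text \<open>\<open>pcong\<close> looks only at the difference of its sides and is thus an
  equivalence relation on all rationals. The membership conditions of \<open>local_cong\<close> are
  split off here once and for all.\<close>

lemma local_cong_iff: "local_cong p a b (of_nat (p\<^sup>2)) \<longleftrightarrow> cg 2 a b \<and> a \<in> L \<and> b \<in> L"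
  by (auto simp: local_cong_def pcong_def)

end

section \<open>Rising factorials, central binomial coefficients and the convolution behind
  \<open>G\<close>\<close>

definition rising :: "rat \<Rightarrow> nat \<Rightarrow> rat" where
  "rising a k = pochhammer a k / fact k"

abbreviation cb :: "nat \<Rightarrow> rat" where
  "cb \<equiv> rising (1 / 2)"

lemma rising_0 [simp]: "rising a 0 = 1"
  by (simp add: rising_def)

lemma rising_Suc: "of_nat (Suc k) * rising a (Suc k) = (a + of_nat k) * rising a k"
  by (simp add: rising_def pochhammer_Suc divide_simps mult_ac del: of_nat_Suc)

text \<open>\<open>rising a k\<close> is the coefficient of \<open>x ^ k\<close> in the binomial
  series of \<open>1 - x\<close> with exponent \<open>- a\<close>; multiplying two such series adds
  the parameters.\<close>

lemma rising_vandermonde: "(\<Sum>j\<le>l. rising a j * rising b (l - j)) = rising (a + b) l"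
proof -
  have "rising (a + b) l = (\<Sum>j\<le>l. of_nat (l choose j) * pochhammer a j * pochhammer b (l - j) / fact l)"
    by (simp add: rising_def pochhammer_binomial_sum sum_divide_distrib)
  also have "\<dots> = (\<Sum>j\<le>l. rising a j * rising b (l - j))"
    by (intro sum.cong) (auto simp: rising_def binomial_fact field_simps)
  finally show ?thesis ..
qed

lemma rising_of_nat_Suc: "rising (of_nat k + 1) l = of_nat ((k + l) choose k)"
proof -
  have "(fact (k + l) :: rat) = fact k * pochhammer (of_nat k + 1) l"
    using pochhammer_product'[of "1::rat" k l] by (simp add: pochhammer_fact add.commute)
  thus ?thesis by (simp add: rising_def binomial_fact field_simps)
qed

lemma rising_minus_of_nat: "rising (- of_nat m) k = (- 1) ^ k * of_nat (m choose k)"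
  by (simp add: rising_def binomial_gbinomial gbinomial_pochhammer)

lemma cb_eq: "cb k = of_nat ((2 * k) choose k) / 4 ^ k"
proof -
  have "(fact (2 * k) :: rat) = 4 ^ k * pochhammer (1 / 2) k * fact k"
    by (simp add: fact_double power_mult)
  thus ?thesis by (simp add: rising_def binomial_fact field_simps)
qed

lemma cb_Suc: "2 * of_nat (Suc k) * cb (Suc k) = (2 * of_nat k + 1) * cb k"
  using rising_Suc[of k "1/2"] by (simp add: algebra_simps)

lemma choose_mult_cb: "of_nat ((k + l) choose k) * cb (k + l) = cb k * rising (of_nat k + 1 / 2) l"
proof -
  have "pochhammer (1/2 :: rat) (k + l) = pochhammer (1/2) k * pochhammer (of_nat k + 1/2) l"
    using pochhammer_product'[of "1/2::rat" k l] by (simp add: add.commute)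
  thus ?thesis by (simp add: rising_def binomial_fact field_simps)
qed

lemma sum_shift_zero:
  fixes f :: "nat \<Rightarrow> 'a::comm_monoid_add"
  assumes "\<And>i. i < k \<Longrightarrow> f i = 0"
  shows "(\<Sum>i\<le>k + d. f i) = (\<Sum>l\<le>d. f (k + l))"
proof (induction d)
  case 0
  have "(\<Sum>i\<le>k. f i) = (\<Sum>i\<in>{k}. f i)"
    by (rule sum.mono_neutral_right) (use assms in auto)
  thus ?case by simp
qed auto

text \<open>With \<open>N = k + l\<close> the summand is \<open>cb k\<close> times a product of
  coefficients of binomial series with parameters \<open>k + 1/2\<close> and \<open>1/2\<close>, so
  Vandermonde applies with the integral parameter \<open>k + 1\<close>.\<close>

lemma sum_choose_cb:
  "(\<Sum>N\<le>m. of_nat (N choose k) * cb N * cb (m - N)) = of_nat (m choose k) * cb k"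
proof (cases "k \<le> m")
  case False
  thus ?thesis by (auto simp: binomial_eq_0 intro!: sum.neutral)
next
  case True
  then obtain d where m: "m = k + d" using le_Suc_ex by blast
  have "(\<Sum>N\<le>m. of_nat (N choose k) * cb N * cb (m - N)) =
      (\<Sum>l\<le>d. of_nat ((k + l) choose k) * cb (k + l) * cb (m - (k + l)))"
    unfolding m by (rule sum_shift_zero) (simp add: binomial_eq_0)
  also have "\<dots> = cb k * (\<Sum>l\<le>d. rising (of_nat k + 1 / 2) l * cb (d - l))"
    unfolding choose_mult_cb sum_distrib_left m by (intro sum.cong) auto
  also have "\<dots> = cb k * rising (of_nat k + 1) d"
    unfolding rising_vandermonde by (simp add: add.assoc)
  finally show ?thesis by (simp add: m rising_of_nat_Suc)
qed

text \<open>Vandermonde with the parameters \<open>1/2\<close> and \<open>- N\<close>: reversing the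
  factors of \<open>pochhammer (1/2 - N) N\<close> gives back \<open>cb N\<close> up to sign. The
  upper limit \<open>m\<close> may exceed \<open>N\<close>, so that one limit serves all
  \<open>N\<close> when the summations are exchanged.\<close>

lemma cb_binomial_sum:
  assumes "N \<le> m" shows "cb N = (\<Sum>k\<le>m. (- 1) ^ k * cb k * of_nat (N choose k))"
proof -
  have "(- 1) ^ N * cb N = rising (1 / 2 + - of_nat N) N"
    using pochhammer_minus[of "of_nat N - 1/2 :: rat" N] by (simp add: rising_def)
  also have "\<dots> = (\<Sum>k\<le>N. cb k * rising (- of_nat N) (N - k))"
    by (rule rising_vandermonde[symmetric])
  also have "\<dots> = (\<Sum>k\<le>N. (- 1) ^ N * ((- 1) ^ k * cb k * of_nat (N choose k)))"
    by (intro sum.cong refl)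
       (auto simp: rising_minus_of_nat minus_one_power_iff even_diff_nat binomial_symmetric[symmetric] split: if_splits)
  also have "\<dots> = (- 1) ^ N * (\<Sum>k\<le>N. (- 1) ^ k * cb k * of_nat (N choose k))"
    by (simp add: sum_distrib_left)
  also have "(\<Sum>k\<le>N. (- 1) ^ k * cb k * of_nat (N choose k)) =
      (\<Sum>k\<le>m. (- 1) ^ k * cb k * of_nat (N choose k))"
    by (rule sum.mono_neutral_left) (use assms in \<open>auto simp: binomial_eq_0\<close>)
  finally show ?thesis by simp
qed

definition gs :: "nat \<Rightarrow> rat" where
  "gs m = (\<Sum>k\<le>m. of_nat (m choose k) * (- 1) ^ k * cb k ^ 2)"

text \<open>Only one of the two factors \<open>cb N\<close> is expanded by
  \<open>cb_binomial_sum\<close>; after the exchange of summations the inner sum is the one of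
  \<open>sum_choose_cb\<close>.\<close>

lemma gs_convolution: "(\<Sum>N\<le>m. cb N ^ 2 * cb (m - N)) = gs m"
proof -
  have "(\<Sum>N\<le>m. cb N ^ 2 * cb (m - N)) =
      (\<Sum>N\<le>m. (\<Sum>k\<le>m. (- 1) ^ k * cb k * of_nat (N choose k)) * (cb N * cb (m - N)))"
    by (intro sum.cong refl) (subst cb_binomial_sum[symmetric], auto simp: power2_eq_square)
  also have "\<dots> = (\<Sum>k\<le>m. (- 1) ^ k * cb k * (\<Sum>N\<le>m. of_nat (N choose k) * cb N * cb (m - N)))"
    unfolding sum_distrib_left sum_distrib_right by (subst sum.swap) (simp add: mult_ac)
  also have "\<dots> = gs m"
    unfolding sum_choose_cb gs_def by (intro sum.cong) (auto simp: power2_eq_square)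
  finally show ?thesis .
qed

lemma G_eq_gs: "of_nat (G m) = 16 ^ m * gs m"
proof -
  have "of_nat (G m) = (\<Sum>k\<le>m. (4 ^ k * cb k) ^ 2 * (4 ^ (m - k) * cb (m - k)) * 4 ^ (m - k))"
    unfolding G_def of_nat_sum atLeast0AtMost
    by (intro sum.cong refl) (simp add: cb_eq diff_mult_distrib2)
  also have "\<dots> = (\<Sum>k\<le>m. 16 ^ m * (cb k ^ 2 * cb (m - k)))"
  proof (intro sum.cong refl)
    fix k assume "k \<in> {..m}"
    then obtain d where "m = k + d" using le_Suc_ex by auto
    moreover have "(4::rat) ^ k * 4 ^ k = 16 ^ k" "(4::rat) ^ d * 4 ^ d = 16 ^ d"
      by (simp_all flip: power_mult_distrib)
    ultimately show "(4 ^ k * cb k) ^ 2 * (4 ^ (m - k) * cb (m - k)) * 4 ^ (m - k)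
        = 16 ^ m * (cb k ^ 2 * cb (m - k))"
      by (simp add: power2_eq_square power_add)
  qed
  also have "\<dots> = 16 ^ m * gs m"
    unfolding gs_convolution[symmetric] by (simp add: sum_distrib_left)
  finally show ?thesis .
qed

lemma summand_eq: "of_nat (((2 * m) choose m) * G m) / 128 ^ m = cb m / 2 ^ m * gs m"
proof -
  have "(128 :: rat) ^ m = 4 ^ m * 2 ^ m * 16 ^ m" by (simp flip: power_mult_distrib)
  thus ?thesis by (simp add: G_eq_gs cb_eq)
qed

definition trunc :: "nat \<Rightarrow> nat \<Rightarrow> rat" where
  "trunc K k = (\<Sum>m<K. of_nat (m choose k) * cb m / 2 ^ m)"

text \<open>The infinite sums equal \<open>cb k\<close> times the square root of 2 and inherit the
  two-term recurrence of \<open>cb\<close>. The last term is the price of stopping before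
  \<open>K\<close>, and the induction on \<open>K\<close> checks that it changes by the right
  amount.\<close>

lemma trunc_rec:
  "2 * (of_nat k + 1) * trunc K (Suc k) =
     (2 * of_nat k + 1) * trunc K k - 4 * of_nat K * cb K / 2 ^ K * of_nat ((K - 1) choose k)"
proof (induction K)
  case 0
  show ?case by (simp add: trunc_def)
next
  case (Suc K)
  define c where "c = (of_nat (K choose k) :: rat)"
  have 1: "(of_nat k + 1) * of_nat (K choose Suc k) = (of_nat K - of_nat k) * c"
  proof (cases "k \<le> K")
    case True
    have "Suc k * (K choose Suc k) = (K - k) * (K choose k)"
      by (simp only: binomial_absorption binomial_absorb_comp)
    hence "(of_nat (Suc k * (K choose Suc k)) :: rat) = of_nat ((K - k) * (K choose k))" by (simp only:)
    thus ?thesis using True by (simp add: c_def of_nat_diff algebra_simps)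
  qed (simp add: c_def binomial_eq_0)
  have 2: "of_nat K * of_nat ((K - 1) choose k) = (of_nat K - of_nat k) * c"
  proof -
    have "of_nat (Suc k * (K choose Suc k)) = (of_nat (K * ((K - 1) choose k)) :: rat)"
      by (simp only: binomial_absorption)
    thus ?thesis using 1 by (simp add: ring_distribs)
  qed
  have 3: "2 * (of_nat K + 1) * cb (Suc K) = (2 * of_nat K + 1) * cb K"
    using cb_Suc[of K] by (simp add: add.commute)
  have "2 * (of_nat k + 1) * trunc (Suc K) (Suc k) =
      2 * (of_nat k + 1) * trunc K (Suc k) + 2 * ((of_nat k + 1) * of_nat (K choose Suc k)) * cb K / 2 ^ K"
    by (simp add: trunc_def algebra_simps)
  also have "\<dots> = (2 * of_nat k + 1) * trunc K k - 4 * (of_nat K * of_nat ((K - 1) choose k)) * cb K / 2 ^ K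
      + 2 * ((of_nat K - of_nat k) * c) * cb K / 2 ^ K"
    unfolding Suc 1 by simp
  also have "\<dots> = (2 * of_nat k + 1) * trunc K k - 2 * ((of_nat K - of_nat k) * c) * cb K / 2 ^ K"
    unfolding 2 by (simp add: field_simps)
  also have "\<dots> = (2 * of_nat k + 1) * trunc (Suc K) k - c * ((2 * of_nat K + 1) * cb K) / 2 ^ K"
    by (simp add: trunc_def c_def field_simps)
  also have "\<dots> = (2 * of_nat k + 1) * trunc (Suc K) k - 4 * of_nat (Suc K) * cb (Suc K) / 2 ^ Suc K * c"
    unfolding 3[symmetric] by (simp add: field_simps)
  finally show ?case by (simp add: c_def)
qed

lemma sum_cb_gs: "(\<Sum>m<K. cb m / 2 ^ m * gs m) = (\<Sum>k<K. (- 1) ^ k * cb k ^ 2 * trunc K k)"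
proof -
  have "gs m = (\<Sum>k<K. of_nat (m choose k) * (- 1) ^ k * cb k ^ 2)" if "m < K" for m
    unfolding gs_def by (rule sum.mono_neutral_left) (use that in \<open>auto simp: binomial_eq_0\<close>)
  hence "(\<Sum>m<K. cb m / 2 ^ m * gs m) =
      (\<Sum>m<K. cb m / 2 ^ m * (\<Sum>k<K. of_nat (m choose k) * (- 1) ^ k * cb k ^ 2))"
    by (intro sum.cong) auto
  also have "\<dots> = (\<Sum>k<K. (- 1) ^ k * cb k ^ 2 * trunc K k)"
    unfolding sum_distrib_left trunc_def by (subst sum.swap) (simp add: mult_ac)
  finally show ?thesis .
qed

text \<open>The weight \<open>m\<close> turns \<open>m choose k\<close> into a combination of
  \<open>m choose k\<close> and \<open>m choose Suc k\<close>. Removing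
  \<open>trunc K (Suc k)\<close> by \<open>trunc_rec\<close> adds \<open>2 k + 1\<close> to
  \<open>2 k\<close>, which is the origin of the weight \<open>4 k + 1\<close> of the Ramanujan-type
  series.\<close>

lemma sum_index_cb_gs:
  "2 * (\<Sum>m<K. of_nat m * (cb m / 2 ^ m * gs m)) =
     (\<Sum>k<K. (- 1) ^ k * cb k ^ 2 *
        ((4 * of_nat k + 1) * trunc K k - 4 * of_nat K * cb K / 2 ^ K * of_nat ((K - 1) choose k)))"
proof -
  have gs: "gs m = (\<Sum>k<K. of_nat (m choose k) * (- 1) ^ k * cb k ^ 2)" if "m < K" for m
    unfolding gs_def by (rule sum.mono_neutral_left) (use that in \<open>auto simp: binomial_eq_0\<close>)
  have abs: "of_nat m * of_nat (m choose k) =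
      (of_nat k * of_nat (m choose k) + (of_nat k + 1) * of_nat (m choose Suc k) :: rat)" for m k
  proof (cases "k \<le> m")
    case True
    have "Suc k * (m choose Suc k) = (m - k) * (m choose k)"
      by (simp only: binomial_absorption binomial_absorb_comp)
    hence "(of_nat (Suc k * (m choose Suc k)) :: rat) = of_nat ((m - k) * (m choose k))" by (simp only:)
    thus ?thesis using True by (simp add: of_nat_diff algebra_simps)
  qed (simp add: binomial_eq_0)
  have inner: "(\<Sum>m<K. of_nat m * of_nat (m choose k) * cb m / 2 ^ m) =
      of_nat k * trunc K k + (of_nat k + 1) * trunc K (Suc k)" for k
    unfolding trunc_def sum_distrib_left sum.distrib[symmetric]
    by (intro sum.cong refl) (simp only: abs, simp add: ring_distribs add_divide_distrib)
  have "(\<Sum>m<K. of_nat m * (cb m / 2 ^ m * gs m)) =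
      (\<Sum>m<K. cb m / 2 ^ m * (\<Sum>k<K. of_nat m * of_nat (m choose k) * (- 1) ^ k * cb k ^ 2))"
    by (intro sum.cong) (auto simp: gs sum_distrib_left mult_ac)
  also have "\<dots> = (\<Sum>k<K. (- 1) ^ k * cb k ^ 2 * (\<Sum>m<K. of_nat m * of_nat (m choose k) * cb m / 2 ^ m))"
    unfolding sum_distrib_left by (subst sum.swap) (simp add: mult_ac)
  also have "\<dots> = (\<Sum>k<K. (- 1) ^ k * cb k ^ 2 *
      (of_nat k * trunc K k + (of_nat k + 1) * trunc K (Suc k)))"
    unfolding inner ..
  finally have "2 * (\<Sum>m<K. of_nat m * (cb m / 2 ^ m * gs m)) = 2 * (\<Sum>k<K. (- 1) ^ k * cb k ^ 2 *
      (of_nat k * trunc K k + (of_nat k + 1) * trunc K (Suc k)))" by (simp only:)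
  also have "\<dots> = (\<Sum>k<K. (- 1) ^ k * cb k ^ 2 *
      (2 * of_nat k * trunc K k + 2 * (of_nat k + 1) * trunc K (Suc k)))"
    unfolding sum_distrib_left by (intro sum.cong refl) (simp add: algebra_simps)
  also have "\<dots> = (\<Sum>k<K. (- 1) ^ k * cb k ^ 2 *
        ((4 * of_nat k + 1) * trunc K k - 4 * of_nat K * cb K / 2 ^ K * of_nat ((K - 1) choose k)))"
    by (intro sum.cong refl, simp only: trunc_rec) (simp add: ring_distribs)
  finally show ?thesis .
qed

section \<open>Alternating binomial sums, reciprocals of binomial coefficients and harmonic
  numbers\<close>

lemma alternating_pascal:
  fixes f :: "nat \<Rightarrow> rat"
  shows "(\<Sum>q\<le>Suc K. (- 1) ^ q * of_nat (Suc K choose q) * f q) =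
   (\<Sum>q\<le>K. (- 1) ^ q * of_nat (K choose q) * (f q - f (Suc q)))"
proof -
  have "(\<Sum>q\<le>Suc K. (- 1) ^ q * of_nat (Suc K choose q) * f q) =
      f 0 + (\<Sum>q\<le>K. (- 1) ^ Suc q * of_nat (Suc K choose Suc q) * f (Suc q))"
    by (subst sum.atMost_Suc_shift) simp
  also have "\<dots> = f 0 + (\<Sum>q\<le>K. (- 1) ^ Suc q * of_nat (K choose Suc q) * f (Suc q))
      - (\<Sum>q\<le>K. (- 1) ^ q * of_nat (K choose q) * f (Suc q))"
    by (simp add: sum.distrib sum_subtractf algebra_simps sum_negf)
  also have "f 0 + (\<Sum>q\<le>K. (- 1) ^ Suc q * of_nat (K choose Suc q) * f (Suc q)) =
      (\<Sum>q\<le>Suc K. (- 1) ^ q * of_nat (K choose q) * f q)"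
    by (subst sum.atMost_Suc_shift) simp
  also have "\<dots> = (\<Sum>q\<le>K. (- 1) ^ q * of_nat (K choose q) * f q)"
    by (simp add: binomial_eq_0)
  finally show ?thesis by (simp add: sum_subtractf algebra_simps)
qed

text \<open>This is the partial fraction expansion of the right-hand side in \<open>x\<close>. By
  \<open>alternating_pascal\<close> the step from \<open>K\<close> to \<open>K + 1\<close> is a
  difference in \<open>x\<close>.\<close>

lemma alternating_partial_fractions:
  fixes x :: rat
  assumes "\<And>j. j \<le> K \<Longrightarrow> x + of_nat j \<noteq> 0"
  shows "(\<Sum>q\<le>K. (- 1) ^ q * of_nat (K choose q) / (x + of_nat q)) = fact K / pochhammer x (Suc K)"
  using assms
proof (induction K arbitrary: x)
  case (Suc K)
  have nz: "x + of_nat j \<noteq> 0" if "j \<le> Suc K" for j using Suc.prems that by blast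
  have nz': "(x + 1) + of_nat j \<noteq> 0" if "j \<le> K" for j using nz[of "Suc j"] that by (simp add: add_ac)
  have "(\<Sum>q\<le>Suc K. (- 1) ^ q * of_nat (Suc K choose q) / (x + of_nat q)) =
      (\<Sum>q\<le>K. (- 1) ^ q * of_nat (K choose q) / (x + of_nat q)) -
      (\<Sum>q\<le>K. (- 1) ^ q * of_nat (K choose q) / ((x + 1) + of_nat q))"
    using alternating_pascal[of K "\<lambda>q. 1 / (x + of_nat q)"]
    by (simp add: sum_subtractf right_diff_distrib add_ac)
  also have "\<dots> = fact K / pochhammer x (Suc K) - fact K / pochhammer (x + 1) (Suc K)"
    using Suc.IH[of x] Suc.IH[of "x + 1"] nz nz' by simp
  also have "\<dots> = fact (Suc K) / pochhammer x (Suc (Suc K))"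
  proof -
    define P y where "P = pochhammer (x + 1) K" and "y = x + 1 + of_nat K"
    have a: "pochhammer x (Suc K) = x * P" "pochhammer (x + 1) (Suc K) = P * y"
      "pochhammer x (Suc (Suc K)) = x * (P * y)"
      unfolding P_def y_def
      by (simp_all only: pochhammer_rec[of x] pochhammer_rec'[of "x + 1"]) (simp_all add: mult_ac)
    have "P \<noteq> 0" unfolding P_def pochhammer_prod using nz' by (auto simp: prod_zero_iff)
    moreover have "x \<noteq> 0" "y \<noteq> 0" using nz[of 0] nz'[of K] by (simp_all add: y_def)
    moreover have "fact (Suc K) = (y - x) * fact K" by (simp add: y_def)
    ultimately show ?thesis unfolding a by (simp add: field_simps del: fact_Suc)
  qed
  finally show ?case .
qed simp

text \<open>The coefficient of \<open>x ^ Q\<close> in \<open>- (1 - x) ^ K * ln (1 - x)\<close>.\<close>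

definition logcoeff :: "nat \<Rightarrow> nat \<Rightarrow> rat" where
  "logcoeff K Q = (\<Sum>q<Q. (- 1) ^ q * of_nat (K choose q) / of_nat (Q - q))"

lemma logcoeff_0 [simp]: "logcoeff K 0 = 0"
  by (simp add: logcoeff_def)

text \<open>In terms of generating functions: one more factor \<open>1 - x\<close>.\<close>

lemma logcoeff_rec: "logcoeff (Suc K) (Suc Q) = logcoeff K (Suc Q) - logcoeff K Q"
proof -
  have "logcoeff (Suc K) (Suc Q) = 1 / of_nat (Suc Q) +
      (\<Sum>q<Q. (- 1) ^ Suc q * of_nat (Suc K choose Suc q) / of_nat (Q - q))"
    unfolding logcoeff_def by (subst sum.lessThan_Suc_shift) simp
  also have "\<dots> = 1 / of_nat (Suc Q) + (\<Sum>q<Q. (- 1) ^ Suc q * of_nat (K choose Suc q) / of_nat (Q - q))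
      - (\<Sum>q<Q. (- 1) ^ q * of_nat (K choose q) / of_nat (Q - q))"
    by (simp add: sum.distrib sum_subtractf algebra_simps sum_negf add_divide_distrib diff_divide_distrib)
  also have "1 / of_nat (Suc Q) + (\<Sum>q<Q. (- 1) ^ Suc q * of_nat (K choose Suc q) / of_nat (Q - q)) =
      logcoeff K (Suc Q)"
    unfolding logcoeff_def by (subst sum.lessThan_Suc_shift) simp
  finally show ?thesis by (simp add: logcoeff_def)
qed

text \<open>The recurrence leaves the range \<open>Q \<le> K\<close> of \<open>logcoeff_eq\<close>
  exactly at this diagonal, which therefore needs its own evaluation.\<close>

lemma logcoeff_Suc_self: "logcoeff K (Suc K) = (- 1) ^ K / of_nat (Suc K)"
proof -
  have "logcoeff K (Suc K) = - (\<Sum>q\<le>K. (- 1) ^ q * of_nat (K choose q) / (- of_nat (Suc K) + of_nat q))"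
    unfolding logcoeff_def sum_negf[symmetric] lessThan_Suc_atMost
  proof (intro sum.cong refl)
    fix q assume "q \<in> {..K}"
    hence "(of_nat (Suc K - q) :: rat) = of_nat (Suc K) - of_nat q" by (simp add: of_nat_diff)
    hence e: "- of_nat (Suc K) + of_nat q = - (of_nat (Suc K - q) :: rat)" by (simp del: of_nat_Suc)
    show "(- 1) ^ q * of_nat (K choose q) / of_nat (Suc K - q) =
        - ((- 1) ^ q * of_nat (K choose q) / (- of_nat (Suc K) + of_nat q) :: rat)"
      unfolding e by (simp del: of_nat_Suc)
  qed
  also have "\<dots> = - (fact K / pochhammer (- of_nat (Suc K)) (Suc K))"
  proof (subst alternating_partial_fractions)
    fix j assume "j \<le> K"
    hence "(of_nat j :: rat) < of_nat (Suc K)" by (simp only: of_nat_less_iff)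
    thus "- of_nat (Suc K) + of_nat j \<noteq> (0::rat)" by simp
  qed simp
  also have "\<dots> = (- 1) ^ K / of_nat (Suc K)"
    by (simp add: pochhammer_same minus_one_power_iff del: of_nat_Suc)
  finally show ?thesis .
qed

text \<open>The series is minus the derivative of \<open>(1 - x) ^ K\<close> with respect to the
  exponent, and the logarithmic derivative of \<open>K choose Q\<close> in \<open>K\<close> is a
  difference of harmonic numbers. The induction verifies what this predicts.\<close>

lemma logcoeff_eq:
  "Q \<le> K \<Longrightarrow> logcoeff K Q = (- 1) ^ Suc Q * of_nat (K choose Q) * (rharm K - rharm (K - Q))"
proof (induction K arbitrary: Q)
  case (Suc K)
  show ?case
  proof (cases Q)
    case 0 thus ?thesis by simp
  next
    case (Suc R)
    hence R: "R \<le> K" using Suc.prems by simp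
    have IH: "logcoeff K R = (- 1) ^ Suc R * of_nat (K choose R) * (rharm K - rharm (K - R))"
      using Suc.IH[OF R] .
    show ?thesis
    proof (cases "R = K")
      case True
      thus ?thesis using IH Suc
        by (simp add: logcoeff_rec logcoeff_Suc_self rharm_Suc algebra_simps del: of_nat_Suc)
    next
      case False
      define d where "d = K - Suc R"
      have K: "K = Suc (R + d)" using False R by (simp add: d_def)
      have IH': "logcoeff K (Suc R) = (- 1) ^ Suc (Suc R) * of_nat (K choose Suc R) * (rharm K - rharm (K - Suc R))"
        using Suc.IH[of "Suc R"] False R by simp
      have "of_nat (Suc d) * of_nat (Suc K choose Suc R) = (of_nat (Suc K) * of_nat (K choose Suc R) :: rat)"
        using binomial_absorb_comp[of "Suc K" "Suc R"] unfolding K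
        by (simp del: binomial_Suc_Suc of_nat_Suc flip: of_nat_mult)
      hence e: "of_nat (Suc K choose Suc R) / of_nat (Suc K) = (of_nat (K choose Suc R) / of_nat (Suc d) :: rat)"
        by (simp add: field_simps del: binomial_Suc_Suc of_nat_Suc)
      have "logcoeff (Suc K) Q = (- 1) ^ R * (of_nat (K choose Suc R) * (rharm K - rharm d)
          + of_nat (K choose R) * (rharm K - rharm (Suc d)))"
        unfolding Suc logcoeff_rec IH IH' by (simp add: K algebra_simps)
      also have "\<dots> = (- 1) ^ R * (of_nat (Suc K choose Suc R) * (rharm K - rharm (Suc d))
          + of_nat (K choose Suc R) / of_nat (Suc d))"
        by (simp add: rharm_Suc algebra_simps del: of_nat_Suc)
      also have "\<dots> = (- 1) ^ R * of_nat (Suc K choose Suc R) * (rharm (Suc K) - rharm (Suc d))"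
        unfolding e[symmetric] by (simp add: rharm_Suc algebra_simps del: of_nat_Suc binomial_Suc_Suc)
      finally show ?thesis by (simp add: Suc K del: binomial_Suc_Suc)
    qed
  qed
qed simp

lemma inverse_choose_add:
  assumes "i \<le> m"
  shows "1 / of_nat (Suc m choose i) + 1 / of_nat (Suc m choose Suc i) =
      (of_nat (Suc (Suc m)) / of_nat (Suc m) * (1 / of_nat (m choose i)) :: rat)"
proof -
  obtain d where m: "m = i + d" using assms le_Suc_ex by blast
  have b: "1 / of_nat ((a + b) choose a) = (fact a * fact b / fact (a + b) :: rat)" for a b
    by (simp add: binomial_fact)
  have 1: "1 / of_nat (Suc m choose i) = (fact i * (of_nat (Suc d) * fact d) / (of_nat (Suc m) * fact m) :: rat)"
    using b[of i "Suc d"] by (simp only: m add_Suc_right fact_Suc of_nat_mult)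
  have 2: "1 / of_nat (Suc m choose Suc i) = (of_nat (Suc i) * fact i * fact d / (of_nat (Suc m) * fact m) :: rat)"
    using b[of "Suc i" d] by (simp only: m add_Suc fact_Suc of_nat_mult)
  have 3: "1 / of_nat (m choose i) = (fact i * fact d / fact m :: rat)"
    using b[of i d] by (simp only: m)
  have 4: "(of_nat (Suc (Suc m)) :: rat) = of_nat (Suc d) + of_nat (Suc i)" by (simp add: m)
  have "x * (A * y) / (M * z) + B * x * y / (M * z) = (A + B) / M * (x * y / z)"
    for A B M x y z :: rat
    by (simp add: add_divide_distrib[symmetric] ring_distribs mult_ac)
  thus ?thesis unfolding 1 2 3 4 .
qed

text \<open>Summing \<open>inverse_choose_add\<close> over row \<open>m\<close> counts every
  reciprocal of row \<open>m + 1\<close> twice except the two ends. This yields a first-order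
  recurrence for the row sums.\<close>

lemma sum_inverse_choose:
  "(\<Sum>i\<le>m. 1 / of_nat (m choose i)) = (of_nat (Suc m) / 2 ^ Suc m * (\<Sum>j=1..Suc m. 2 ^ j / of_nat j) :: rat)"
proof (induction m)
  case (Suc m)
  define S :: "nat \<Rightarrow> rat" where "S = (\<lambda>m. \<Sum>i\<le>m. 1 / of_nat (m choose i))"
  have halve: "a + b = c \<Longrightarrow> s = a + 1 \<Longrightarrow> s = 1 + b \<Longrightarrow> s = 1 + c / 2" for a b c s :: rat
    by simp
  have "(\<Sum>i\<le>m. 1 / of_nat (Suc m choose i) + 1 / of_nat (Suc m choose Suc i)) =
      of_nat (Suc (Suc m)) / of_nat (Suc m) * S m"
    unfolding S_def sum_distrib_left by (intro sum.cong refl inverse_choose_add) auto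
  moreover have "S (Suc m) = (\<Sum>i\<le>m. 1 / of_nat (Suc m choose i)) + 1"
    unfolding S_def sum.atMost_Suc by (simp only: binomial_n_n)
  moreover have "S (Suc m) = 1 + (\<Sum>i\<le>m. 1 / of_nat (Suc m choose Suc i))"
    unfolding S_def sum.atMost_Suc_shift by (simp only: binomial_n_0)
  ultimately have "S (Suc m) = 1 + (of_nat (Suc (Suc m)) / of_nat (Suc m) * S m) / 2"
    unfolding sum.distrib by (rule halve)
  also have "S m = of_nat (Suc m) / 2 ^ Suc m * (\<Sum>j=1..Suc m. 2 ^ j / of_nat j)"
    using Suc unfolding S_def .
  also have "1 + (of_nat (Suc (Suc m)) / of_nat (Suc m) * (of_nat (Suc m) / 2 ^ Suc m * Y)) / 2 =
      of_nat (Suc (Suc m)) / 2 ^ Suc (Suc m) * (Y + 2 ^ Suc (Suc m) / of_nat (Suc (Suc m)))" for Y :: rat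
    by (simp add: distrib_left del: of_nat_Suc)
  finally show ?case unfolding S_def by (simp only: sum.cl_ivl_Suc) simp
qed simp

subsection \<open>A Wilf--Zeilberger pair and Clausen's formula\<close>

text \<open>A Wilf--Zeilberger pair: \<open>wzF j k - wzF (j + 1) k = wzG j (k + 1) - wzG j k\<close>.\<close>

definition wzF :: "nat \<Rightarrow> nat \<Rightarrow> rat" where
  "wzF j k = (if k < j then 0 else
     (4 * of_nat k + 1) * (- 1) ^ (k + j) * pochhammer (1/2) k ^ 2 * pochhammer (1/2) (j + k) /
     (pochhammer (1/2) j ^ 2 * fact k ^ 2 * fact (k - j)))"

definition wzG :: "nat \<Rightarrow> nat \<Rightarrow> rat" where
  "wzG j k = (if k \<le> j then 0 else
     2 * (- 1) ^ Suc (k + j) * pochhammer (1/2) k ^ 2 * pochhammer (1/2) (j + k) /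
     (pochhammer (1/2) (Suc j) ^ 2 * fact (k - 1) ^ 2 * fact (k - 1 - j)))"

lemma pochhammer_half_nonzero: "pochhammer (1/2 :: rat) k \<noteq> 0"
  using pochhammer_pos[of "1/2 :: rat" k] by simp

lemma wz_pair: "wzF j k - wzF (Suc j) k = wzG j (Suc k) - wzG j k"
proof -
  consider "k < j" | "k = j" | d where "k = Suc (j + d)"
    using less_imp_Suc_add by (metis linorder_less_linear)
  thus ?thesis
  proof cases
    case 1 thus ?thesis by (simp add: wzF_def wzG_def)
  next
    case 2
    have "wzF j j = (4 * of_nat j + 1) * pochhammer (1/2) (j + j) / fact j ^ 2"
      using pochhammer_half_nonzero[of j] by (simp add: wzF_def)
    moreover have "wzG j (Suc j) = 2 * pochhammer (1/2) (Suc (j + j)) / fact j ^ 2"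
      using pochhammer_half_nonzero[of "Suc j"] by (simp add: wzG_def)
    moreover have "wzF (Suc j) j = 0" "wzG j j = 0" by (simp_all add: wzF_def wzG_def)
    ultimately show ?thesis unfolding 2 by (simp add: pochhammer_Suc algebra_simps)
  next
    case 3
    define P Q R e :: rat where "P = pochhammer (1/2) k" and "Q = pochhammer (1/2) (j + k)"
      and "R = pochhammer (1/2) j" and "e = (- 1) ^ (k + j)"
    define f g x y :: rat where "f = fact (j + d)" and "g = fact d" and "x = of_nat j" and "y = of_nat d"
    have nz: "R \<noteq> 0" "f \<noteq> 0" "g \<noteq> 0" by (simp_all add: R_def f_def g_def pochhammer_half_nonzero)
    have nn: "x \<ge> 0" "y \<ge> 0" by (simp_all add: x_def y_def)
    have n: "x + 1/2 \<noteq> 0" "x + y + 1 \<noteq> 0" "y + 1 \<noteq> 0"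
      using nn by linarith+
    have k: "(of_nat k :: rat) = x + y + 1" by (simp add: 3 x_def y_def)
    have F1: "wzF j k = (4 * (x + y + 1) + 1) * e * P\<^sup>2 * Q / (R\<^sup>2 * ((x + y + 1) * f)\<^sup>2 * ((y + 1) * g))"
      unfolding wzF_def P_def Q_def R_def e_def f_def g_def k using 3
      by (simp add: x_def y_def add_ac)
    have F2: "wzF (Suc j) k = - ((4 * (x + y + 1) + 1) * e * P\<^sup>2 * (Q * (1/2 + (x + (x + y + 1)))) /
        ((R * (1/2 + x))\<^sup>2 * ((x + y + 1) * f)\<^sup>2 * g))"
      unfolding wzF_def P_def Q_def R_def e_def f_def g_def k using 3
      by (simp add: x_def y_def add_ac pochhammer_Suc)
    have G1: "wzG j (Suc k) = 2 * e * (P * (1/2 + (x + y + 1)))\<^sup>2 * (Q * (1/2 + (x + (x + y + 1)))) /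
        ((R * (1/2 + x))\<^sup>2 * ((x + y + 1) * f)\<^sup>2 * ((y + 1) * g))"
      unfolding wzG_def P_def Q_def R_def e_def f_def g_def using 3
      by (simp add: x_def y_def add_ac pochhammer_Suc)
    have G2: "wzG j k = - (2 * e * P\<^sup>2 * Q / ((R * (1/2 + x))\<^sup>2 * f\<^sup>2 * g))"
      unfolding wzG_def P_def Q_def R_def e_def f_def g_def using 3
      by (simp add: x_def y_def add_ac pochhammer_Suc)
    \<comment> \<open>All four terms are \<open>D\<close> times a rational function of
      \<open>a\<close>, \<open>b\<close>, \<open>c\<close>, so the pair reduces to the identity
      \<open>f5\<close>.\<close>
    define D where "D = e * P\<^sup>2 * Q / (R\<^sup>2 * f\<^sup>2 * g)"
    define a b c where "a = x + 1/2" and "b = x + y + 1" and "c = y + 1"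
    have nz': "a \<noteq> 0" "b \<noteq> 0" "c \<noteq> 0" using n by (simp_all add: a_def b_def c_def)
    have f1: "wzF j k = D * ((4 * b + 1) / (b\<^sup>2 * c))"
      unfolding F1 D_def by (simp add: b_def c_def power_mult_distrib mult_ac)
    have f2: "wzF (Suc j) k = - (D * ((4 * b + 1) * (a + b) / (a\<^sup>2 * b\<^sup>2)))"
      unfolding F2 D_def by (simp add: a_def b_def power_mult_distrib add_ac mult_ac)
    have f3: "wzG j (Suc k) = D * (2 * (1/2 + b)\<^sup>2 * (a + b) / (a\<^sup>2 * b\<^sup>2 * c))"
      unfolding G1 D_def by (simp add: a_def b_def c_def power_mult_distrib add_ac mult_ac)
    have f4: "wzG j k = - (D * (2 / a\<^sup>2))"
      unfolding G2 D_def by (simp add: a_def power_mult_distrib add_ac mult_ac)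
    have f5: "(4 * b + 1) / (b\<^sup>2 * c) + (4 * b + 1) * (a + b) / (a\<^sup>2 * b\<^sup>2) =
        2 * (1/2 + b)\<^sup>2 * (a + b) / (a\<^sup>2 * b\<^sup>2 * c) + 2 / a\<^sup>2"
    proof -
      have "(4 * b + 1) * a\<^sup>2 + (4 * b + 1) * (a + b) * c = 2 * (1/2 + b)\<^sup>2 * (a + b) + 2 * b\<^sup>2 * c"
        unfolding a_def b_def c_def by (simp add: power2_eq_square field_simps)
      moreover have "(4 * b + 1) / (b\<^sup>2 * c) + (4 * b + 1) * (a + b) / (a\<^sup>2 * b\<^sup>2) =
          ((4 * b + 1) * a\<^sup>2 + (4 * b + 1) * (a + b) * c) / (a\<^sup>2 * b\<^sup>2 * c)"
        using nz' by (simp add: add_divide_distrib)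
      moreover have "2 * (1/2 + b)\<^sup>2 * (a + b) / (a\<^sup>2 * b\<^sup>2 * c) + 2 / a\<^sup>2 =
          (2 * (1/2 + b)\<^sup>2 * (a + b) + 2 * b\<^sup>2 * c) / (a\<^sup>2 * b\<^sup>2 * c)"
        using nz' by (simp add: add_divide_distrib)
      ultimately show ?thesis by (simp only:)
    qed
    have "A + B = C + E \<Longrightarrow> D * A - - (D * B) = D * C - - (D * E)" for A B C E
      by (metis diff_minus_eq_add distrib_left)
    from this[OF f5] show ?thesis unfolding f1 f2 f3 f4 .
  qed
qed

text \<open>Partial sums of the series of Bauer and Ramanujan for 2 divided by pi.\<close>

definition wzsum :: "nat \<Rightarrow> rat" where
  "wzsum i = (\<Sum>k\<le>i. (4 * of_nat k + 1) * (- 1) ^ k * cb k ^ 3)"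

text \<open>The series is the edge \<open>j = 0\<close> of \<open>wzF\<close>. Raising
  \<open>N\<close> by one changes the column sum of \<open>wzG\<close> by a sum over
  \<open>j\<close> of differences of \<open>wzF\<close>, which telescopes to \<open>wzF 0 N\<close>
  because \<open>wzF\<close> vanishes below the diagonal.\<close>

lemma wzsum_eq: "wzsum i = (\<Sum>j\<le>i. wzG j (Suc i))"
proof -
  have "(\<Sum>k<N. wzF 0 k) = (\<Sum>j<N. wzG j N)" for N
  proof (induction N)
    case (Suc N)
    have "(\<Sum>j<Suc N. wzG j (Suc N) - wzG j N) = (\<Sum>j<Suc N. wzF j N - wzF (Suc j) N)"
      by (simp only: wz_pair)
    also have "\<dots> = wzF 0 N - wzF (Suc N) N"
      by (rule sum_lessThan_telescope')
    also have "\<dots> = wzF 0 N" by (simp add: wzF_def)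
    finally show ?case using Suc by (simp add: sum_subtractf wzG_def)
  qed simp
  moreover have "wzF 0 k = (4 * of_nat k + 1) * (- 1) ^ k * cb k ^ 3" for k
    by (simp add: wzF_def rising_def power2_eq_square power3_eq_cube)
  ultimately show ?thesis
    by (simp add: wzsum_def lessThan_Suc_atMost[symmetric])
qed

definition euler_op :: "rat poly \<Rightarrow> rat poly" where
  "euler_op f = [:0, 1:] * pderiv f"

lemma coeff_X_mult_0: "coeff ([:0, 1:] * f) 0 = 0"
  and coeff_X_mult_Suc: "coeff ([:0, 1:] * f) (Suc k) = coeff f k" for f :: "rat poly"
  by simp_all

lemma coeff_euler_op: "coeff (euler_op f) k = of_nat k * coeff f k"
  by (cases k) (simp_all add: coeff_pderiv euler_op_def)

lemma euler_op_mult: "euler_op (f * g) = f * euler_op g + euler_op f * g"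
  by (simp add: euler_op_def pderiv_mult algebra_simps)

lemma euler_op_add: "euler_op (f + g) = euler_op f + euler_op g"
  and euler_op_diff: "euler_op (f - g) = euler_op f - euler_op g"
  and euler_op_smult: "euler_op (smult c f) = smult c (euler_op f)"
  by (simp_all add: euler_op_def pderiv_add pderiv_diff pderiv_smult algebra_simps)

lemma euler_op_X: "euler_op [:0, 1:] = [:0, 1:]"
  by (simp add: euler_op_def pderiv_pCons)

text \<open>The terminating Gauss series with parameters \<open>- m\<close>, \<open>b\<close> over
  1.\<close>

definition hyp_poly :: "rat \<Rightarrow> nat \<Rightarrow> rat poly" where
  "hyp_poly b m = (\<Sum>k\<le>m. monom (rising (- of_nat m) k * rising b k) k)"

lemma coeff_hyp_poly: "coeff (hyp_poly b m) k = rising (- of_nat m) k * rising b k"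
  by (simp add: hyp_poly_def coeff_sum rising_minus_of_nat binomial_eq_0)

text \<open>The hypergeometric equation, with T for \<open>euler_op\<close>: T T u = X (T - m) (T +
  b) u, with the terms sorted by the order of T. On coefficients it is the term ratio.\<close>

lemma hyp_poly_ode:
  fixes b :: rat and m :: nat
  defines "X \<equiv> [:0, 1:]" and "u \<equiv> hyp_poly b m"
  defines "u1 \<equiv> euler_op u"
  shows "euler_op u1 - X * euler_op u1 = X * (smult (b - of_nat m) u1 - smult (of_nat m * b) u)"
proof (rule poly_eqI)
  fix k
  show "coeff (euler_op u1 - X * euler_op u1) k = coeff (X * (smult (b - of_nat m) u1 - smult (of_nat m * b) u)) k"
  proof (cases k)
    case 0
    thus ?thesis by (simp add: coeff_euler_op X_def)
  next
    case (Suc i)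
    have "of_nat (Suc i) * rising (- of_nat m) (Suc i) * (of_nat (Suc i) * rising b (Suc i)) =
        (of_nat i - of_nat m) * (b + of_nat i) * (rising (- of_nat m) i * rising b i)"
      unfolding rising_Suc by (simp add: algebra_simps)
    thus ?thesis
      unfolding Suc X_def u1_def u_def coeff_diff coeff_X_mult_Suc coeff_euler_op coeff_smult coeff_hyp_poly
      by (simp add: algebra_simps)
  qed
qed

text \<open>With T for \<open>euler_op\<close>, the assumption is a regrouping of T T T y = X (T +
  1/2) (T - n) (T + n + 1) y, the equation of the series with upper parameters \<open>- n\<close>,
  \<open>n + 1\<close>, \<open>1/2\<close> and lower parameters 1, 1. It determines all coefficients
  from the constant one. In this grouping the inner bracket collapses when \<open>y\<close> is built
  from the square of a Gauss series.\<close>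

lemma clausen_coeff:
  fixes y :: "rat poly" and n :: nat
  defines "X \<equiv> [:0, 1:]" and "\<kappa> \<equiv> of_nat n * (of_nat n + 1) / 4"
  defines "y1 \<equiv> euler_op y"
  assumes ode: "euler_op (euler_op y1 - X * euler_op y1 - X * (smult (1/2) y1 - smult (2 * \<kappa>) y)) =
      - (X * smult (2 * \<kappa>) y1)"
    and y0: "coeff y 0 = 1"
  shows "coeff y k = rising (- of_nat n) k * rising (of_nat n + 1) k * cb k"
proof (induction k)
  case 0
  show ?case by (simp add: y0)
next
  case (Suc k)
  define x where "x = (of_nat k :: rat)"
  have cX: "coeff (X * f) (Suc k) = coeff f k" for f by (simp add: X_def)
  have "coeff (euler_op (euler_op y1 - X * euler_op y1 - X * (smult (1/2) y1 - smult (2 * \<kappa>) y))) (Suc k) =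
      coeff (- (X * smult (2 * \<kappa>) y1)) (Suc k)"
    by (simp only: ode)
  hence "(x + 1) * ((x + 1) * ((x + 1) * coeff y (Suc k)) - x * (x * coeff y k) - (1/2 * (x * coeff y k) - 2 * \<kappa> * coeff y k))
      = - (2 * \<kappa> * (x * coeff y k))"
    unfolding y1_def coeff_euler_op coeff_diff cX coeff_minus coeff_smult
    by (simp add: x_def add.commute)
  hence "(x + 1) ^ 3 * coeff y (Suc k) = (x + 1/2) * (x - of_nat n) * (x + of_nat n + 1) * coeff y k"
    unfolding \<kappa>_def by (simp add: power3_eq_cube field_simps)
  also have "\<dots> = ((- of_nat n + x) * rising (- of_nat n) k) * ((of_nat n + 1 + x) * rising (of_nat n + 1) k) * ((1/2 + x) * cb k)"
  proof -
    have "- of_nat n + x = x - of_nat n" "of_nat n + 1 + x = x + of_nat n + 1" "1/2 + x = x + 1/2"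
      by simp_all
    thus ?thesis unfolding Suc by (simp only: mult_ac)
  qed
  also have "\<dots> = (x + 1) ^ 3 * (rising (- of_nat n) (Suc k) * rising (of_nat n + 1) (Suc k) * cb (Suc k))"
    unfolding x_def rising_Suc[symmetric] by (simp add: power3_eq_cube mult_ac add.commute)
  finally show ?case
    by (simp add: x_def add_nonneg_eq_0_iff)
qed

definition clausen_value :: "nat \<Rightarrow> rat" where
  "clausen_value n = (\<Sum>k\<le>n. (- 1) ^ k * (rising (- of_nat n) k * rising (of_nat n + 1) k * cb k))"

lemma poly_eq_sum_coeff:
  fixes f :: "rat poly"
  assumes "\<And>k. k > n \<Longrightarrow> coeff f k = 0" shows "poly f x = (\<Sum>k\<le>n. coeff f k * x ^ k)"
proof -
  have "degree f \<le> n" using assms by (intro degree_le) auto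
  hence "(\<Sum>k\<le>degree f. coeff f k * x ^ k) = (\<Sum>k\<le>n. coeff f k * x ^ k)"
    by (intro sum.mono_neutral_left) (auto simp: coeff_eq_0)
  thus ?thesis by (simp add: poly_altdef)
qed

lemma poly_clausen:
  assumes "\<And>k. coeff y k = rising (- of_nat n) k * rising (of_nat n + 1) k * cb k"
  shows "poly y (- 1) = clausen_value n"
  by (subst poly_eq_sum_coeff[of n]) (auto simp: assms clausen_value_def rising_minus_of_nat binomial_eq_0 mult_ac)

definition legendre_value :: "rat \<Rightarrow> nat \<Rightarrow> rat" where
  "legendre_value b m = (\<Sum>k\<le>m. of_nat (m choose k) * rising b k)"

lemma poly_hyp_poly: "poly (hyp_poly b m) (- 1) = legendre_value b m"
  by (simp add: hyp_poly_def legendre_value_def poly_sum poly_monom rising_minus_of_nat mult_ac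
      flip: power_mult_distrib)

text \<open>Clausen's formula as an identity of polynomials, then evaluated at \<open>- 1\<close>:
  the square of the Gauss polynomial with parameters \<open>- m\<close>, \<open>m + 1/2\<close>
  satisfies the equation of \<open>clausen_coeff\<close> for \<open>2 * m\<close>.\<close>

lemma clausen_even: "clausen_value (2 * m) = legendre_value (of_nat m + 1/2) m ^ 2"
proof -
  define X :: "rat poly" where "X = [:0, 1:]"
  define u where "u = hyp_poly (of_nat m + 1/2) m"
  define u1 where "u1 = euler_op u"
  define K :: rat where "K = of_nat m * (of_nat m + 1/2)"
  define y where "y = u * u"
  have ode: "euler_op u1 = X * euler_op u1 + X * (smult (1/2) u1 - smult K u)"
    using hyp_poly_ode[of "of_nat m + 1/2" m] unfolding u1_def u_def X_def K_def
    by (simp add: algebra_simps)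
  \<comment> \<open>The rational constants become polynomials \<open>h\<close> and \<open>k\<close>,
    so that the identities below are ring identities in \<open>h\<close>, \<open>k\<close>,
    \<open>X\<close>, \<open>u\<close>, \<open>u1\<close>, \<open>u2\<close>, up to multiples of the
    two vanishing expressions in \<open>z\<close> and \<open>hz\<close>.\<close>
  define h k :: "rat poly" where "h = [:1/2:]" and "k = [:K:]"
  have sm: "smult (1/2) f = h * f" "smult K f = k * f" "smult (2 * K) f = 2 * k * f" for f
    by (simp_all add: h_def k_def numeral_poly mult.commute)
  have hh: "h + h = 1" by (simp add: h_def one_pCons)
  define u2 where "u2 = euler_op u1"
  have z: "u2 - X * u2 - X * (h * u1 - k * u) = 0" and hz: "h + h - 1 = 0"
    using ode hh unfolding u2_def sm by simp_all
  have y1: "euler_op y = u * u1 + u1 * u"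
    unfolding y_def u1_def by (rule euler_op_mult)
  have y2: "euler_op (euler_op y) = 2 * (u1 * u1) + 2 * (u * u2)"
    unfolding y1 euler_op_add euler_op_mult u2_def u1_def[symmetric] by (simp add: algebra_simps)
  have Y: "euler_op (euler_op y) - X * euler_op (euler_op y) - X * (smult (1/2) (euler_op y) - smult (2 * K) y)
      = 2 * (u1 * u1) - 2 * (X * (u1 * u1))"
    proof -
    have "2 * (u1 * u1) + 2 * (u * u2) - X * (2 * (u1 * u1) + 2 * (u * u2)) -
        X * (h * (u * u1 + u1 * u) - 2 * k * (u * u)) - (2 * (u1 * u1) - 2 * (X * (u1 * u1))) =
        2 * u * (u2 - X * u2 - X * (h * u1 - k * u))"
      by (simp add: algebra_simps)
    thus ?thesis unfolding sm y2 unfolding y1 unfolding y_def z by simp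
  qed
  have Yd: "euler_op (2 * (u1 * u1) - 2 * (X * (u1 * u1))) =
      4 * (u1 * u2) - 4 * (X * (u1 * u2)) - 2 * (X * (u1 * u1))"
  proof -
    have "euler_op (2 * f) = 2 * euler_op f" for f using euler_op_smult[of 2 f] by (simp add: numeral_poly)
    thus ?thesis
      unfolding euler_op_diff euler_op_mult[of X] euler_op_mult[of u1] u2_def[symmetric]
      by (simp only: euler_op_diff euler_op_mult[of X] euler_op_mult[of u1] u2_def[symmetric]
            euler_op_X[folded X_def]) (simp add: algebra_simps)
  qed
  have "euler_op (euler_op (euler_op y) - X * euler_op (euler_op y) - X * (smult (1/2) (euler_op y) - smult (2 * K) y))
      = - (X * smult (2 * K) (euler_op y))"
    proof -
    have "4 * (u1 * u2) - 4 * (X * (u1 * u2)) - 2 * (X * (u1 * u1)) - - (X * (2 * k * (u * u1 + u1 * u))) =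
        4 * u1 * (u2 - X * u2 - X * (h * u1 - k * u)) + 2 * X * u1 * u1 * (h + h - 1)"
      by (simp add: algebra_simps)
    thus ?thesis unfolding Y Yd unfolding sm y1 z hz by simp
  qed
  moreover have "K = of_nat (2 * m) * (of_nat (2 * m) + 1) / 4" by (simp add: K_def algebra_simps)
  moreover have "coeff y 0 = 1" by (simp add: y_def coeff_mult u_def coeff_hyp_poly)
  ultimately have "coeff y k = rising (- of_nat (2 * m)) k * rising (of_nat (2 * m) + 1) k * cb k" for k
    using clausen_coeff[of y "2 * m" k] unfolding X_def by simp
  hence "poly y (- 1) = clausen_value (2 * m)" by (rule poly_clausen)
  thus ?thesis by (simp add: y_def u_def poly_hyp_poly power2_eq_square)
qed

text \<open>For odd index the Gauss series in Clausen's formula has the parameters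
  \<open>- m - 1/2\<close>, \<open>m + 1\<close> and does not terminate. Euler's transformation
  writes it as the square root of \<open>1 - x\<close> times a polynomial with parameters
  \<open>- m\<close>, \<open>m + 3/2\<close>. Squaring leaves the factor \<open>1 - x\<close>, which
  is 2 at \<open>- 1\<close>.\<close>

lemma clausen_odd: "clausen_value (2 * m + 1) = 2 * legendre_value (of_nat m + 3/2) m ^ 2"
proof -
  define X :: "rat poly" where "X = [:0, 1:]"
  define u where "u = hyp_poly (of_nat m + 3/2) m"
  define u1 where "u1 = euler_op u"
  define K :: rat where "K = of_nat m * (of_nat m + 3/2)"
  define y where "y = u * u - X * (u * u)"
  have ode: "euler_op u1 = X * euler_op u1 + X * (smult (3/2) u1 - smult K u)"
    using hyp_poly_ode[of "of_nat m + 3/2" m] unfolding u1_def u_def X_def K_def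
    by (simp add: algebra_simps)
  define h k :: "rat poly" where "h = [:1/2:]" and "k = [:K:]"
  have sm: "smult (1/2) f = h * f" "smult (3/2) f = 3 * h * f" "smult K f = k * f"
    "smult (2 * (K + 1/2)) f = (2 * k + 1) * f" for f
    by (simp_all add: h_def k_def numeral_poly algebra_simps smult_add_left)
  have hh: "h + h = 1" by (simp add: h_def one_pCons)
  define u2 where "u2 = euler_op u1"
  have z: "u2 - X * u2 - X * (3 * h * u1 - k * u) = 0" and hz: "h + h - 1 = 0"
    using ode hh unfolding u2_def sm by simp_all
  have e2: "euler_op (2 * f) = 2 * euler_op f" "euler_op (4 * f) = 4 * euler_op f" for f
    using euler_op_smult[of 2 f] euler_op_smult[of 4 f] by (simp_all add: numeral_poly)
  note rules = euler_op_diff euler_op_add euler_op_mult[of X] euler_op_mult[of u1] euler_op_mult[of u]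
     u1_def[symmetric] u2_def[symmetric] euler_op_X[folded X_def] e2
  have y1: "euler_op y = 2 * (u * u1) - X * (u * u) - 2 * (X * (u * u1))"
    unfolding y_def by (simp only: rules) (simp add: algebra_simps)
  have y2: "euler_op (euler_op y) = 2 * (u1 * u1) + 2 * (u * u2) - X * (u * u) - 4 * (X * (u * u1))
      - 2 * (X * (u1 * u1)) - 2 * (X * (u * u2))"
    unfolding y1 by (simp only: rules) (simp add: algebra_simps)
  have Y: "euler_op (euler_op y) - X * euler_op (euler_op y) - X * (smult (1/2) (euler_op y) - smult (2 * (K + 1/2)) y)
      = 2 * (u1 * u1) - 4 * (X * (u1 * u1)) + 2 * (X * (X * (u1 * u1))) - 2 * (X * (u * u1))
        + 2 * (X * (X * (u * u1))) + h * (X * (X * (u * u)))"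
    proof -
    define lhs rhs where
      "lhs = 2 * (u1 * u1) + 2 * (u * u2) - X * (u * u) - 4 * (X * (u * u1))
        - 2 * (X * (u1 * u1)) - 2 * (X * (u * u2)) -
        X * (2 * (u1 * u1) + 2 * (u * u2) - X * (u * u) - 4 * (X * (u * u1))
        - 2 * (X * (u1 * u1)) - 2 * (X * (u * u2))) -
        X * (h * (2 * (u * u1) - X * (u * u) - 2 * (X * (u * u1))) - (2 * k + 1) * (u * u - X * (u * u)))"
      and "rhs = 2 * (u1 * u1) - 4 * (X * (u1 * u1)) + 2 * (X * (X * (u1 * u1))) - 2 * (X * (u * u1))
        + 2 * (X * (X * (u * u1))) + h * (X * (X * (u * u)))"
    \<comment> \<open>An explicit cofactor representation: the difference is a combination of the
      equation of \<open>u\<close> and of \<open>h + h - 1\<close>, both of which are zero.\<close>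
    have "lhs - rhs = 2 * u * (1 - X) * (u2 - X * u2 - X * (3 * h * u1 - k * u))
        + 2 * X * (1 - X) * u * u1 * (h + h - 1)"
      unfolding lhs_def rhs_def by (simp add: algebra_simps)
    hence "lhs = rhs" unfolding z hz by simp
    thus ?thesis unfolding sm y2 unfolding y1 unfolding y_def lhs_def rhs_def .
  qed
  have eh: "euler_op (h * f) = h * euler_op f" for f using euler_op_smult[of "1/2" f] by (simp add: h_def)
  define E where "E = 2 * (u1 * u2 + u2 * u1) - 4 * (X * (u1 * u2 + u2 * u1) + X * (u1 * u1))
      + 2 * (X * (X * (u1 * u2 + u2 * u1) + X * (u1 * u1)) + X * (X * (u1 * u1)))
      - 2 * (X * (u * u2 + u1 * u1) + X * (u * u1))
      + 2 * (X * (X * (u * u2 + u1 * u1) + X * (u * u1)) + X * (X * (u * u1)))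
      + h * (X * (X * (u * u1 + u1 * u) + X * (u * u)) + X * (X * (u * u)))"
  have "euler_op (2 * (u1 * u1) - 4 * (X * (u1 * u1)) + 2 * (X * (X * (u1 * u1))) - 2 * (X * (u * u1))
        + 2 * (X * (X * (u * u1))) + h * (X * (X * (u * u)))) = - (X * ((2 * k + 1) * euler_op y))"
    proof -
    have "E - - (X * ((2 * k + 1) * (2 * (u * u1) - X * (u * u) - 2 * (X * (u * u1))))) =
        (4 * u1 * (1 - X) - 2 * X * u) * (u2 - X * u2 - X * (3 * h * u1 - k * u))
        + (h + h - 1) * (6 * X * (1 - X) * u1 * u1 - 2 * X * X * u * u1 + X * X * u * u)"
      unfolding E_def by (simp add: algebra_simps)
    hence "E = - (X * ((2 * k + 1) * (2 * (u * u1) - X * (u * u) - 2 * (X * (u * u1)))))"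
      unfolding z hz by simp
    thus ?thesis unfolding y1 E_def by (simp only: rules eh)
  qed
  hence "euler_op (euler_op (euler_op y) - X * euler_op (euler_op y) - X * (smult (1/2) (euler_op y) - smult (2 * (K + 1/2)) y))
      = - (X * smult (2 * (K + 1/2)) (euler_op y))"
    unfolding Y unfolding sm .
  moreover have "K + 1/2 = of_nat (2 * m + 1) * (of_nat (2 * m + 1) + 1) / 4" by (simp add: K_def algebra_simps)
  moreover have "coeff y 0 = 1" by (simp add: y_def X_def coeff_mult u_def coeff_hyp_poly)
  ultimately have "coeff y k = rising (- of_nat (2 * m + 1)) k * rising (of_nat (2 * m + 1) + 1) k * cb k" for k
    using clausen_coeff[of y "2 * m + 1" k] unfolding X_def by simp
  hence "poly y (- 1) = clausen_value (2 * m + 1)" by (rule poly_clausen)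
  thus ?thesis by (simp add: y_def u_def X_def poly_hyp_poly power2_eq_square)
qed

text \<open>The left side is the coefficient of \<open>t ^ m\<close> in the product of
  \<open>(1 + t) ^ m\<close> with the binomial series of \<open>1 - t\<close> of parameter
  \<open>x - m\<close>. Pairing \<open>(1 - t) ^ m\<close> with \<open>(1 + t) ^ m\<close> leaves a
  polynomial in \<open>t ^ 2\<close> times the series of parameter \<open>x\<close>. For
  \<open>x = p / 2\<close> almost every term then carries a factor \<open>p\<close>.\<close>

lemma legendre_value_convolution:
  "legendre_value (x - of_nat m) m =
     (\<Sum>h\<le>m div 2. (- 1) ^ h * of_nat (m choose h) * rising x (m - 2 * h))"
proof -
  define R where "R a = Abs_fps (rising a)" for a
  have R_add: "R (a + b) = R a * R b" for a b
    by (intro fps_ext) (simp add: R_def fps_mult_nth rising_vandermonde[symmetric] atLeast0AtMost)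
  have R_m: "R (- of_nat m) = (1 - fps_X) ^ m" for m
  proof (induction m)
    case 0
    show ?case by (intro fps_ext) (simp add: R_def rising_minus_of_nat[of 0, simplified] binomial_eq_0 split: nat.split)
  next
    case (Suc m)
    have "R (- 1) = 1 - fps_X"
      using rising_minus_of_nat[of 1]
      by (intro fps_ext) (auto simp: R_def fps_X_def binomial_eq_0 less_Suc_eq_0_disj not_less_eq split: if_splits)
    moreover have "- of_nat (Suc m) = (- of_nat m + - 1 :: rat)" by simp
    ultimately show ?case using R_add[of "- of_nat m" "- 1"] Suc by (simp only: power_Suc2)
  qed
  have C: "((1 + fps_X :: rat fps) ^ m) $ k = of_nat (m choose k)" for k
    using fps_binomial_nth[of "of_nat m :: rat" k] by (simp add: fps_binomial_of_nat binomial_gbinomial)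
  have "legendre_value (x - of_nat m) m = (R (x - of_nat m) * (1 + fps_X) ^ m) $ m"
    unfolding fps_mult_nth C legendre_value_def
    by (intro sum.cong) (auto simp: R_def binomial_symmetric[symmetric])
  also have "R (x - of_nat m) * (1 + fps_X) ^ m = ((1 - fps_X) * (1 + fps_X)) ^ m * R x"
    using R_add[of x "- of_nat m"] by (simp add: R_m power_mult_distrib mult_ac)
  also have "(1 - fps_X) * (1 + fps_X) = (- (fps_X ^ 2) + 1 :: rat fps)"
    by (simp add: algebra_simps power2_eq_square)
  also have "(- (fps_X ^ 2) + 1 :: rat fps) ^ m = (\<Sum>h\<le>m. of_nat (m choose h) * (- (fps_X ^ 2)) ^ h)"
    by (subst binomial_ring) simp
  also have "\<dots> * R x = (\<Sum>h\<le>m. fps_const ((- 1) ^ h * of_nat (m choose h)) * (fps_X ^ (2 * h) * R x))"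
  proof -
    have m1: "(- 1 :: rat fps) = fps_const (- 1)" by (simp flip: fps_const_neg)
    have "of_nat (m choose h) * (- (fps_X ^ 2)) ^ h =
        (fps_const ((- 1) ^ h * of_nat (m choose h)) * fps_X ^ (2 * h) :: rat fps)" for h
      unfolding power_minus[of "fps_X ^ 2"] m1 fps_const_power power_mult fps_of_nat[symmetric]
        fps_const_mult[symmetric] by (simp only: mult_ac)
    thus ?thesis by (simp only: sum_distrib_right mult.assoc)
  qed
  also have "\<dots> $ m = (\<Sum>h\<le>m. (- 1) ^ h * of_nat (m choose h) * (if m < 2 * h then 0 else rising x (m - 2 * h)))"
    by (simp add: fps_sum_nth fps_X_power_mult_nth R_def cong: if_cong)
  also have "\<dots> = (\<Sum>h\<le>m div 2. (- 1) ^ h * of_nat (m choose h) * rising x (m - 2 * h))"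
    by (rule sum.mono_neutral_cong_right) auto
  finally show ?thesis .
qed

section \<open>Congruences for binomial coefficients, powers of 2 and harmonic sums\<close>

context odd_prime
begin

lemma n_pos: "n > 0" and n_less: "n < p"
  using p_eq p_ge_3 by auto

lemma of_nat_n: "(of_nat n :: rat) = of_nat p / 2 - 1 / 2"
  by (simp add: p_eq field_simps)

lemma cg_p_half: "cg 1 (of_nat p / 2) 0"
  using cg_p[of "1/2"] L_divide[of 1 2] by simp

lemma L_half [simp]: "x \<in> L \<Longrightarrow> x / 2 \<in> L"
  by (intro L_divide) auto

lemma unit_half [simp]: "unit (1/2)"
  using unit_inverse[OF unit_2] by (simp add: inverse_eq_divide)

lemma cg_unlift:
  assumes "cg 2 (of_nat p * a) (of_nat p * b)" shows "cg 1 a b"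
proof -
  obtain c where c: "c \<in> L" "of_nat p * a = of_nat p * b + of_nat p ^ 2 * c"
    using cg_0D[OF assms] by blast
  have "of_nat p * a = of_nat p * (b + of_nat p ^ 1 * c)"
    using c(2) by (simp add: algebra_simps power2_eq_square)
  hence "a = b + of_nat p ^ 1 * c" using p_gt_0 by simp
  thus ?thesis using c(1) by (rule cg_I)
qed

lemma cg_2_0: "a \<in> L \<Longrightarrow> b \<in> L \<Longrightarrow> cg 1 a 0 \<Longrightarrow> cg 1 b 0 \<Longrightarrow> cg 2 (a * b) 0"
proof -
  assume "a \<in> L" "b \<in> L" "cg 1 a 0" "cg 1 b 0"
  then obtain c d where "c \<in> L" "d \<in> L" "a = of_nat p * c" "b = of_nat p * d"
    using cg_0D[of 1 a 0] cg_0D[of 1 b 0] by auto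
  thus ?thesis by (intro cg_I[of _ _ _ "c * d"]) (auto simp: power2_eq_square)
qed

lemma L_pochhammer: "a \<in> L \<Longrightarrow> pochhammer a k \<in> L"
  unfolding pochhammer_prod by (intro L_prod L_add) auto

lemma cg_pochhammer: "cg k a b \<Longrightarrow> b \<in> L \<Longrightarrow> cg k (pochhammer a j) (pochhammer b j)"
  unfolding pochhammer_prod by (intro cg_prod cg_add) auto

lemma cg_rising: "cg k a b \<Longrightarrow> b \<in> L \<Longrightarrow> j < p \<Longrightarrow> cg k (rising a j) (rising b j)"
  unfolding rising_def by (intro cg_divide cg_pochhammer L_pochhammer unit_fact) auto

lemma rising_1 [simp]: "rising 1 k = 1"
  by (simp add: rising_def pochhammer_fact[symmetric])

lemma L_cb [simp]: "cb k \<in> L"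
  unfolding cb_eq by (intro L_divide unit_power) auto

text \<open>The two sides differ by exactly \<open>p / 2\<close>. Through this congruence rising
  factorials of \<open>1/2\<close> become binomial coefficients with upper entry
  \<open>n\<close>.\<close>

lemma cg_half: "cg 1 (1/2) (- of_nat n)"
  using cg_add[OF cg_refl[of 1 "- of_nat n"] cg_p_half] by (simp add: of_nat_n)

lemma cg_cb: "j < p \<Longrightarrow> cg 1 (cb j) ((- 1) ^ j * of_nat (n choose j))"
  using cg_rising[OF cg_half, of j] by (simp add: rising_minus_of_nat)

lemma unit_cb: "j \<le> n \<Longrightarrow> unit (cb j)"
  using n_less by (intro cg_unit[OF cg_cb]) (auto intro!: unit_mult unit_binomial)

lemma cg_cb_0: "n < j \<Longrightarrow> j < p \<Longrightarrow> cg 1 (cb j) 0"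
  using cg_cb[of j] by (simp add: binomial_eq_0)

text \<open>The leading factor \<open>p / 2\<close> of the Pochhammer symbol already contains
  \<open>p\<close>, so the other factors are needed only modulo \<open>p\<close>, where they form a
  factorial.\<close>

lemma cg_rising_p_half:
  assumes "0 < j" "j < p" shows "cg 2 (rising (of_nat p / 2) j) (of_nat p * (1 / (2 * of_nat j)))"
proof -
  obtain i where i: "j = Suc i" using assms(1) gr0_implies_Suc by blast
  have "cg 1 (rising (of_nat p / 2 + 1) i) (rising (0 + 1) i)"
    using assms i by (intro cg_rising cg_add cg_p_half) auto
  hence "cg 2 (of_nat p * (1 / (2 * of_nat j) * rising (of_nat p / 2 + 1) i)) (of_nat p * (1 / (2 * of_nat j) * 1))"
    using assms by (intro cg_lift cg_mult_left L_divide unit_mult unit_of_nat_less) auto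
  moreover have "rising (of_nat p / 2) j = of_nat p * (1 / (2 * of_nat j) * rising (of_nat p / 2 + 1) i)"
    by (simp add: i rising_def pochhammer_rec divide_simps del: of_nat_Suc)
  ultimately show ?thesis by simp
qed

lemma cg_choose_pred: "r < p \<Longrightarrow> cg 1 (of_nat ((p - 1) choose r)) ((- 1) ^ r)"
proof -
  assume r: "r < p"
  have "cg 1 (- of_nat (p - 1)) (1 :: rat)"
    using p_gt_0 by (intro cg_I[of _ _ _ "-1"]) (auto simp: of_nat_diff)
  hence "cg 1 ((- 1) ^ r * rising (- of_nat (p - 1)) r) ((- 1) ^ r * rising 1 r)"
    using r by (intro cg_mult_left cg_rising) auto
  thus ?thesis by (simp add: rising_minus_of_nat flip: power_mult_distrib)
qed

lemma cg_choose_p: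
  assumes "0 < j" "j < p"
  shows "cg 2 (of_nat (p choose j)) (of_nat p * ((- 1) ^ (j - 1) / of_nat j))"
proof -
  have "j * (p choose j) = p * ((p - 1) choose (j - 1))"
    using binomial_absorption[of "j - 1" p] assms(1) by simp
  hence "of_nat j * of_nat (p choose j) = (of_nat p * of_nat ((p - 1) choose (j - 1)) :: rat)"
    by (simp flip: of_nat_mult)
  hence "of_nat (p choose j) = (of_nat p * (1 / of_nat j * of_nat ((p - 1) choose (j - 1))) :: rat)"
    using assms(1) by (simp add: field_simps)
  moreover have "cg 2 (of_nat p * (1 / of_nat j * of_nat ((p - 1) choose (j - 1))))
      (of_nat p * (1 / of_nat j * (- 1) ^ (j - 1)))"
    using assms by (intro cg_lift cg_mult_left cg_choose_pred L_divide unit_of_nat_less) auto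
  ultimately show ?thesis by simp
qed

lemma cg_p_0: "cg 1 (of_nat p) 0"
  using cg_p[of 1] by simp

lemma cg_two_power_p: "cg 1 (2 ^ p) 2"
proof -
  have "\<not> p dvd 2" using p_ge_3 by (auto dest: dvd_imp_le)
  hence "[2 ^ (p - 1) = 1] (mod p)" using prime_p by (intro fermat_theorem) auto
  hence "int p dvd int (2 ^ (p - 1)) - int 1"
    by (simp only: cong_iff_dvd_diff flip: cong_int_iff)
  hence "cg 1 (of_nat (2 ^ (p - 1))) (of_nat 1)" unfolding cg_of_nat_iff by simp
  hence "cg 1 (2 * 2 ^ (p - 1)) (2 * 1)" by (intro cg_mult_left) auto
  thus ?thesis using p_gt_0 by (simp flip: power_Suc)
qed

lemma cg_two_power: "cg 1 (2 ^ n) (1 / 2 ^ n)"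
proof -
  have "(2 :: rat) ^ p = 2 * (2 ^ n * 2 ^ n)"
    unfolding p_eq by (simp add: mult_2[of n] power_add)
  hence "cg 1 (2 * (2 ^ n * 2 ^ n)) (2 * 1)" using cg_two_power_p by (simp only: mult_1_right)
  hence "cg 1 (2 ^ n * 2 ^ n) 1" by (simp only: cg_mult_unit_iff unit_2)
  hence "cg 1 (1 / 2 ^ n * (2 ^ n * 2 ^ n)) (1 / 2 ^ n * 1)" by (intro cg_mult_left L_divide) auto
  thus ?thesis by simp
qed

lemma cg_choose_2p: "cg 1 (of_nat ((2 * p) choose p)) 2"
proof -
  have "cg 1 (rising (of_nat p + 1) (p - 1)) (rising (0 + 1) (p - 1))"
    using p_gt_0 by (intro cg_rising cg_add cg_p_0) auto
  hence "cg 1 (2 * of_nat ((p + (p - 1)) choose p)) (2 * 1)"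
    unfolding rising_of_nat_Suc by (intro cg_mult_left) auto
  moreover have "p + (p - 1) = 2 * p - 1" "2 * p - p = p" using p_gt_0 by auto
  hence "p * ((2 * p) choose p) = p * (2 * ((p + (p - 1)) choose p))"
    using binomial_absorb_comp[of "2 * p" p] by (simp only: mult_ac)
  hence "(2 * p) choose p = 2 * ((p + (p - 1)) choose p)" using p_gt_0 by (simp only: mult_left_cancel)
  ultimately show ?thesis by simp
qed

lemma cg_cb_p: "cg 1 (cb p) (1/2)"
proof -
  have "cg 1 ((2 ^ p) ^ 2) (2 ^ 2)" by (intro cg_power cg_two_power_p) auto
  hence "cg 1 (of_nat ((2 * p) choose p) / 4 ^ p) (2 / 4)"
    by (intro cg_divide cg_choose_2p unit_power)
       (auto simp: power2_eq_square simp flip: power_mult_distrib)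
  thus ?thesis by (simp add: cb_eq)
qed

lemma cg_central: "cg 1 (of_nat ((2 * n) choose n)) ((- 1) ^ n)"
proof -
  have "p - 1 = 2 * n" by (simp add: p_eq)
  thus ?thesis using cg_choose_pred[OF n_less] by simp
qed

lemma sum_reflect: "(\<Sum>j=1..p-1. f (p - j)) = (\<Sum>j=1..p-1. f j)" for f :: "nat \<Rightarrow> rat"
  using sum.atLeastAtMost_rev[of f 1 "p - 1"] p_gt_0 by simp

lemma cg_inverse_reflect: "0 < j \<Longrightarrow> j < p \<Longrightarrow> cg 1 (1 / of_nat (p - j)) (- (1 / of_nat j))"
proof -
  assume j: "0 < j" "j < p"
  have "cg 1 (of_nat (p - j)) (- of_nat j :: rat)"
    using j by (intro cg_I[of _ _ _ 1]) (auto simp: of_nat_diff)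
  hence "cg 1 (1 / of_nat (p - j)) (1 / (- of_nat j))"
    using j by (intro cg_divide unit_minus unit_of_nat_less) auto
  thus ?thesis by simp
qed

lemma cg_rharm_pred: "cg 1 (rharm (p - 1)) 0"
proof -
  have "cg 1 (\<Sum>j=1..p-1. 1 / of_nat (p - j)) (\<Sum>j=1..p-1. - (1 / of_nat j))"
    by (intro cg_sum cg_inverse_reflect) (use p_gt_0 in auto)
  hence "cg 1 (rharm (p - 1)) (- rharm (p - 1))"
    using sum_reflect[of "\<lambda>j. 1 / of_nat j"] by (simp add: rharm_def sum_negf)
  hence "cg 1 (rharm (p - 1) + rharm (p - 1)) (- rharm (p - 1) + rharm (p - 1))"
    by (intro cg_add cg_refl)
  hence "cg 1 (2 * rharm (p - 1)) (2 * 0)" by simp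
  thus ?thesis by (simp only: cg_mult_unit_iff unit_2)
qed

lemma alternating_harmonic:
  "(\<Sum>j=1..2*m. (- 1) ^ (j - 1) / of_nat j) = rharm (2 * m) - rharm m"
proof (induction m)
  case (Suc m)
  have "rharm (2 * Suc m) = rharm (2 * m) + 1 / of_nat (2 * m + 1) + 1 / of_nat (2 * m + 2)"
    by (simp add: rharm_Suc)
  moreover have "rharm (Suc m) = rharm m + 2 / of_nat (2 * m + 2)"
  proof -
    have e: "of_nat (2 * m + 2) = 2 * (of_nat (Suc m) :: rat)" by simp
    show ?thesis unfolding e by (simp add: rharm_Suc del: of_nat_Suc)
  qed
  ultimately have "rharm (2 * Suc m) - rharm (Suc m) =
      rharm (2 * m) - rharm m + 1 / of_nat (2 * m + 1) - 1 / of_nat (2 * m + 2)"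
    by (simp del: of_nat_add of_nat_mult)
  also have "\<dots> = (\<Sum>j=1..2*Suc m. (- 1) ^ (j - 1) / of_nat j)"
    unfolding Suc[symmetric] by simp
  finally show ?case ..
qed (simp add: rharm_def)

text \<open>\<open>X2\<close> comes from the value of \<open>tm n\<close>, and \<open>Y2\<close>
  below from the sum of reciprocal binomial coefficients; the result contains them only as
  \<open>Y2 - 2 * X2\<close>.\<close>

definition X2 :: rat where
  "X2 = (\<Sum>j=1..n. 1 / (of_nat j * 2 ^ j))"

definition Y2 :: rat where
  "Y2 = (\<Sum>j=1..n. 2 ^ j / of_nat j)"

lemma L_X2: "X2 \<in> L" and L_Y2: "Y2 \<in> L"
  unfolding X2_def Y2_def using n_less
  by (auto intro!: L_sum L_divide unit_mult unit_of_nat_less)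

lemma L_rharm_n [simp]: "rharm n \<in> L"
  using L_rharm n_less by blast

text \<open>Both sides of the first congruence compute \<open>(2 ^ p - 2) / p\<close>, expanding \<open>(1 + 1) ^ p\<close>
  and \<open>(1 - 2) ^ p\<close>.\<close>

lemma cg_Y2: "cg 1 (Y2 - 2 * X2) (rharm n)"
proof -
  have expand: "(x + 1) ^ p = 1 + (\<Sum>j=1..p-1. of_nat (p choose j) * x ^ j) + x ^ p" for x :: rat
  proof -
    have "{..p} = insert 0 (insert p {1..p-1})" using p_gt_0 by auto
    thus ?thesis using p_gt_0 by (subst binomial_ring) (simp add: add_ac)
  qed
  have cgx: "cg 2 (\<Sum>j=1..p-1. of_nat (p choose j) * x ^ j) (of_nat p * (\<Sum>j=1..p-1. (- 1) ^ (j - 1) / of_nat j * x ^ j))"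
    if "x \<in> L" for x
    unfolding sum_distrib_left mult.assoc[symmetric]
    by (intro cg_sum cg_mult_right cg_choose_p) (use that p_gt_0 in auto)
  define A B :: rat where "A = (\<Sum>j=1..p-1. (- 1) ^ (j - 1) / of_nat j * 1 ^ j)"
    and "B = (\<Sum>j=1..p-1. (- 1) ^ (j - 1) / of_nat j * (- 2) ^ j)"
  have "(\<Sum>j=1..p-1. of_nat (p choose j) * 1 ^ j) = (2 ^ p - 2 :: rat)"
    using expand[of 1] by simp
  hence 1: "cg 2 (2 ^ p - 2) (of_nat p * A)"
    using cgx[of 1] unfolding A_def by simp
  have "(\<Sum>j=1..p-1. of_nat (p choose j) * (- 2) ^ j) = (2 ^ p - 2 :: rat)"
    using expand[of "- 2"] odd_p by simp
  hence 2: "cg 2 (2 ^ p - 2) (of_nat p * B)"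
    using cgx[of "- 2"] unfolding B_def by simp
  have "cg 2 (of_nat p * A) (of_nat p * B)"
    by (rule cg_trans[OF cg_sym[OF 1] 2])
  hence AB: "cg 1 A B" by (rule cg_unlift)
  have A: "A = rharm (p - 1) - rharm n"
    using alternating_harmonic[of n] by (simp add: A_def p_eq)
  have B: "B = - (\<Sum>j=1..p-1. 2 ^ j / of_nat j)"
    unfolding B_def sum_negf[symmetric]
  proof (intro sum.cong refl)
    fix j assume "j \<in> {1..p-1}"
    then obtain i where j: "j = Suc i" by (cases j) auto
    have "(- 1) ^ i * (- 2) ^ Suc i = - (2 ^ Suc i :: rat)" by (induction i) auto
    thus "(- 1) ^ (j - 1) / of_nat j * (- 2) ^ j = - (2 ^ j / of_nat j :: rat)"
      unfolding j times_divide_eq_left diff_Suc_1 by (simp only: minus_divide_left)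
  qed
  \<comment> \<open>The upper half of the range is reflected by \<open>j \<mapsto> p - j\<close>.
    Modulo \<open>p\<close> this sends \<open>2 ^ j / j\<close> to \<open>- 2 / (j * 2 ^ j)\<close>,
    the source of \<open>- 2 * X2\<close>.\<close>
  have split: "(\<Sum>j=1..p-1. f j) = (\<Sum>j=1..n. f j) + (\<Sum>j=1..n. f (p - j))" for f :: "nat \<Rightarrow> rat"
  proof -
    have "(\<Sum>j=1..p-1. f j) = (\<Sum>j=1..n. f j) + (\<Sum>j=n+1..n+n. f j)"
      using sum.ub_add_nat[of 1 n f n] by (simp add: p_eq mult_2)
    also have "(\<Sum>j=n+1..n+n. f j) = (\<Sum>j=1..n. f (p - j))"
      by (rule sum.reindex_bij_witness[of _ "\<lambda>j. p - j" "\<lambda>j. p - j"]) (use p_eq in auto)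
    finally show ?thesis .
  qed
  have "cg 1 (\<Sum>j=1..n. 2 ^ (p - j) / of_nat (p - j)) (\<Sum>j=1..n. - 2 * (1 / (of_nat j * 2 ^ j)))"
  proof (intro cg_sum)
    fix j assume "j \<in> {1..n}"
    hence j: "0 < j" "j < p" using n_less by auto
    have "(2 :: rat) ^ (p - j) = 2 ^ p / 2 ^ j" using j by (simp add: power_diff)
    hence "cg 1 (2 ^ (p - j)) (2 / 2 ^ j)" using cg_two_power_p by (simp add: cg_divide)
    hence "cg 1 (2 ^ (p - j) * (1 / of_nat (p - j))) (2 / 2 ^ j * - (1 / of_nat j))"
      using j by (intro cg_mult cg_inverse_reflect) (auto intro!: L_divide unit_of_nat_less)
    thus "cg 1 (2 ^ (p - j) / of_nat (p - j)) (- 2 * (1 / (of_nat j * 2 ^ j)))"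
      by (simp add: mult.commute)
  qed
  hence h1: "cg 1 (\<Sum>j=1..p-1. 2 ^ j / of_nat j) (Y2 - 2 * X2)"
    unfolding split[of "\<lambda>j. 2 ^ j / of_nat j"] Y2_def X2_def sum_distrib_left
    using cg_add[OF cg_refl] by (fastforce simp: sum_negf)
  have h2: "cg 1 (- B) (- (0 - rharm n))"
    by (intro cg_minus cg_trans[OF cg_sym[OF AB]]) (unfold A, intro cg_diff cg_rharm_pred cg_refl)
  show ?thesis using cg_trans[OF cg_sym[OF h1], of "rharm n"] h2 by (simp add: B)
qed

section \<open>The truncated sums modulo \<open>p ^ 2\<close> and the first sum\<close>

definition tc :: "nat \<Rightarrow> rat" where
  "tc k = 4 * of_nat p * cb p / 2 ^ p * of_nat ((p - 1) choose k)"

lemma cg_tc: "k < p \<Longrightarrow> cg 2 (tc k) (of_nat p * (- 1) ^ k)"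
proof -
  assume k: "k < p"
  have "cg 1 (4 * cb p / 2 ^ p * of_nat ((p - 1) choose k)) (4 * (1/2) / 2 * (- 1) ^ k)"
    using k by (intro cg_mult cg_divide cg_mult_left cg_cb_p cg_two_power_p cg_choose_pred)
      (auto intro!: L_divide)
  hence "cg 2 (of_nat p * (4 * cb p / 2 ^ p * of_nat ((p - 1) choose k))) (of_nat p * (1 * (- 1) ^ k))"
    by (intro cg_lift) simp
  thus ?thesis by (simp add: tc_def mult_ac)
qed

lemma L_tc: "k < p \<Longrightarrow> tc k \<in> L"
  using cg_L[OF cg_tc] by simp

text \<open>Division by \<open>cb k\<close> turns \<open>trunc_rec\<close> into a telescoping
  recurrence. It is carried out for \<open>k \<le> n\<close>, where \<open>cb k\<close> is a unit,
  and is anchored at \<open>k = n\<close>, where the sum can be evaluated directly.\<close>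

definition tm :: "nat \<Rightarrow> rat" where
  "tm k = trunc p k / cb k"

lemma L_trunc: "trunc p k \<in> L"
  unfolding trunc_def by (intro L_sum L_divide L_mult) auto

lemma L_tm: "k \<le> n \<Longrightarrow> tm k \<in> L"
  unfolding tm_def by (intro L_divide L_trunc unit_cb)

text \<open>Modulo \<open>p ^ 2\<close> the step from \<open>tm k\<close> to
  \<open>tm (Suc k)\<close> subtracts \<open>p * te k\<close>.\<close>

definition te :: "nat \<Rightarrow> rat" where
  "te k = (- 1) ^ k / ((2 * of_nat k + 1) * cb k)"

lemma unit_odd: "k < n \<Longrightarrow> unit (2 * of_nat k + 1)"
  using unit_of_nat_less[of "2 * k + 1"] p_eq by (simp add: algebra_simps)

lemma L_te: "k < n \<Longrightarrow> te k \<in> L"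
  unfolding te_def by (intro L_divide unit_mult unit_odd unit_cb) auto

text \<open>Modulo \<open>p\<close> the factor \<open>2 k + 1\<close> is \<open>- 2 (n - k)\<close>,
  absorption turns \<open>(n - k) * (n choose k)\<close> into \<open>n * ((n - 1) choose k)\<close>,
  and \<open>- 2 n\<close> is 1.\<close>

lemma cg_te: assumes "k < n" shows "cg 1 (te k) (1 / of_nat ((n - 1) choose k))"
proof -
  have "cg 1 (2 * of_nat k + 1) (- 2 * of_nat (n - k))"
    by (rule cg_I[of _ _ _ 1]) (use assms in \<open>auto simp: of_nat_diff of_nat_n algebra_simps\<close>)
  hence "cg 1 ((2 * of_nat k + 1) * cb k) (- 2 * of_nat (n - k) * ((- 1) ^ k * of_nat (n choose k)))"
    using assms n_less by (intro cg_mult cg_cb) auto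
  also have "- 2 * of_nat (n - k) * ((- 1) ^ k * of_nat (n choose k)) =
      (- 1) ^ k * (- 2 * of_nat n * of_nat ((n - 1) choose k) :: rat)"
    using binomial_absorb_comp[of n k] by (simp flip: of_nat_mult)
  also have "cg 1 \<dots> ((- 1) ^ k * (1 * of_nat ((n - 1) choose k)))"
    by (intro cg_mult_left cg_mult_right cg_I[of "- 2 * of_nat n" _ _ "- 1"]) (auto simp: of_nat_n)
  finally have "cg 1 ((- 1) ^ k / ((2 * of_nat k + 1) * cb k)) ((- 1) ^ k / ((- 1) ^ k * (1 * of_nat ((n - 1) choose k))))"
    using assms n_less by (intro cg_divide cg_refl unit_mult unit_odd unit_cb unit_power unit_neg1 unit_binomial unit_1) auto
  thus ?thesis by (simp add: te_def)
qed

lemma tm_Suc: "k < n \<Longrightarrow> tm (Suc k) = tm k - tc k / ((2 * of_nat k + 1) * cb k)"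
proof -
  assume k: "k < n"
  have nz: "cb k \<noteq> 0" "2 * of_nat k + 1 \<noteq> (0::rat)" "cb (Suc k) \<noteq> 0"
    using unit_cb[of k] unit_cb[of "Suc k"] unit_odd[of k] k unit_nonzero by auto
  have e: "2 * (of_nat k + 1) * cb (Suc k) = (2 * of_nat k + 1) * cb k"
    using cb_Suc[of k] by (simp add: add.commute)
  have "tm (Suc k) = 2 * (of_nat k + 1) * trunc p (Suc k) / (2 * (of_nat k + 1) * cb (Suc k))"
    by (simp add: tm_def add_nonneg_eq_0_iff del: of_nat_Suc)
  also have "\<dots> = ((2 * of_nat k + 1) * trunc p k - tc k) / ((2 * of_nat k + 1) * cb k)"
    unfolding trunc_rec e by (simp add: tc_def)
  also have "\<dots> = tm k - tc k / ((2 * of_nat k + 1) * cb k)"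
    using nz by (simp add: tm_def diff_divide_distrib)
  finally show ?thesis .
qed

lemma cg_tm: "k \<le> n \<Longrightarrow> cg 2 (tm k) (tm 0 - of_nat p * (\<Sum>i<k. te i))"
proof (induction k)
  case (Suc k)
  have "cg 2 (tc k / ((2 * of_nat k + 1) * cb k)) (of_nat p * (- 1) ^ k / ((2 * of_nat k + 1) * cb k))"
    using Suc.prems n_less by (intro cg_divide cg_tc cg_refl unit_mult unit_odd unit_cb) auto
  hence "cg 2 (tm (Suc k)) (tm 0 - of_nat p * (\<Sum>i<k. te i) - of_nat p * (- 1) ^ k / ((2 * of_nat k + 1) * cb k))"
    using Suc by (subst tm_Suc) (auto intro!: cg_diff)
  thus ?case by (simp add: te_def algebra_simps)
qed simp

text \<open>Only indices \<open>m = n + l\<close> contribute, and splitting off \<open>cb n\<close>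
  leaves rising factorials of \<open>n + 1/2\<close>, which is \<open>p / 2\<close>. All terms
  except \<open>l = 0\<close> then have a factor \<open>p\<close>.\<close>

lemma cg_tm_n: "cg 2 (tm n) (1 / 2 ^ n * (1 + of_nat p / 2 * X2))"
proof -
  have "trunc p n = (\<Sum>m\<le>n+n. of_nat (m choose n) * cb m / 2 ^ m)"
    unfolding trunc_def p_eq by (simp add: mult_2 lessThan_Suc_atMost)
  also have "\<dots> = (\<Sum>l\<le>n. of_nat ((n + l) choose n) * cb (n + l) / 2 ^ (n + l))"
    by (rule sum_shift_zero) (simp add: binomial_eq_0)
  also have "\<dots> = cb n * (1 / 2 ^ n * (\<Sum>l\<le>n. rising (of_nat p / 2) l / 2 ^ l))"
    unfolding choose_mult_cb sum_distrib_left
    by (intro sum.cong refl) (simp add: of_nat_n power_add)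
  finally have "tm n = 1 / 2 ^ n * (\<Sum>l\<le>n. rising (of_nat p / 2) l / 2 ^ l)"
    using unit_nonzero[OF unit_cb[of n]] by (simp add: tm_def)
  also have "(\<Sum>l\<le>n. rising (of_nat p / 2) l / 2 ^ l) = 1 + (\<Sum>l=1..n. rising (of_nat p / 2) l / 2 ^ l)"
    by (simp add: sum.atMost_shift sum.shift_bounds_Suc_ivl atLeast1_lessThan_eq_remove0
         sum.atLeast1_atMost_eq lessThan_Suc_atMost[symmetric] sum.lessThan_Suc_shift del: sum.lessThan_Suc)
  also have "cg 2 (1 / 2 ^ n * \<dots>) (1 / 2 ^ n * (1 + (\<Sum>l=1..n. of_nat p * (1 / (2 * of_nat l)) / 2 ^ l)))"
    using n_less by (intro cg_mult_left cg_add cg_sum cg_divide cg_rising_p_half)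
      (auto intro!: L_divide unit_mult unit_of_nat_less)
  also have "(\<Sum>l=1..n. of_nat p * (1 / (2 * of_nat l)) / 2 ^ l) = of_nat p / 2 * X2"
    unfolding X2_def sum_distrib_left by (intro sum.cong) auto
  finally show ?thesis .
qed

end

lemma sum_split_lessThan:
  fixes f :: "nat \<Rightarrow> 'a::comm_monoid_add"
  assumes "i < m" shows "sum f {..<m} = sum f {..i} + sum f {i<..<m}"
proof -
  have u: "{..<m} = {..i} \<union> {i<..<m}" using assms by auto
  have d: "{..i} \<inter> {i<..<m} = {}" by auto
  show ?thesis unfolding u by (rule sum.union_disjoint[OF _ _ d]) simp_all
qed

lemma sum_split_atMost:
  fixes f :: "nat \<Rightarrow> 'a::comm_monoid_add"
  assumes "i \<le> m" shows "sum f {..m} = sum f {..i} + sum f {i<..m}"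
proof -
  have u: "{..m} = {..i} \<union> {i<..m}" using assms by auto
  have d: "{..i} \<inter> {i<..m} = {}" by auto
  show ?thesis unfolding u by (rule sum.union_disjoint[OF _ _ d]) simp_all
qed

context odd_prime
begin

definition ts :: "nat \<Rightarrow> rat" where
  "ts k = (- 1) ^ k * cb k ^ 3"

lemma L_ts [simp]: "ts k \<in> L"
  unfolding ts_def by auto

lemma cg_ts: "k \<le> n \<Longrightarrow> cg 1 (ts k) (of_nat (n choose k) ^ 3)"
proof -
  assume "k \<le> n"
  hence "cg 1 ((- 1) ^ k * cb k ^ 3) ((- 1) ^ k * ((- 1) ^ k * of_nat (n choose k)) ^ 3)"
    using n_less by (intro cg_mult_left cg_power cg_cb) auto
  also have "(- 1) ^ k * ((- 1) ^ k * of_nat (n choose k)) ^ 3 = (of_nat (n choose k) ^ 3 :: rat)"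
    by (cases "even k") auto
  finally show ?thesis by (simp add: ts_def)
qed

text \<open>For \<open>k > n\<close> the factor \<open>cb k ^ 2\<close> is divisible by \<open>p ^ 2\<close>.\<close>

lemma cg_truncate:
  assumes "\<And>k. k < p \<Longrightarrow> f k \<in> L"
  shows "cg 2 (\<Sum>k<p. (- 1) ^ k * cb k ^ 2 * f k) (\<Sum>k\<le>n. (- 1) ^ k * cb k ^ 2 * f k)"
proof -
  have "(\<Sum>k<p. (- 1) ^ k * cb k ^ 2 * f k) =
      (\<Sum>k\<le>n. (- 1) ^ k * cb k ^ 2 * f k) + (\<Sum>k\<in>{n<..<p}. (- 1) ^ k * cb k ^ 2 * f k)"
    by (rule sum_split_lessThan[OF n_less])
  moreover have "cg 2 (\<Sum>k\<in>{n<..<p}. (- 1) ^ k * cb k ^ 2 * f k) (\<Sum>k\<in>{n<..<p}. 0)"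
  proof (intro cg_sum)
    fix k assume k: "k \<in> {n<..<p}"
    hence "cg 2 (cb k * cb k) 0" by (intro cg_2_0 cg_cb_0) auto
    hence "cg 2 ((- 1) ^ k * f k * (cb k * cb k)) ((- 1) ^ k * f k * 0)"
      using k assms by (intro cg_mult_left) auto
    thus "cg 2 ((- 1) ^ k * cb k ^ 2 * f k) 0" by (simp add: power2_eq_square mult_ac)
  qed
  ultimately show ?thesis using cg_add[OF cg_refl] by fastforce
qed

definition lam :: "nat \<Rightarrow> rat" where
  "lam k = (\<Sum>i<k. te i)"

lemma L_lam: "k \<le> n \<Longrightarrow> lam k \<in> L"
  unfolding lam_def by (intro L_sum L_te) auto

lemma cg_tm': "k \<le> n \<Longrightarrow> cg 2 (tm k) (tm n + of_nat p * (lam n - lam k))"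
proof -
  assume k: "k \<le> n"
  have "cg 2 (tm k) (tm 0 - of_nat p * lam k)" using cg_tm[OF k] by (simp add: lam_def)
  moreover have "cg 2 (tm 0) (tm n + of_nat p * lam n)"
    using cg_add[OF cg_sym[OF cg_tm[of n]] cg_refl[of 2 "of_nat p * lam n"]] by (simp add: lam_def)
  hence "cg 2 (tm 0 - of_nat p * lam k) (tm n + of_nat p * lam n - of_nat p * lam k)"
    by (intro cg_diff cg_refl)
  ultimately show ?thesis using cg_trans by (simp add: algebra_simps)
qed

lemma trunc_eq: "k \<le> n \<Longrightarrow> (- 1) ^ k * cb k ^ 2 * trunc p k = ts k * tm k"
  using unit_nonzero[OF unit_cb[of k]] by (simp add: ts_def tm_def power2_eq_square power3_eq_cube)

text \<open>Modulo \<open>p\<close> the weights \<open>ts k\<close> are symmetric under \<open>k \<mapsto> n - k\<close>, so the correction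
  \<open>lam n - lam k\<close> may be replaced by its average \<open>lam n / 2\<close>.\<close>

lemma cg_sum_ts_lam: "cg 1 (\<Sum>k\<le>n. ts k * (lam n - lam k)) ((\<Sum>k\<le>n. ts k) * (- (1/4) * (1 / 2 ^ n) * Y2))"
proof -
  define g where "g i = (1 / of_nat ((n - 1) choose i) :: rat)" for i
  define mu where "mu k = (\<Sum>i<k. g i)" for k
  define C where "C k = (of_nat (n choose k) ^ 3 :: rat)" for k
  have Lg: "g i \<in> L" if "i < n" for i
    unfolding g_def using that n_less by (intro L_divide unit_binomial) auto
  have Lmu: "mu k \<in> L" if "k \<le> n" for k unfolding mu_def using that by (intro L_sum Lg) auto
  have lam_mu: "cg 1 (lam k) (mu k)" if "k \<le> n" for k
    unfolding lam_def mu_def g_def using that by (intro cg_sum cg_te) auto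
  have mu_refl: "mu n - mu k = mu (n - k)" if "k \<le> n" for k
  proof -
    have "mu n = mu k + (\<Sum>i\<in>{k..<n}. g i)"
      unfolding mu_def using that by (simp add: sum.atLeastLessThan_concat lessThan_atLeast0)
    also have "(\<Sum>i\<in>{k..<n}. g i) = mu (n - k)"
      unfolding mu_def
    proof (rule sum.reindex_bij_witness[of _ "\<lambda>i. n - 1 - i" "\<lambda>i. n - 1 - i"])
      fix i assume i: "i \<in> {k..<n}"
      have "(n - 1) choose (n - 1 - i) = (n - 1) choose i"
        using i by (intro binomial_symmetric[symmetric]) auto
      thus "g (n - 1 - i) = g i" by (simp add: g_def)
    qed (use that in auto)
    finally show ?thesis by simp
  qed
  have Csym: "(\<Sum>k\<le>n. C k * mu (n - k)) = (\<Sum>k\<le>n. C k * mu k)"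
    by (rule sum.reindex_bij_witness[of _ "\<lambda>k. n - k" "\<lambda>k. n - k"])
       (auto simp: C_def binomial_symmetric[symmetric])
  have "(\<Sum>k\<le>n. C k * (mu n - mu k)) + (\<Sum>k\<le>n. C k * mu k) = (\<Sum>k\<le>n. C k) * mu n"
    by (simp add: right_diff_distrib sum_subtractf sum_distrib_right)
  moreover have "(\<Sum>k\<le>n. C k * (mu n - mu k)) = (\<Sum>k\<le>n. C k * mu k)"
    unfolding Csym[symmetric] by (intro sum.cong refl) (simp add: mu_refl)
  ultimately have avg: "(\<Sum>k\<le>n. C k * (mu n - mu k)) = (\<Sum>k\<le>n. C k) * (mu n / 2)" by simp
  have "mu n = (\<Sum>i\<le>n-1. 1 / of_nat ((n - 1) choose i))"
    unfolding mu_def g_def using n_pos by (intro sum.cong) auto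
  also have "\<dots> = of_nat n / 2 ^ n * Y2"
    unfolding sum_inverse_choose Y2_def using n_pos by simp
  finally have mu_n: "mu n = of_nat n * (1 / 2 ^ n * Y2)" by simp
  have L2: "1 / 2 ^ n * Y2 \<in> L" by (intro L_mult L_divide L_Y2) auto
  have "cg 1 (of_nat n) (- (1/2))" using cg_sym[OF cg_minus[OF cg_half]] by (simp only: minus_minus)
  hence "cg 1 (mu n) (- (1/2) * (1 / 2 ^ n * Y2))"
    unfolding mu_n by (intro cg_mult_right L2)
  hence "cg 1 (1/2 * mu n) (1/2 * (- (1/2) * (1 / 2 ^ n * Y2)))" by (intro cg_mult_left) auto
  hence mu_half: "cg 1 (mu n / 2) (- (1/4) * (1 / 2 ^ n) * Y2)" by simp
  have "cg 1 (\<Sum>k\<le>n. ts k * (lam n - lam k)) (\<Sum>k\<le>n. C k * (mu n - mu k))"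
    unfolding C_def using Lmu by (intro cg_sum cg_mult cg_ts cg_diff lam_mu) auto
  also have "\<dots> = (\<Sum>k\<le>n. C k) * (mu n / 2)" by (rule avg)
  also have "cg 1 \<dots> ((\<Sum>k\<le>n. ts k) * (- (1/4) * (1 / 2 ^ n) * Y2))"
  proof (intro cg_mult mu_half cg_sum cg_sym[OF cg_ts, folded C_def])
    show "(\<Sum>k\<le>n. C k) \<in> L" by (intro L_sum) (auto simp: C_def)
    show "- (1/4) * (1 / 2 ^ n) * Y2 \<in> L" by (intro L_mult L_minus L_divide L_Y2) auto
  qed auto
  finally show ?thesis .
qed

text \<open>The numbers \<open>- n\<close> and \<open>n + 1\<close> are \<open>1/2 - p/2\<close> and
  \<open>1/2 + p/2\<close>, so paired factors of the two Pochhammer symbols differ from the squares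
  \<open>(1/2 + i) ^ 2\<close> by \<open>p ^ 2 / 4\<close> only.\<close>

lemma cg_sum_ts: "cg 2 (\<Sum>k\<le>n. ts k) (clausen_value n)"
  unfolding clausen_value_def
proof (intro cg_sum)
  fix k assume "k \<in> {..n}"
  hence k: "k < p" using n_less by auto
  have "pochhammer (- of_nat n) k * pochhammer (of_nat n + 1) k =
      (\<Prod>i<k. (- of_nat n + of_nat i) * (of_nat n + 1 + of_nat i) :: rat)"
    by (simp add: pochhammer_prod prod.distrib atLeast0LessThan)
  also have "cg 2 \<dots> (\<Prod>i<k. (1/2 + of_nat i) * (1/2 + of_nat i))"
  proof (intro cg_prod)
    fix i
    show "cg 2 ((- of_nat n + of_nat i) * (of_nat n + 1 + of_nat i)) ((1/2 + of_nat i) * (1/2 + of_nat i))"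
      by (rule cg_I[of _ _ _ "- (1/4)"])
         (auto simp: of_nat_n field_simps power2_eq_square intro!: L_divide)
  qed (auto intro!: L_mult L_add L_divide)
  also have "(\<Prod>i<k. (1/2 + of_nat i) * (1/2 + of_nat i)) = (pochhammer (1/2) k * pochhammer (1/2) k :: rat)"
    by (simp add: pochhammer_prod prod.distrib atLeast0LessThan)
  finally have P: "cg 2 (pochhammer (- of_nat n) k * pochhammer (of_nat n + 1) k)
      (pochhammer (1/2) k * pochhammer (1/2) k)" .
  have "(- 1) ^ k * cb k * (1 / (fact k * fact k)) \<in> L"
    using k by (intro L_mult L_power L_minus L_1 L_cb L_divide unit_mult unit_fact)
  from cg_mult_left[OF this cg_sym[OF P]]
  have "cg 2 ((- 1) ^ k * cb k * (1 / (fact k * fact k)) * (pochhammer (1/2) k * pochhammer (1/2) k))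
      ((- 1) ^ k * cb k * (1 / (fact k * fact k)) * (pochhammer (- of_nat n) k * pochhammer (of_nat n + 1) k))" .
  moreover have "(- 1) ^ k * cb k * (1 / (fact k * fact k)) * (pochhammer (1/2) k * pochhammer (1/2) k) = ts k"
    by (simp add: ts_def rising_def power3_eq_cube)
  moreover have "(- 1) ^ k * cb k * (1 / (fact k * fact k)) * (pochhammer (- of_nat n) k * pochhammer (of_nat n + 1) k)
      = (- 1) ^ k * (rising (- of_nat n) k * rising (of_nat n + 1) k * cb k)"
    by (simp add: rising_def mult_ac)
  ultimately show "cg 2 (ts k) ((- 1) ^ k * (rising (- of_nat n) k * rising (of_nat n + 1) k * cb k))"
    by (simp only:)
qed

definition main_sum :: rat where
  "main_sum = (\<Sum>m=0..p-1. of_nat (((2 * m) choose m) * G m) / 128 ^ m)"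

lemma L_main_sum: "main_sum \<in> L"
  unfolding main_sum_def by (intro L_sum L_divide unit_power) auto

lemma main_sum_eq: "main_sum = (\<Sum>m<p. cb m / 2 ^ m * gs m)"
  unfolding main_sum_def summand_eq using p_gt_0 by (intro sum.cong) auto

lemma cg_main_sum: "cg 2 main_sum (clausen_value n * (1 / 2 ^ n * (1 - of_nat p * (rharm n / 4))))"
proof -
  define S where "S = (\<Sum>k\<le>n. ts k)"
  define h where "h = (1 / 2 ^ n :: rat)"
  have LS: "S \<in> L" unfolding S_def by (intro L_sum) auto
  have Lh: "h \<in> L" unfolding h_def by (intro L_divide) auto
  have "cg 2 main_sum (\<Sum>k\<le>n. (- 1) ^ k * cb k ^ 2 * trunc p k)"
    unfolding main_sum_eq sum_cb_gs by (intro cg_truncate L_trunc)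
  also have "(\<Sum>k\<le>n. (- 1) ^ k * cb k ^ 2 * trunc p k) = (\<Sum>k\<le>n. ts k * tm k)"
    by (intro sum.cong refl trunc_eq) auto
  also have "cg 2 \<dots> (\<Sum>k\<le>n. ts k * (tm n + of_nat p * (lam n - lam k)))"
    by (intro cg_sum cg_mult_left cg_tm') auto
  also have "\<dots> = S * tm n + of_nat p * (\<Sum>k\<le>n. ts k * (lam n - lam k))"
    by (simp add: S_def distrib_left sum.distrib sum_distrib_left sum_distrib_right mult_ac)
  also have "cg 2 \<dots> (S * (h * (1 + of_nat p / 2 * X2)) + of_nat p * (S * (- (1/4) * h * Y2)))"
    unfolding h_def using cg_sum_ts_lam LS
    by (intro cg_add cg_mult_left cg_tm_n cg_lift) (auto simp: S_def)
  \<comment> \<open>The \<open>X2\<close> of \<open>tm n\<close> and the \<open>Y2\<close> of the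
    averaged correction form exactly the combination evaluated by \<open>cg_Y2\<close>.\<close>
  also have "\<dots> = S * h * (1 + of_nat p * (- (1/4) * (Y2 - 2 * X2)))"
    by (simp add: algebra_simps)
  also have "cg 2 \<dots> (S * h * (1 + of_nat p * (- (1/4) * rharm n)))"
    using LS Lh by (intro cg_mult_left cg_add cg_refl cg_lift cg_Y2 L_mult L_minus L_divide) auto
  also have "cg 2 \<dots> (clausen_value n * h * (1 + of_nat p * (- (1/4) * rharm n)))"
    unfolding S_def using Lh L_rharm_n
    by (intro cg_mult_right cg_sum_ts L_add L_mult L_minus L_divide) auto
  finally show ?thesis by (simp add: h_def mult_ac)
qed

lemma cg_tm_0: "cg 1 (tm 0) (2 ^ n)"
proof -
  have "cg 1 (tm 0) (tm n + of_nat p * (lam n - lam 0))" by (intro cg_2_1 cg_tm') auto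
  also have "cg 1 \<dots> (1 / 2 ^ n * (1 + of_nat p / 2 * X2) + 0)"
    by (intro cg_add cg_2_1[OF cg_tm_n] cg_p L_diff L_lam) auto
  also have "\<dots> = 1 / 2 ^ n * (1 + of_nat p * (X2 / 2))" by simp
  also have "cg 1 \<dots> (1 / 2 ^ n * (1 + 0))"
    by (intro cg_mult_left cg_add cg_refl cg_p L_divide L_X2) auto
  also have "cg 1 \<dots> (2 ^ n)" using cg_sym[OF cg_two_power] by simp
  finally show ?thesis .
qed

section \<open>The second sum\<close>

lemma pochhammer_half_mod:
  "r < p \<Longrightarrow> cg 1 (pochhammer (1/2) r) ((- 1) ^ r * fact r * of_nat (n choose r))"
proof -
  assume "r < p"
  have "cg 1 (pochhammer (1/2) r) (pochhammer (- of_nat n) r)"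
    by (intro cg_pochhammer cg_half) auto
  also have "pochhammer (- of_nat n :: rat) r = fact r * rising (- of_nat n) r" by (simp add: rising_def)
  finally show ?thesis by (simp add: rising_minus_of_nat mult_ac)
qed

lemma unit_pochhammer_half: "r \<le> n \<Longrightarrow> unit (pochhammer (1/2) r)"
  using n_less by (intro cg_unit[OF pochhammer_half_mod] unit_mult unit_power unit_fact unit_binomial) auto

lemma pochhammer_half_0: "n < r \<Longrightarrow> cg 1 (pochhammer (1/2) r) 0"
proof -
  assume "n < r"
  have "cg 1 (pochhammer (1/2) r) (pochhammer (- of_nat n) r)"
    by (intro cg_pochhammer cg_half) auto
  thus ?thesis using pochhammer_of_nat_eq_0_lemma[OF \<open>n < r\<close>, where ?'a = rat] by simp
qed

text \<open>For \<open>j < n\<close> the entry of the column \<open>Suc n\<close> contains the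
  square of \<open>pochhammer (1/2) (Suc n)\<close>, which has a factor \<open>p\<close>, over a
  unit. For \<open>j = n\<close> this square cancels against the denominator, and
  \<open>2 * pochhammer (1/2) p / fact n ^ 2\<close> remains.\<close>

lemma cg_wzsum_n: "cg 2 (wzsum n) (of_nat p * (- 1) ^ n)"
proof -
  have small: "cg 2 (wzG j (Suc n)) 0" if "j < n" for j
  proof -
    define c where "c = 2 * (- 1) ^ Suc (Suc n + j) / (pochhammer (1/2) (Suc j) ^ 2 * fact n ^ 2 * fact (n - j) :: rat)"
    have "c \<in> L" unfolding c_def using that n_less
      by (intro L_divide L_mult unit_mult unit_power unit_pochhammer_half unit_fact) auto
    moreover have "cg 2 (pochhammer (1/2) (Suc n) * pochhammer (1/2) (Suc n)) 0"
      by (intro cg_2_0 L_pochhammer pochhammer_half_0) auto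
    ultimately have "cg 2 (c * pochhammer (1/2) (j + Suc n) * (pochhammer (1/2) (Suc n) * pochhammer (1/2) (Suc n)))
        (c * pochhammer (1/2) (j + Suc n) * 0)"
      by (intro cg_mult_left L_mult L_pochhammer) auto
    moreover have "wzG j (Suc n) = c * pochhammer (1/2) (j + Suc n) * (pochhammer (1/2) (Suc n) * pochhammer (1/2) (Suc n))"
      using that by (simp add: wzG_def c_def power2_eq_square mult_ac del: pochhammer_Suc)
    ultimately show ?thesis by simp
  qed
  have "wzG n (Suc n) = 2 * pochhammer (1/2) p / fact n ^ 2"
  proof -
    have e: "n + Suc n = p" by (simp add: p_eq)
    have s: "(- 1) ^ Suc (Suc n + n) = (1 :: rat)" by (simp flip: mult_2)
    show ?thesis unfolding wzG_def e s using pochhammer_half_nonzero[of "Suc n"] by simp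
  qed
  also have "pochhammer (1/2 :: rat) p = cb p * fact p" by (simp add: rising_def)
  also have "(fact p :: rat) = of_nat p * fact (2 * n)" by (simp add: p_eq)
  also have "2 * (cb p * (of_nat p * fact (2 * n))) / fact n ^ 2 = of_nat p * (2 * cb p * of_nat ((2 * n) choose n))"
  proof -
    have "(of_nat ((2 * n) choose n) :: rat) = fact (2 * n) / (fact n * fact n)"
      using binomial_fact[of n "2 * n", where ?'a = rat] by simp
    thus ?thesis by (simp add: power2_eq_square mult_ac)
  qed
  finally have last: "wzG n (Suc n) = of_nat p * (2 * cb p * of_nat ((2 * n) choose n))" .
  have "wzsum n = (\<Sum>j<n. wzG j (Suc n)) + wzG n (Suc n)"
    unfolding wzsum_eq by (simp flip: lessThan_Suc_atMost)
  also have "cg 2 \<dots> ((\<Sum>j<n. 0) + of_nat p * (2 * (1/2) * (- 1) ^ n))"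
    unfolding last using cg_cb_p cg_central
    by (intro cg_add cg_sum small cg_lift cg_mult cg_mult_left) auto
  finally show ?thesis by simp
qed

text \<open>Multiplication by \<open>fact (j + N)\<close> turns the reciprocal factorials into
  Pochhammer symbols of \<open>- (j + N)\<close>, and the binomial theorem for Pochhammer symbols
  applies.\<close>

lemma chu_vandermonde:
  "(\<Sum>l\<le>N. (- 1) ^ l * of_nat (N choose l) * pochhammer a l / fact (j + l)) =
     pochhammer (of_nat j + 1 - a) N / (fact (j + N) :: rat)"
proof -
  have gen: "s * t = u \<Longrightarrow> F * (u * C * P / G) = s * (C * P * (t * (F / G)))" for s t u F C P G :: rat
    by (auto simp: mult_ac)
  have e: "fact (j + N) * ((- 1) ^ l * of_nat (N choose l) * pochhammer a l / fact (j + l)) =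
      (- 1) ^ N * (of_nat (N choose l) * pochhammer a l * pochhammer (- of_nat (j + N)) (N - l))" if le: "l \<le> N" for l
  proof -
    obtain d where N: "N = l + d" using le_Suc_ex[OF le] by blast
    have f: "pochhammer (- of_nat (j + N)) d = ((- 1) ^ d * (fact (j + N) / fact (j + l)) :: rat)"
    proof -
      have "(fact (j + l + d) :: rat) = fact (j + l) * pochhammer (of_nat (j + l) + 1) d"
        using pochhammer_product'[of "1::rat" "j + l" d]
        by (simp only: pochhammer_fact[symmetric] add.commute[of 1])
      moreover have "of_nat (j + N) - of_nat d + 1 = (of_nat (j + l) + 1 :: rat)" by (simp add: N)
      moreover have "j + N = j + l + d" by (simp add: N)
      ultimately show ?thesis unfolding pochhammer_minus by (simp only:) simp
    qed
    have "(- 1) ^ N * (- 1) ^ d = ((- 1) ^ l :: rat)" by (simp add: N power_add flip: power_mult_distrib)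
    moreover have "N - l = d" by (simp add: N)
    ultimately show ?thesis using gen[of "(- 1) ^ N" "(- 1) ^ d" "(- 1) ^ l"] by (simp only: f)
  qed
  have "fact (j + N) * (\<Sum>l\<le>N. (- 1) ^ l * of_nat (N choose l) * pochhammer a l / fact (j + l)) =
      (- 1) ^ N * (\<Sum>l\<le>N. of_nat (N choose l) * pochhammer a l * pochhammer (- of_nat (j + N)) (N - l))"
    unfolding sum_distrib_left by (intro sum.cong refl e) auto
  also have "\<dots> = (- 1) ^ N * pochhammer (- (of_nat (j + N) - a)) N"
    unfolding pochhammer_binomial_sum[symmetric] minus_diff_eq by (simp only: diff_conv_add_uminus)
  also have "\<dots> = pochhammer (of_nat (j + N) - a - of_nat N + 1) N"
    unfolding pochhammer_minus by (simp flip: power_mult_distrib mult.assoc)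
  also have "of_nat (j + N) - a - of_nat N + 1 = of_nat j + 1 - a" by simp
  finally show ?thesis by (simp add: field_simps)
qed

lemma L_fact: "fact k \<in> L"
  using L_of_nat[of "fact k"] by simp

lemma te_pochhammer: "k < n \<Longrightarrow> te k = (- 1) ^ k * fact k / (2 * pochhammer (1/2) (Suc k))"
proof -
  have "2 * pochhammer (1/2 :: rat) (Suc k) = (2 * of_nat k + 1) * (cb k * fact k)"
    by (simp add: rising_def pochhammer_Suc field_simps)
  thus ?thesis by (simp add: te_def)
qed

lemma te_wzG:
  assumes "j + l < n"
  shows "te (j + l) * wzG j (Suc (j + l)) =
     (- 1) ^ j * (pochhammer (of_nat j + 3/2) l * pochhammer (1/2) (2 * j + 1 + l)) /
       (pochhammer (1/2) (Suc j) * fact (j + l) * fact l)"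
proof -
  define P Q R where "P = (pochhammer (1/2) (Suc (j + l)) :: rat)" and "Q = (pochhammer (1/2) (2 * j + 1 + l) :: rat)"
    and "R = (pochhammer (1/2) (Suc j) :: rat)"
  have nz: "P \<noteq> 0" "R \<noteq> 0" using pochhammer_half_nonzero by (auto simp: P_def R_def)
  have P: "P = R * pochhammer (of_nat j + 3/2) l"
    using pochhammer_product'[of "1/2 :: rat" "Suc j" l] by (simp add: P_def R_def add_ac)
  have s: "((- 1) ^ (j + l) * (- 1) ^ (j + l + j) :: rat) = (- 1) ^ j"
    by (cases "even j"; cases "even l") (simp_all add: power_add)
  have "te (j + l) * wzG j (Suc (j + l)) =
      ((- 1) ^ (j + l) * fact (j + l) / (2 * P)) * (2 * (- 1) ^ (j + l + j) * P ^ 2 * Q / (R ^ 2 * fact (j + l) ^ 2 * fact l))"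
  proof -
    have e: "j + Suc (j + l) = 2 * j + 1 + l" by simp
    have "wzG j (Suc (j + l)) = 2 * (- 1) ^ (j + l + j) * P ^ 2 * Q / (R ^ 2 * fact (j + l) ^ 2 * fact l)"
      unfolding wzG_def P_def Q_def R_def e by simp
    thus ?thesis unfolding te_pochhammer[OF assms] P_def by (simp only:)
  qed
  also have "\<dots> = ((- 1) ^ (j + l) * (- 1) ^ (j + l + j)) * P * Q / (R ^ 2 * fact (j + l) * fact l)"
    using nz by (simp add: power2_eq_square)
  also have "\<dots> = (- 1) ^ j * (pochhammer (of_nat j + 3/2) l * Q) / (R * fact (j + l) * fact l)"
    unfolding s P using nz by (simp add: power2_eq_square)
  finally show ?thesis by (simp add: Q_def R_def)
qed

text \<open>In \<open>te_wzG\<close> the denominators are units, while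
  \<open>pochhammer (1/2) (2 * j + 1 + l)\<close> has a factor \<open>p\<close> as soon as
  \<open>2 * j + 1 > n\<close>. In the other rows the sum terminates modulo \<open>p\<close> at
  \<open>l = N\<close> and is evaluated by \<open>chu_vandermonde\<close>.\<close>

lemma cg_row:
  assumes "j < n"
  shows "cg 1 (\<Sum>l<n-j. te (j + l) * wzG j (Suc (j + l)))
     (if 2 * j + 1 \<le> n then (- 1) ^ (n - 1) * of_nat ((n + 1) choose (2 * j + 2)) else 0)"
proof (cases "2 * j + 1 \<le> n")
  case False
  have "cg 1 (\<Sum>l<n-j. te (j + l) * wzG j (Suc (j + l))) (\<Sum>l<n-j. 0)"
  proof (intro cg_sum)
    fix l assume l: "l \<in> {..<n-j}"
    define c where "c = ((- 1) ^ j * pochhammer (of_nat j + 3/2) l / (pochhammer (1/2) (Suc j) * fact (j + l) * fact l) :: rat)"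
    have c: "c \<in> L" unfolding c_def using l assms n_less
      by (intro L_divide L_mult L_pochhammer L_add unit_mult unit_pochhammer_half unit_fact) auto
    have "cg 1 (pochhammer (1/2) (2 * j + 1 + l)) 0"
      using False by (intro pochhammer_half_0) auto
    hence "cg 1 (c * pochhammer (1/2) (2 * j + 1 + l)) (c * 0)" using c by (intro cg_mult_left)
    thus "cg 1 (te (j + l) * wzG j (Suc (j + l))) 0"
      using l by (subst te_wzG) (auto simp: c_def mult_ac)
  qed
  thus ?thesis using False by simp
next
  case True
  define N where "N = n - 1 - 2 * j"
  have N: "n = N + 1 + 2 * j" using True by (simp add: N_def)
  define R where "R = (pochhammer (1/2) (Suc j) :: rat)"
  define c where "c = ((- 1) ^ j * pochhammer (1/2) (2 * j + 1) / R :: rat)"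
  have uR: "unit R" unfolding R_def using assms by (intro unit_pochhammer_half) auto
  have Lc: "c \<in> L" unfolding c_def using uR by (intro L_divide L_mult L_pochhammer) auto
  \<comment> \<open>The left side is \<open>- N + p / 2\<close>, so rising factorials of it become
    binomial coefficients with upper entry \<open>N\<close>.\<close>
  have shift: "cg 1 (1/2 + of_nat (2 * j + 1)) (- of_nat N)"
    by (rule cg_I[of _ _ _ "1/2"]) (use of_nat_n in \<open>auto simp: N algebra_simps\<close>)
  have "cg 1 (\<Sum>l<n-j. te (j + l) * wzG j (Suc (j + l)))
      (\<Sum>l<n-j. c * ((- 1) ^ l * of_nat (N choose l) * pochhammer (of_nat j + 3/2) l / fact (j + l)))"
  proof (intro cg_sum)
    fix l assume l: "l \<in> {..<n-j}"
    have "te (j + l) * wzG j (Suc (j + l)) =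
        c * pochhammer (of_nat j + 3/2) l / fact (j + l) * rising (1/2 + of_nat (2 * j + 1)) l"
    proof -
      have q: "pochhammer (1/2 :: rat) (2 * j + 1 + l) = pochhammer (1/2) (2 * j + 1) * pochhammer (1/2 + of_nat (2 * j + 1)) l"
        by (rule pochhammer_product')
      have jl: "j + l < n" using l by auto
      show ?thesis unfolding te_wzG[OF jl] q c_def rising_def R_def by simp
    qed
    also have "cg 1 \<dots> (c * pochhammer (of_nat j + 3/2) l / fact (j + l) * rising (- of_nat N) l)"
      using l n_less Lc
      by (intro cg_mult_left cg_rising shift L_divide L_mult L_pochhammer unit_fact L_add) auto
    also have "\<dots> = c * ((- 1) ^ l * of_nat (N choose l) * pochhammer (of_nat j + 3/2) l / fact (j + l))"
      by (simp add: rising_minus_of_nat)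
    finally show "cg 1 (te (j + l) * wzG j (Suc (j + l))) \<dots>" .
  qed
  also have "(\<Sum>l<n-j. c * ((- 1) ^ l * of_nat (N choose l) * pochhammer (of_nat j + 3/2) l / fact (j + l)))
      = (\<Sum>l\<le>N. c * ((- 1) ^ l * of_nat (N choose l) * pochhammer (of_nat j + 3/2) l / fact (j + l)))"
    by (rule sum.mono_neutral_right) (auto simp: N binomial_eq_0)
  also have "\<dots> = c * (pochhammer (- 1/2) N / fact (j + N))"
    unfolding sum_distrib_left[symmetric] chu_vandermonde by simp
  also have "\<dots> = c * fact N / fact (j + N) * rising (- 1/2) N"
    by (simp add: rising_def)
  also have "cg 1 \<dots> (1 * ((- 1) ^ N * of_nat ((n + 1) choose N)))"
  proof (intro cg_mult)
    define d where "d = ((- 1) ^ (2 * j + 1) * fact (2 * j + 1) * of_nat (n choose (2 * j + 1)) :: rat)"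
    define e where "e = ((- 1) ^ (Suc j) * fact (Suc j) * of_nat (n choose (Suc j)) :: rat)"
    have ue: "unit e" unfolding e_def using n_less assms
      by (intro unit_mult unit_power unit_fact unit_binomial) auto
    have Ld: "d \<in> L" unfolding d_def by (intro L_mult L_power L_fact L_of_nat) auto
    have cd: "cg 1 (pochhammer (1/2) (2 * j + 1)) d"
      unfolding d_def using n_less True by (intro pochhammer_half_mod) auto
    have ce: "cg 1 R e"
      unfolding e_def R_def using n_less assms by (intro pochhammer_half_mod) auto
    have "cg 1 c ((- 1) ^ j * d / e)"
      unfolding c_def using Ld by (intro cg_divide cg_mult_left cd ce uR ue L_mult L_power) auto
    hence "cg 1 (c * (fact N / fact (j + N))) ((- 1) ^ j * d / e * (fact N / fact (j + N)))"
      using n_less N by (intro cg_mult_right L_divide L_fact unit_fact) auto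
    hence "cg 1 (c * fact N / fact (j + N)) ((- 1) ^ j * d / e * fact N / fact (j + N))"
      by (simp only: times_divide_eq_right)
    also have "(- 1) ^ j * d / e * fact N / fact (j + N) = 1"
    proof -
      have a: "fact (2 * j + 1) * of_nat (n choose (2 * j + 1)) = (fact n / fact N :: rat)"
      proof -
        have "n - (2 * j + 1) = N" by (simp add: N)
        thus ?thesis unfolding binomial_fact[OF True] by (simp del: fact_Suc)
      qed
      have "n - Suc j = j + N" using N by simp
      hence b: "fact (Suc j) * of_nat (n choose (Suc j)) = (fact n / fact (j + N) :: rat)"
        using binomial_fact[of "Suc j" n, where ?'a = rat] assms by (simp del: fact_Suc)
      have s: "(- 1) ^ j * (- 1) ^ (2 * j + 1) = ((- 1) ^ Suc j :: rat)" by simp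
      have "(- 1) ^ j * d = (- 1) ^ Suc j * (fact n / fact N)"
        unfolding d_def mult.assoc a by (simp only: s mult.assoc[symmetric])
      moreover have "e = (- 1) ^ Suc j * (fact n / fact (j + N))"
        unfolding e_def mult.assoc b ..
      ultimately show ?thesis by simp
    qed
    finally show "cg 1 (c * fact N / fact (j + N)) 1" .
    have "cg 1 (- 1/2) (- of_nat (n + 1))"
      by (rule cg_I[of _ _ _ "1/2"]) (auto simp: of_nat_n)
    hence "cg 1 (rising (- 1/2) N) (rising (- of_nat (n + 1)) N)"
      using n_less N by (intro cg_rising) auto
    thus "cg 1 (rising (- 1/2) N) ((- 1) ^ N * of_nat ((n + 1) choose N))"
      unfolding rising_minus_of_nat .
    show "c * fact N / fact (j + N) \<in> L"
      using n_less N Lc by (intro L_divide L_mult unit_fact unit_L[OF unit_fact]) auto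
  qed auto
  also have "1 * ((- 1) ^ N * of_nat ((n + 1) choose N)) = ((- 1) ^ (n - 1) * of_nat ((n + 1) choose (2 * j + 2)) :: rat)"
  proof -
    have "(n + 1) choose N = (n + 1) choose (2 * j + 2)"
      using binomial_symmetric[of N "n + 1"] by (simp add: N)
    moreover have "(- 1) ^ (n - 1) = ((- 1) ^ N :: rat)" by (simp add: N power_add)
    ultimately show ?thesis by simp
  qed
  finally show ?thesis using True by simp
qed

lemma sum_even_choose:
  "(\<Sum>j<n. if 2 * j + 1 \<le> n then of_nat ((n + 1) choose (2 * j + 2)) else 0) = (2 ^ n - 1 :: rat)"
proof -
  have "2 * (\<Sum>i\<le>n+1. if even i then of_nat ((n + 1) choose i) else 0) = (2 ^ (n + 1) :: rat)"
    by (rule choose_even_sum) simp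
  moreover have "(\<Sum>i\<le>n+1. if even i then of_nat ((n + 1) choose i) else (0::rat)) =
      1 + (\<Sum>i\<in>{i. 0 < i \<and> i \<le> n + 1 \<and> even i}. of_nat ((n + 1) choose i))"
  proof -
    have "(\<Sum>i\<le>n+1. if even i then of_nat ((n + 1) choose i) else (0::rat)) =
        (\<Sum>i\<in>insert 0 {i. 0 < i \<and> i \<le> n + 1 \<and> even i}. of_nat ((n + 1) choose i))"
      by (rule sum.mono_neutral_cong_right) auto
    thus ?thesis by simp
  qed
  moreover have "(\<Sum>j<n. if 2 * j + 1 \<le> n then of_nat ((n + 1) choose (2 * j + 2)) else (0::rat)) =
      (\<Sum>j\<in>{j. 2 * j + 1 \<le> n}. of_nat ((n + 1) choose (2 * j + 2)))"
    by (rule sum.mono_neutral_cong_right) auto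
  moreover have "\<dots> = (\<Sum>i\<in>{i. 0 < i \<and> i \<le> n + 1 \<and> even i}. of_nat ((n + 1) choose i))"
    by (rule sum.reindex_bij_witness[of _ "\<lambda>i. i div 2 - 1" "\<lambda>j. 2 * j + 2"]) (auto elim!: evenE)
  ultimately show ?thesis by simp
qed

text \<open>Abel summation moves the weights from \<open>lam\<close> to its increments
  \<open>te\<close>, paired with partial sums of the series. The complete sum \<open>wzsum n\<close>
  vanishes modulo \<open>p\<close>, and every \<open>wzsum i\<close> is a column sum of
  \<open>wzG\<close>; regrouping the double sum by \<open>j\<close> gives the rows of
  \<open>cg_row\<close>, which add up to a sum of even-indexed binomial coefficients.\<close>

lemma cg_weighted: "cg 1 (\<Sum>k\<le>n. (4 * of_nat k + 1) * ts k * lam k) ((- 1) ^ n * (2 ^ n - 1))"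
proof -
  define r where "r k = (4 * of_nat k + 1) * ts k" for k
  have R: "wzsum i = (\<Sum>k\<le>i. r k)" for i by (simp add: wzsum_def r_def ts_def mult_ac)
  have "(\<Sum>k\<le>n. r k * lam k) = (\<Sum>k\<le>n. \<Sum>i<n. if i < k then r k * te i else 0)"
  proof (intro sum.cong refl)
    fix k assume "k \<in> {..n}"
    hence "(\<Sum>i<n. if i < k then r k * te i else 0) = (\<Sum>i<k. r k * te i)"
      by (intro sum.mono_neutral_cong_right) auto
    thus "r k * lam k = (\<Sum>i<n. if i < k then r k * te i else 0)"
      by (simp add: lam_def sum_distrib_left)
  qed
  also have "\<dots> = (\<Sum>i<n. \<Sum>k\<le>n. if i < k then r k * te i else 0)" by (rule sum.swap)
  also have "\<dots> = (\<Sum>i<n. te i * (wzsum n - wzsum i))"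
  proof (intro sum.cong refl)
    fix i assume i: "i \<in> {..<n}"
    have "(\<Sum>k\<le>n. if i < k then r k * te i else 0) = (\<Sum>k\<in>{i<..n}. r k * te i)"
      by (intro sum.mono_neutral_cong_right) auto
    moreover have "wzsum n = wzsum i + (\<Sum>k\<in>{i<..n}. r k)"
      unfolding R using i by (intro sum_split_atMost) auto
    ultimately show "(\<Sum>k\<le>n. if i < k then r k * te i else 0) = te i * (wzsum n - wzsum i)"
      by (simp add: sum_distrib_left mult.commute)
  qed
  also have "\<dots> = wzsum n * lam n - (\<Sum>i<n. te i * wzsum i)"
    by (simp add: lam_def right_diff_distrib sum_subtractf sum_distrib_left mult.commute)
  also have "(\<Sum>i<n. te i * wzsum i) = (\<Sum>j<n. \<Sum>l<n-j. te (j + l) * wzG j (Suc (j + l)))"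
  proof -
    have "(\<Sum>i<n. te i * wzsum i) = (\<Sum>i<n. \<Sum>j\<le>i. te i * wzG j (Suc i))"
      unfolding wzsum_eq sum_distrib_left ..
    also have "\<dots> = (\<Sum>(i, j)\<in>Sigma {..<n} (\<lambda>i. {..i}). te i * wzG j (Suc i))"
      by (rule sum.Sigma) auto
    also have "\<dots> = (\<Sum>(j, l)\<in>Sigma {..<n} (\<lambda>j. {..<n-j}). te (j + l) * wzG j (Suc (j + l)))"
      by (rule sum.reindex_bij_witness[of _ "\<lambda>(j, l). (j + l, j)" "\<lambda>(i, j). (j, i - j)"]) auto
    also have "\<dots> = (\<Sum>j<n. \<Sum>l<n-j. te (j + l) * wzG j (Suc (j + l)))"
      by (rule sum.Sigma[symmetric]) auto
    finally show ?thesis .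
  qed
  finally have eq: "(\<Sum>k\<le>n. r k * lam k) = wzsum n * lam n - (\<Sum>j<n. \<Sum>l<n-j. te (j + l) * wzG j (Suc (j + l)))" .
  have "cg 1 (wzsum n) 0"
    using cg_trans[OF cg_2_1[OF cg_wzsum_n] cg_p] by auto
  hence "cg 1 (wzsum n * lam n) (0 * lam n)" by (intro cg_mult_right L_lam) auto
  hence "cg 1 (\<Sum>k\<le>n. r k * lam k) (0 * lam n - (\<Sum>j<n. if 2 * j + 1 \<le> n then (- 1) ^ (n - 1) * of_nat ((n + 1) choose (2 * j + 2)) else 0))"
    unfolding eq by (intro cg_diff cg_sum cg_row) auto
  also have "0 * lam n - (\<Sum>j<n. if 2 * j + 1 \<le> n then (- 1) ^ (n - 1) * of_nat ((n + 1) choose (2 * j + 2)) else 0) =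
      (- 1) * (- 1) ^ (n - 1) * (\<Sum>j<n. if 2 * j + 1 \<le> n then of_nat ((n + 1) choose (2 * j + 2)) else (0::rat))"
    unfolding sum_distrib_left mult_zero_left diff_0 sum_negf[symmetric] by (intro sum.cong refl) simp
  also have "(- 1) * (- 1) ^ (n - 1) = ((- 1) ^ n :: rat)" using n_pos by (simp flip: power_Suc)
  finally show ?thesis unfolding sum_even_choose r_def .
qed

definition second_sum :: rat where
  "second_sum = (\<Sum>m=0..p-1. of_nat (((2 * m) choose m) * m * G m) / 128 ^ m)"

lemma L_second_sum: "second_sum \<in> L"
  unfolding second_sum_def by (intro L_sum L_divide unit_power) auto

lemma cg_second_sum: "cg 2 second_sum 0"
proof -
  have "second_sum = (\<Sum>m=0..p-1. of_nat m * (of_nat (((2 * m) choose m) * G m) / 128 ^ m))"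
    unfolding second_sum_def by (intro sum.cong) (auto simp: mult_ac)
  also have "\<dots> = (\<Sum>m<p. of_nat m * (cb m / 2 ^ m * gs m))"
    unfolding summand_eq using p_gt_0 by (intro sum.cong) auto
  finally have "2 * second_sum = (\<Sum>k<p. (- 1) ^ k * cb k ^ 2 * ((4 * of_nat k + 1) * trunc p k - tc k))"
    by (simp only: sum_index_cb_gs tc_def)
  also have "cg 2 \<dots> (\<Sum>k\<le>n. (- 1) ^ k * cb k ^ 2 * ((4 * of_nat k + 1) * trunc p k - tc k))"
    by (intro cg_truncate L_diff L_mult L_add L_trunc L_tc) auto
  also have "\<dots> = (\<Sum>k\<le>n. (4 * of_nat k + 1) * ts k * tm k) - (\<Sum>k\<le>n. (- 1) ^ k * cb k ^ 2 * tc k)"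
    unfolding sum_subtractf[symmetric]
  proof (intro sum.cong refl)
    fix k assume "k \<in> {..n}"
    hence "(- 1) ^ k * cb k ^ 2 * ((4 * of_nat k + 1) * trunc p k - tc k) =
        (4 * of_nat k + 1) * ((- 1) ^ k * cb k ^ 2 * trunc p k) - (- 1) ^ k * cb k ^ 2 * tc k"
      by (simp add: algebra_simps)
    thus "(- 1) ^ k * cb k ^ 2 * ((4 * of_nat k + 1) * trunc p k - tc k) =
        (4 * of_nat k + 1) * ts k * tm k - (- 1) ^ k * cb k ^ 2 * tc k"
      using trunc_eq[of k] \<open>k \<in> {..n}\<close> by simp
  qed
  also have "cg 2 \<dots> ((\<Sum>k\<le>n. (4 * of_nat k + 1) * ts k * (tm 0 - of_nat p * lam k)) -
      (\<Sum>k\<le>n. (- 1) ^ k * cb k ^ 2 * (of_nat p * (- 1) ^ k)))"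
    using n_less cg_tm unfolding lam_def by (intro cg_diff cg_sum cg_mult_left cg_tc) auto
  also have "\<dots> = wzsum n * tm 0 - of_nat p * (\<Sum>k\<le>n. (4 * of_nat k + 1) * ts k * lam k) - of_nat p * (\<Sum>k\<le>n. cb k ^ 2)"
  proof -
    have "(- 1) ^ k * cb k ^ 2 * (of_nat p * (- 1) ^ k) = of_nat p * cb k ^ 2" for k
      by (cases "even k") auto
    moreover have "wzsum n = (\<Sum>k\<le>n. (4 * of_nat k + 1) * ts k)" by (simp add: wzsum_def ts_def mult_ac)
    moreover have "(\<Sum>k\<le>n. (4 * of_nat k + 1) * ts k * (tm 0 - of_nat p * lam k)) =
        (\<Sum>k\<le>n. (4 * of_nat k + 1) * ts k * tm 0 - of_nat p * ((4 * of_nat k + 1) * ts k * lam k))"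
    proof -
      have "r * (t - q * l) = r * t - q * (r * l)" for r t q l :: rat by (simp add: algebra_simps)
      thus ?thesis by (simp only:)
    qed
    ultimately show ?thesis
      by (simp only: sum_subtractf sum_distrib_left sum_distrib_right)
  qed
  \<comment> \<open>Since \<open>tm 0\<close> is \<open>2 ^ n\<close> modulo \<open>p\<close>, the
    three contributions are \<open>p * (- 1) ^ n\<close> times \<open>2 ^ n\<close>,
    \<open>- (2 ^ n - 1)\<close> and \<open>- 1\<close>, with sum zero.\<close>
  also have "cg 2 \<dots> (of_nat p * (- 1) ^ n * tm 0 - of_nat p * ((- 1) ^ n * (2 ^ n - 1)) - of_nat p * (- 1) ^ n)"
  proof (intro cg_diff cg_lift cg_weighted cg_mult_right cg_wzsum_n L_tm)
    have "cg 1 (\<Sum>k\<le>n. cb k ^ 2) (\<Sum>k\<le>n. ((- 1) ^ k * of_nat (n choose k)) ^ 2)"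
      using n_less by (intro cg_sum cg_power cg_cb) auto
    also have "(\<Sum>k\<le>n. ((- 1) ^ k * of_nat (n choose k)) ^ 2) = (of_nat ((2 * n) choose n) :: rat)"
      unfolding choose_square_sum[symmetric] by (simp add: power_mult_distrib flip: power_mult)
    finally show "cg 1 (\<Sum>k\<le>n. cb k ^ 2) ((- 1) ^ n)" using cg_central cg_trans by blast
  qed simp
  also have "\<dots> = of_nat p * ((- 1) ^ n * tm 0 - (- 1) ^ n * 2 ^ n)"
    by (simp add: algebra_simps)
  also have "cg 2 \<dots> (of_nat p * ((- 1) ^ n * 2 ^ n - (- 1) ^ n * 2 ^ n))"
    by (intro cg_lift cg_diff cg_mult_left cg_tm_0 cg_refl) auto
  finally have "cg 2 (2 * second_sum) (2 * 0)" by simp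
  thus ?thesis by (simp only: cg_mult_unit_iff unit_2)
qed

end

section \<open>Lacunary binomial sums and the Clausen square to first order in
  \<open>p\<close>\<close>

lemma logcoeff_rev:
  assumes "a \<le> Suc K"
  shows "(\<Sum>q=a..K. (- 1) ^ q * of_nat (K choose q) / of_nat (Suc q - a)) = (- 1) ^ K * logcoeff K (Suc K - a)"
proof -
  have "(\<Sum>q=a..K. (- 1) ^ q * of_nat (K choose q) / of_nat (Suc q - a)) =
      (\<Sum>q<Suc K - a. (- 1) ^ K * ((- 1) ^ q * of_nat (K choose q) / of_nat (Suc K - a - q) :: rat))"
  proof (rule sum.reindex_bij_witness[of _ "\<lambda>q. K - q" "\<lambda>q. K - q"])
    fix q assume "q \<in> {a..K}"
    hence q: "q \<le> K" "a \<le> q" by auto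
    have "(- 1) ^ K * (- 1) ^ (K - q) = ((- 1) ^ q :: rat)"
      using q by (cases "even K"; cases "even q") (auto simp: minus_one_power_iff)
    moreover have "K choose (K - q) = K choose q" using q by (intro binomial_symmetric[symmetric])
    moreover have "Suc K - a - (K - q) = Suc q - a" using q by simp
    ultimately show "(- 1) ^ K * ((- 1) ^ (K - q) * of_nat (K choose (K - q)) / of_nat (Suc K - a - (K - q))) =
        ((- 1) ^ q * of_nat (K choose q) / of_nat (Suc q - a) :: rat)"
      by (simp only: mult.assoc[symmetric] times_divide_eq_right)
  qed auto
  thus ?thesis by (simp only: logcoeff_def sum_distrib_left)
qed

lemma sum_blocks:
  fixes f :: "nat \<Rightarrow> 'a::comm_monoid_add"
  assumes "p > 0"
  shows "(\<Sum>l\<le>p * N. f l) = (\<Sum>q\<le>N. f (p * q)) + (\<Sum>q<N. \<Sum>r=1..p-1. f (p * q + r))"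
proof (induction N)
  case (Suc N)
  have "(\<Sum>l\<le>p * Suc N. f l) = (\<Sum>l\<le>p * N. f l) + (\<Sum>l\<in>{p * N<..p * N + p}. f l)"
    by (subst sum_split_atMost[of "p * N"]) (auto simp: add.commute)
  also have "(\<Sum>l\<in>{p * N<..p * N + p}. f l) = (\<Sum>r=1..p. f (p * N + r))"
    by (rule sum.reindex_bij_witness[of _ "\<lambda>r. p * N + r" "\<lambda>l. l - p * N"]) auto
  also have "\<dots> = (\<Sum>r=1..p-1. f (p * N + r)) + f (p * Suc N)"
  proof -
    have "{1..p} = insert p {1..p-1}" using assms by auto
    thus ?thesis using assms by (simp add: add.commute)
  qed
  finally show ?case unfolding Suc by (simp add: add_ac)
qed simp

lemma odd_harmonic: "(\<Sum>k<m. 1 / (2 * of_nat k + 1)) = rharm (2 * m) - rharm m / 2"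
proof (induction m)
  case (Suc m)
  have "2 * Suc m = Suc (Suc (2 * m))" by simp
  hence "rharm (2 * Suc m) = rharm (2 * m) + 1 / of_nat (Suc (2 * m)) + 1 / of_nat (Suc (Suc (2 * m)))"
    by (simp only: rharm_Suc)
  also have "of_nat (Suc (2 * m)) = (2 * of_nat m + 1 :: rat)" by simp
  also have "of_nat (Suc (Suc (2 * m))) = (2 * of_nat (Suc m) :: rat)" by simp
  finally have "rharm (2 * Suc m) - rharm (Suc m) / 2 = rharm (2 * m) - rharm m / 2 + 1 / (2 * of_nat m + 1)"
    unfolding rharm_Suc by (simp add: add_divide_distrib mult.commute del: of_nat_Suc)
  thus ?case using Suc by simp
qed simp

context odd_prime
begin

text \<open>Coefficient comparison in \<open>(1 + x) ^ (p + A)\<close>, where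
  \<open>(1 + x) ^ p\<close> is \<open>1 + x ^ p\<close> modulo \<open>p\<close>.\<close>

lemma cg_pascal_p:
  "cg 1 (of_nat ((p + A) choose l)) (of_nat (A choose l) + (if p \<le> l then of_nat (A choose (l - p)) else 0))"
proof -
  have "(of_nat ((p + A) choose l) :: rat) = (\<Sum>k\<le>l. of_nat (p choose k) * of_nat (A choose (l - k)))"
    unfolding vandermonde[symmetric] by simp
  also have "cg 1 \<dots> (\<Sum>k\<le>l. (if k = 0 then of_nat (A choose l) else 0) + (if k = p then of_nat (A choose (l - p)) else 0))"
  proof (intro cg_sum)
    fix k
    consider "k = 0" | "k = p" | "0 < k" "k < p" | "p < k" by linarith
    thus "cg 1 (of_nat (p choose k) * of_nat (A choose (l - k)))
        ((if k = 0 then of_nat (A choose l) else 0) + (if k = p then of_nat (A choose (l - p)) else 0))"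
    proof cases
      case 3
      have "(- 1) ^ (k - 1) / of_nat k \<in> L"
        using 3 by (intro L_divide L_power unit_of_nat_less) auto
      hence "cg 1 (of_nat (p choose k)) 0"
        by (rule cg_trans[OF cg_2_1[OF cg_choose_p[OF 3]] cg_p])
      hence "cg 1 (of_nat (p choose k) * of_nat (A choose (l - k))) (0 * of_nat (A choose (l - k)))"
        by (intro cg_mult_right) auto
      thus ?thesis using 3 by simp
    qed (use p_gt_0 in \<open>auto simp: binomial_eq_0\<close>)
  qed
  also have "\<dots> = of_nat (A choose l) + (if p \<le> l then of_nat (A choose (l - p)) else 0)"
    by (simp add: sum.distrib)
  finally show ?thesis .
qed

text \<open>Lucas' congruence for the upper entry \<open>p * N + (p - 1)\<close>; the factor
  \<open>(p - 1) choose s\<close> is \<open>(- 1) ^ s\<close>.\<close>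

lemma cg_choose_pN_pred:
  assumes "s < p"
  shows "cg 1 (of_nat ((p * Suc N - 1) choose (p * q + s))) ((- 1) ^ s * of_nat (N choose q))"
proof (induction N arbitrary: q)
  case 0
  show ?case
  proof (cases q)
    case 0
    thus ?thesis using cg_choose_pred[OF assms] by simp
  next
    case (Suc q')
    have "p - 1 < p * q + s" using Suc p_gt_0 by simp
    thus ?thesis using Suc by (simp add: binomial_eq_0)
  qed
next
  case (Suc N)
  have e: "p * Suc (Suc N) - 1 = p + (p * Suc N - 1)" using p_gt_0 by simp
  show ?case
  proof (cases q)
    case 0
    thus ?thesis
      using cg_trans[OF cg_pascal_p[of "p * Suc N - 1" s]] Suc.IH[of 0] assms unfolding e by simp
  next
    case (Suc q')
    have "p \<le> p * q + s" "p * q + s - p = p * q' + s" using Suc by simp_all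
    hence "cg 1 (of_nat ((p + (p * Suc N - 1)) choose (p * q + s)))
       (of_nat ((p * Suc N - 1) choose (p * q + s)) + of_nat ((p * Suc N - 1) choose (p * q' + s)))"
      using cg_pascal_p[of "p * Suc N - 1" "p * q + s"] by simp
    also have "cg 1 \<dots> ((- 1) ^ s * of_nat (N choose q) + (- 1) ^ s * of_nat (N choose q'))"
      by (intro cg_add Suc.IH)
    also have "\<dots> = (- 1) ^ s * of_nat (Suc N choose q)"
      unfolding Suc by (simp add: algebra_simps)
    finally show ?thesis unfolding e .
  qed
qed

lemma cg_choose_pN_0: "\<not> p dvd l \<Longrightarrow> cg 1 (of_nat ((p * N) choose l)) 0"
proof -
  assume l: "\<not> p dvd l"
  hence "l > 0" by (cases l) auto
  hence "l * ((p * N) choose l) = p * N * ((p * N - 1) choose (l - 1))"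
    using binomial_absorption[of "l - 1" "p * N"] by simp
  hence "p dvd l * ((p * N) choose l)" by simp
  hence "p dvd (p * N) choose l" using l prime_p by (simp add: prime_dvd_mult_iff)
  thus ?thesis using cg_of_nat_iff[of 1 "(p * N) choose l" 0] by simp
qed

text \<open>In the Vandermonde expansion with upper entries \<open>p\<close> and
  \<open>p * N\<close> both factors of a middle term are divisible by \<open>p\<close>, so modulo
  \<open>p ^ 2\<close> only the two end terms survive and Pascal's rule results.\<close>

lemma cg_choose_pN: "cg 2 (of_nat ((p * N) choose (p * q))) (of_nat (N choose q))"
proof (induction N arbitrary: q)
  case 0
  show ?case using p_gt_0 by (cases q) (auto simp: binomial_eq_0)
next
  case (Suc N)
  show ?case
  proof (cases q)
    case (Suc q')
    have "(of_nat ((p * Suc N) choose (p * q)) :: rat) =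
        (\<Sum>k\<le>p * q. of_nat (p choose k) * of_nat ((p * N) choose (p * q - k)))"
      using vandermonde[of p "p * N" "p * q"] by (simp flip: of_nat_mult of_nat_sum)
    also have "cg 2 \<dots> (\<Sum>k\<le>p * q. (if k = 0 then of_nat ((p * N) choose (p * q)) else 0)
        + (if k = p then of_nat ((p * N) choose (p * q')) else 0))"
    proof (intro cg_sum)
      fix k assume k: "k \<in> {..p * q}"
      consider "k = 0" | "k = p" | "0 < k" "k < p" | "p < k" by linarith
      thus "cg 2 (of_nat (p choose k) * of_nat ((p * N) choose (p * q - k)))
          ((if k = 0 then of_nat ((p * N) choose (p * q)) else 0)
            + (if k = p then of_nat ((p * N) choose (p * q')) else 0))"
      proof cases
        case 3
        have nk: "\<not> p dvd k" using 3 by (auto dest: dvd_imp_le)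
        have "\<not> p dvd p * q - k"
        proof
          assume "p dvd p * q - k"
          hence "p dvd p * q - (p * q - k)" by (rule dvd_diff_nat[OF dvd_triv_left])
          moreover have "p * q - (p * q - k) = k" using k by simp
          ultimately show False using nk by (simp only:)
        qed
        moreover have "cg 1 (of_nat (p choose k)) 0"
          using cg_choose_pN_0[OF nk, of 1] by simp
        ultimately have "cg 2 (of_nat (p choose k) * of_nat ((p * N) choose (p * q - k))) 0"
          by (intro cg_2_0 cg_choose_pN_0) auto
        thus ?thesis using 3 by simp
      qed (use p_gt_0 Suc in \<open>auto simp: binomial_eq_0\<close>)
    qed
    also have "\<dots> = of_nat ((p * N) choose (p * q)) + of_nat ((p * N) choose (p * q'))"
      using Suc by (simp add: sum.distrib)
    also have "cg 2 \<dots> (of_nat (N choose q) + of_nat (N choose q'))"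
      by (intro cg_add Suc.IH)
    finally show ?thesis using Suc by (simp add: add.commute)
  qed simp
qed

text \<open>Absorption extracts the factor \<open>p\<close>; the remaining factors are then needed
  only modulo \<open>p\<close>.\<close>

lemma cg_choose_pN_rem:
  assumes "0 < r" "r < p"
  shows "cg 2 (of_nat ((p * Suc N) choose (p * q + r)))
     (of_nat p * (of_nat (Suc N) * (1 / of_nat r) * (- 1) ^ (r - 1) * of_nat (N choose q)))"
proof -
  define l where "l = p * q + r"
  have "\<not> p dvd r" using assms by (auto dest: dvd_imp_le)
  hence "\<not> p dvd l" by (simp add: l_def dvd_add_right_iff)
  hence u: "unit (of_nat l)" by (rule unit_of_nat)
  have l: "cg 1 (of_nat l) (of_nat r)" by (rule cg_I[of _ _ _ "of_nat q"]) (auto simp: l_def)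
  have pred: "l - 1 = p * q + (r - 1)" using assms by (simp add: l_def)
  have "l * ((p * Suc N) choose l) = p * Suc N * ((p * Suc N - 1) choose (l - 1))"
    using binomial_absorption[of "l - 1" "p * Suc N"] assms by (simp add: l_def)
  hence "of_nat l * of_nat ((p * Suc N) choose l) =
      (of_nat p * of_nat (Suc N) * of_nat ((p * Suc N - 1) choose (l - 1)) :: rat)"
    by (simp only: of_nat_mult[symmetric])
  hence "of_nat ((p * Suc N) choose l) =
      (of_nat p * (of_nat (Suc N) * (1 / of_nat l) * of_nat ((p * Suc N - 1) choose (l - 1))) :: rat)"
    using unit_nonzero[OF u] by (simp add: field_simps del: of_nat_Suc)
  also have "cg 2 \<dots> (of_nat p * (of_nat (Suc N) * (1 / of_nat r) * ((- 1) ^ (r - 1) * of_nat (N choose q))))"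
  proof -
    have ur: "unit (of_nat r)" using assms by (rule unit_of_nat_less)
    have "cg 1 (1 / of_nat l) (1 / of_nat r)" by (intro cg_divide cg_refl l u ur) auto
    moreover have "cg 1 (of_nat ((p * Suc N - 1) choose (l - 1))) ((- 1) ^ (r - 1) * of_nat (N choose q))"
      unfolding pred using assms by (intro cg_choose_pN_pred) auto
    ultimately show ?thesis
      using u ur by (intro cg_lift cg_mult cg_mult_left L_mult L_divide L_power) auto
  qed
  finally show ?thesis by (simp add: l_def mult_ac)
qed

text \<open>\<open>D * jsum \<delta> D c\<close> is the value of the sum of
  \<open>z ^ c * (1 + \<delta> * z) ^ (p * n)\<close> over the \<open>D\<close>-th roots of unity
  \<open>z\<close>, by orthogonality.\<close>

definition jsum :: "int \<Rightarrow> nat \<Rightarrow> nat \<Rightarrow> int" where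
  "jsum \<delta> D c = (\<Sum>l\<le>p * n. if D dvd c + l then \<delta> ^ l * int ((p * n) choose l) else 0)"

lemma cg_jsum:
  "cg 2 (of_int (jsum \<delta> D c))
    ((\<Sum>q\<le>n. if D dvd c + p * q then of_int \<delta> ^ (p * q) * of_nat (n choose q) else 0) +
     of_nat p * (\<Sum>q<n. \<Sum>r=1..p-1. if D dvd c + (p * q + r) then
        of_int \<delta> ^ (p * q + r) * (of_nat n * (1 / of_nat r) * (- 1) ^ (r - 1) * of_nat ((n - 1) choose q)) else 0))"
proof -
  obtain N where N: "n = Suc N" using n_pos gr0_implies_Suc by blast
  have "(of_int (jsum \<delta> D c) :: rat) =
      (\<Sum>l\<le>p * n. if D dvd c + l then of_int \<delta> ^ l * of_nat ((p * n) choose l) else 0)"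
    unfolding jsum_def of_int_sum by (intro sum.cong) auto
  also have "\<dots> = (\<Sum>q\<le>n. if D dvd c + p * q then of_int \<delta> ^ (p * q) * of_nat ((p * n) choose (p * q)) else 0) +
      (\<Sum>q<n. \<Sum>r=1..p-1. if D dvd c + (p * q + r) then of_int \<delta> ^ (p * q + r) * of_nat ((p * n) choose (p * q + r)) else 0)"
    by (rule sum_blocks[OF p_gt_0])
  also have "cg 2 \<dots> ((\<Sum>q\<le>n. if D dvd c + p * q then of_int \<delta> ^ (p * q) * of_nat (n choose q) else 0) +
     (\<Sum>q<n. \<Sum>r=1..p-1. of_nat p * (if D dvd c + (p * q + r) then
        of_int \<delta> ^ (p * q + r) * (of_nat n * (1 / of_nat r) * (- 1) ^ (r - 1) * of_nat ((n - 1) choose q)) else 0)))"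
  proof (intro cg_add cg_sum)
    fix q
    show "cg 2 (if D dvd c + p * q then of_int \<delta> ^ (p * q) * of_nat ((p * n) choose (p * q)) else 0)
       (if D dvd c + p * q then of_int \<delta> ^ (p * q) * of_nat (n choose q) else 0)"
      by (auto intro!: cg_mult_left cg_choose_pN)
    fix r assume "r \<in> {1..p-1}"
    hence r: "0 < r" "r < p" by auto
    have "cg 2 (of_int \<delta> ^ (p * q + r) * of_nat ((p * n) choose (p * q + r)))
       (of_int \<delta> ^ (p * q + r) * (of_nat p * (of_nat n * (1 / of_nat r) * (- 1) ^ (r - 1) * of_nat ((n - 1) choose q))))"
      using cg_choose_pN_rem[OF r, of N q] unfolding N by (intro cg_mult_left) auto
    thus "cg 2 (if D dvd c + (p * q + r) then of_int \<delta> ^ (p * q + r) * of_nat ((p * n) choose (p * q + r)) else 0)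
       (of_nat p * (if D dvd c + (p * q + r) then
        of_int \<delta> ^ (p * q + r) * (of_nat n * (1 / of_nat r) * (- 1) ^ (r - 1) * of_nat ((n - 1) choose q)) else 0))"
      by (simp add: mult_ac)
  qed
  finally show ?thesis by (simp only: sum_distrib_left)
qed

text \<open>The parameter is \<open>m + 1/2\<close> for \<open>n = 2 * m\<close> and
  \<open>m + 3/2\<close> for \<open>n = 2 * m + 1\<close>, which covers both cases of Clausen's
  formula, and its form lets \<open>legendre_value_convolution\<close> apply with
  \<open>x = p / 2\<close>.\<close>

definition leg :: rat where
  "leg = legendre_value (of_nat p / 2 - of_nat (n div 2)) (n div 2)"

lemma clausen_leg: "clausen_value n = (if even n then leg ^ 2 else 2 * leg ^ 2)"
proof (cases "even n")
  case True
  then obtain m where m: "n = 2 * m" by (rule evenE)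
  hence d: "n div 2 = m" by simp
  have e: "of_nat p / 2 - of_nat m = (of_nat m + 1/2 :: rat)" by (simp add: p_eq m field_simps)
  have "leg = legendre_value (of_nat m + 1/2) m" unfolding leg_def d e ..
  hence "clausen_value (2 * m) = leg ^ 2" by (simp only: clausen_even)
  thus ?thesis using True unfolding m[symmetric] by simp
next
  case False
  then obtain m where m: "n = 2 * m + 1" by (rule oddE)
  hence d: "n div 2 = m" by simp
  have e: "of_nat p / 2 - of_nat m = (of_nat m + 3/2 :: rat)" by (simp add: p_eq m field_simps)
  have "leg = legendre_value (of_nat m + 3/2) m" unfolding leg_def d e ..
  hence "clausen_value (2 * m + 1) = 2 * leg ^ 2" by (simp only: clausen_odd)
  thus ?thesis using False unfolding m[symmetric] by simp
qed

text \<open>The convolution runs over rising factorials of \<open>p / 2\<close> whose index has the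
  parity of \<open>n div 2\<close>; for odd parity index 0 never occurs, and every term has a factor
  \<open>p\<close>.\<close>

lemma cg_leg_odd: "odd (n div 2) \<Longrightarrow> cg 1 leg 0"
proof -
  assume odd: "odd (n div 2)"
  define m where "m = n div 2"
  have "cg 1 (\<Sum>h\<le>m div 2. (- 1) ^ h * of_nat (m choose h) * rising (of_nat p / 2) (m - 2 * h))
      (\<Sum>h\<le>m div 2. (- 1) ^ h * of_nat (m choose h) * 0)"
  proof (intro cg_sum cg_mult_left)
    fix h assume "h \<in> {..m div 2}"
    hence j: "0 < m - 2 * h" "m - 2 * h < p" using odd n_less unfolding m_def by (auto elim!: oddE)
    have "cg 1 (rising (of_nat p / 2) (m - 2 * h)) (of_nat p * (1 / (2 * of_nat (m - 2 * h))))"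
      by (intro cg_2_1 cg_rising_p_half j)
    also have "cg 1 \<dots> 0" using j by (intro cg_p L_divide unit_mult unit_of_nat_less) auto
    finally show "cg 1 (rising (of_nat p / 2) (m - 2 * h)) 0" .
  qed auto
  thus ?thesis unfolding leg_def legendre_value_convolution m_def by simp
qed

text \<open>The central term \<open>h = M\<close> is the only one without a factor \<open>p\<close>.
  To first order the others form the coefficient \<open>logcoeff (2 * M) M\<close>, hence a
  difference of harmonic numbers.\<close>

lemma cg_leg_even:
  assumes "n div 2 = 2 * M"
  shows "cg 2 leg ((- 1) ^ M * of_nat ((2 * M) choose M) * (1 - of_nat p * ((rharm (2 * M) - rharm M) / 4)))"
proof -
  have M: "2 * M < p" using assms n_less by linarith
  have "leg = (\<Sum>h<M. (- 1) ^ h * of_nat ((2 * M) choose h) * rising (of_nat p / 2) (2 * M - 2 * h)) +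
      (- 1) ^ M * of_nat ((2 * M) choose M)"
    unfolding leg_def legendre_value_convolution assms
    by (simp add: lessThan_Suc_atMost[symmetric])
  also have "cg 2 \<dots> ((\<Sum>h<M. (- 1) ^ h * of_nat ((2 * M) choose h) * (of_nat p * (1 / (2 * of_nat (2 * M - 2 * h))))) +
      (- 1) ^ M * of_nat ((2 * M) choose M))"
    using M by (intro cg_add cg_refl cg_sum cg_mult_left cg_rising_p_half) auto
  also have "(\<Sum>h<M. (- 1) ^ h * of_nat ((2 * M) choose h) * (of_nat p * (1 / (2 * of_nat (2 * M - 2 * h))))) =
      of_nat p / 4 * logcoeff (2 * M) M"
    unfolding logcoeff_def sum_distrib_left
  proof (intro sum.cong refl)
    fix h assume "h \<in> {..<M}"
    have e: "(of_nat (2 * M - 2 * h) :: rat) = 2 * of_nat (M - h)"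
      by (simp flip: diff_mult_distrib2)
    show "(- 1) ^ h * of_nat ((2 * M) choose h) * (of_nat p * (1 / (2 * of_nat (2 * M - 2 * h)))) =
        of_nat p / 4 * ((- 1) ^ h * of_nat ((2 * M) choose h) / of_nat (M - h) :: rat)"
      unfolding e by simp
  qed
  also have "of_nat p / 4 * logcoeff (2 * M) M + (- 1) ^ M * of_nat ((2 * M) choose M) =
      (- 1) ^ M * of_nat ((2 * M) choose M) * (1 - of_nat p * ((rharm (2 * M) - rharm M) / 4))"
    by (subst logcoeff_eq) (simp_all add: algebra_simps add_divide_distrib diff_divide_distrib)
  finally show ?thesis .
qed

lemma cg_prod_linear:
  fixes a :: "nat \<Rightarrow> rat"
  assumes "\<And>i. i < M \<Longrightarrow> unit (a i)"
  shows "cg 2 (\<Prod>i<M. a i - of_nat p / 2) ((\<Prod>i<M. a i) * (1 - of_nat p * (\<Sum>i<M. 1 / (2 * a i))))"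
  using assms
proof (induction M)
  case (Suc M)
  have u: "unit (a M)" using Suc.prems by simp
  define P S where "P = (\<Prod>i<M. a i)" and "S = (\<Sum>i<M. 1 / (2 * a i))"
  have PL: "P \<in> L" unfolding P_def using Suc.prems by (intro L_prod unit_L) auto
  have SL: "S \<in> L" unfolding S_def using Suc.prems by (intro L_sum L_divide unit_mult) auto
  have "cg 2 ((\<Prod>i<M. a i - of_nat p / 2) * (a M - of_nat p / 2)) (P * (1 - of_nat p * S) * (a M - of_nat p / 2))"
    unfolding P_def S_def using Suc u by (intro cg_mult_right) auto
  also have "cg 2 \<dots> (P * a M * (1 - of_nat p * (S + 1 / (2 * a M))))"
    by (rule cg_I[of _ _ _ "P * S / 2"])
       (use u unit_nonzero[OF u] PL SL in \<open>auto simp: field_simps power2_eq_square\<close>)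
  finally show ?case by (simp add: P_def S_def)
qed simp

text \<open>\<open>oh M\<close> is the odd harmonic sum \<open>1 + 1/3 + \<dots> + 1/(2 M - 1)\<close>.\<close>

definition oh :: "nat \<Rightarrow> rat" where
  "oh M = rharm (2 * M) - rharm M / 2"

text \<open>First-order expansion of the Pochhammer symbol of \<open>- n = 1/2 - p/2\<close> around
  \<open>1/2\<close>.\<close>

lemma cg_choose_n:
  assumes "M \<le> n"
  shows "cg 2 (of_nat (n choose M)) ((- 1) ^ M * cb M * (1 - of_nat p * oh M))"
proof -
  have u: "unit (1/2 + of_nat i)" if "i < M" for i
  proof -
    have "unit ((2 * of_nat i + 1) / 2)" using that assms by (intro unit_divide unit_odd) auto
    thus ?thesis by (simp add: add_divide_distrib add.commute)
  qed
  have "(of_nat (n choose M) :: rat) = (- 1) ^ M * rising (- of_nat n) M"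
    by (simp add: rising_minus_of_nat flip: power_mult_distrib mult.assoc)
  also have "rising (- of_nat n) M = 1 / fact M * (\<Prod>i<M. (1/2 + of_nat i) - of_nat p / 2)"
    by (simp add: rising_def pochhammer_prod of_nat_n atLeast0LessThan algebra_simps)
  also have "cg 2 ((- 1) ^ M * \<dots>) ((- 1) ^ M * (1 / fact M * ((\<Prod>i<M. 1/2 + of_nat i) * (1 - of_nat p * (\<Sum>i<M. 1 / (2 * (1/2 + of_nat i)))))))"
    using assms n_less u by (intro cg_mult_left cg_prod_linear L_divide unit_fact) auto
  also have "(\<Sum>i<M. 1 / (2 * (1/2 + of_nat i))) = oh M"
    unfolding oh_def odd_harmonic[symmetric] by (intro sum.cong) (auto simp: distrib_left add.commute)
  finally show ?thesis
    by (simp add: rising_def pochhammer_prod atLeast0LessThan mult.assoc)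
qed

text \<open>Modulo \<open>p\<close> the removed terms \<open>1 / (n - k)\<close> are
  \<open>- 2 / (2 * k + 1)\<close>, which is how odd harmonic sums enter.\<close>

lemma cg_rharm_shift:
  assumes "2 * M \<le> n"
  shows "cg 1 (rharm (n - M)) (rharm n + 2 * oh M)"
proof -
  have split: "rharm n = rharm (n - M) + (\<Sum>k<M. 1 / of_nat (n - k))"
    using assms
  proof (induction M)
    case (Suc M)
    have "n - M = Suc (n - Suc M)" using Suc.prems by simp
    hence "rharm (n - M) = rharm (n - Suc M) + 1 / of_nat (n - M)" by (simp add: rharm_Suc)
    thus ?case using Suc by simp
  qed simp
  have "cg 1 (\<Sum>k<M. 1 / of_nat (n - k)) (\<Sum>k<M. - 2 * (1 / (2 * of_nat k + 1)))"
  proof (intro cg_sum)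
    fix k assume "k \<in> {..<M}"
    hence k: "k < n" "0 < n - k" "n - k < p" using assms n_less by auto
    have "cg 1 (of_nat (n - k)) (- (2 * of_nat k + 1) / 2)"
      by (rule cg_I[of _ _ _ "1/2"]) (use k in \<open>auto simp: of_nat_diff of_nat_n field_simps\<close>)
    hence "cg 1 (1 / of_nat (n - k)) (1 / (- (2 * of_nat k + 1) / 2))"
      using k by (intro cg_divide cg_refl unit_of_nat_less unit_divide unit_minus unit_odd) auto
    thus "cg 1 (1 / of_nat (n - k)) (- 2 * (1 / (2 * of_nat k + 1)))"
      by (simp flip: divide_minus_right)
  qed
  hence "cg 1 (rharm n - (\<Sum>k<M. 1 / of_nat (n - k))) (rharm n - (\<Sum>k<M. - 2 * (1 / (2 * of_nat k + 1))))"
    by (intro cg_diff cg_refl)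
  moreover have "(\<Sum>k<M. - 2 * (1 / (2 * of_nat k + 1))) = - 2 * oh M"
    unfolding sum_distrib_left[symmetric] odd_harmonic oh_def ..
  ultimately show ?thesis using split by simp
qed

end

lemma dvd_between:
  fixes D v :: nat
  assumes "D dvd v" "0 < v" "v < 3 * D" shows "v = D \<or> v = 2 * D"
proof -
  obtain k where k: "v = D * k" using assms(1) by blast
  hence "D * k < D * 3" using assms(3) by (simp only: mult.commute)
  hence "k < 3" by (simp only: nat_mult_less_cancel1 mult_less_cancel1)
  hence "k = 0 \<or> k = 1 \<or> k = 2" by auto
  thus ?thesis using k assms(2) by auto
qed

lemma minus_one_power_odd_mult:
  assumes "odd p" "0 < r"
  shows "(- 1) ^ (p * q + r) * (a * (- 1) ^ (r - 1) * b) = - (a * ((- 1) ^ q * b :: rat))"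
proof -
  obtain s where "r = Suc s" using assms(2) gr0_implies_Suc by blast
  thus ?thesis using assms(1)
    by (cases "even q"; cases "even s") (auto simp: minus_one_power_iff)
qed

context odd_prime
begin

lemma cg_one_plus:
  assumes "a \<in> L" "b \<in> L"
  shows "cg 2 ((1 + of_nat p * a) * (1 + of_nat p * b)) (1 + of_nat p * (a + b))"
  by (rule cg_I[of _ _ _ "a * b"]) (use assms in \<open>auto simp: algebra_simps power2_eq_square\<close>)

lemma L_oh: "2 * M < p \<Longrightarrow> oh M \<in> L"
  unfolding oh_def by (intro L_diff L_half L_rharm) auto

text \<open>Both sides are \<open>cb M ^ 2\<close> times a factor \<open>1 + p * e\<close>. For
  \<open>J ^ 2\<close> the exponent \<open>e\<close> is \<open>2 * (h - oh M)\<close>; for the sum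
  it is minus half of \<open>rharm (2 * M) - rharm M\<close>, from the square of \<open>leg\<close>,
  minus \<open>rharm n / 4\<close>. Solving for \<open>h\<close>, with
  \<open>rharm (2 * M) = oh M + rharm M / 2\<close>, gives the coefficients in the assumption on
  \<open>h\<close>.\<close>

lemma cg_square_main_sum:
  assumes J: "cg 2 J (s * of_nat (n choose M) * (1 + of_nat p * h))" and s: "s ^ 2 = 1" "s \<in> L"
    and h: "cg 1 h (- (1/8) * rharm n + 3/4 * oh M + 1/8 * rharm M)"
    and n: "n = 4 * M \<or> n = 4 * M + 1"
  shows "cg 2 (J ^ 2) main_sum"
proof -
  define h0 where "h0 = - (1/8) * rharm n + 3/4 * oh M + 1/8 * rharm M"
  have M: "2 * M < p" "M \<le> n" "M < p" using n n_less by auto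
  have inv8: "1/8 \<in> L" "1/4 \<in> L" by (intro L_divide; simp)+
  have L34: "3/4 \<in> L" by (intro L_divide) auto
  have Lo: "oh M \<in> L" "rharm M \<in> L" "rharm (2 * M) \<in> L" using M by (auto intro: L_oh L_rharm)
  have Lh0: "h0 \<in> L" unfolding h0_def using inv8 L34 Lo by (intro L_add L_mult L_minus) auto
  have "cg 2 J (s * of_nat (n choose M) * (1 + of_nat p * h0))"
    using s(2) h unfolding h0_def[symmetric]
    by (intro cg_trans[OF J] cg_mult_left cg_add cg_refl cg_lift) auto
  also have "cg 2 \<dots> (s * ((- 1) ^ M * cb M * (1 - of_nat p * oh M)) * (1 + of_nat p * h0))"
    using s(2) Lh0 M by (intro cg_mult_right cg_mult_left cg_choose_n) auto
  also have "\<dots> = s * (- 1) ^ M * cb M * ((1 + of_nat p * (- oh M)) * (1 + of_nat p * h0))" by simp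
  also have "cg 2 \<dots> (s * (- 1) ^ M * cb M * (1 + of_nat p * (- oh M + h0)))"
    using s(2) Lh0 Lo by (intro cg_mult_left cg_one_plus) auto
  finally have "cg 2 (J ^ 2) ((s * (- 1) ^ M * cb M * (1 + of_nat p * (- oh M + h0))) ^ 2)"
    using s(2) Lh0 Lo by (intro cg_power) auto
  also have "(s * (- 1) ^ M * cb M * (1 + of_nat p * (- oh M + h0))) ^ 2 =
      cb M ^ 2 * ((1 + of_nat p * (- oh M + h0)) * (1 + of_nat p * (- oh M + h0)))"
    using s(1) by (simp add: power_mult_distrib power2_eq_square[of "1 + _"] flip: power_mult)
  also have "cg 2 \<dots> (cb M ^ 2 * (1 + of_nat p * ((- oh M + h0) + (- oh M + h0))))"
    using Lh0 Lo by (intro cg_mult_left cg_one_plus) auto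
  finally have J2: "cg 2 (J ^ 2) (cb M ^ 2 * (1 + of_nat p * ((- oh M + h0) + (- oh M + h0))))" .
  define g where "g = - ((rharm (2 * M) - rharm M) / 4)"
  have Lg: "g \<in> L" unfolding g_def using Lo by (intro L_minus L_divide) auto
  define e where "e = (if even n then 1 else 2 :: rat)"
  have "cg 2 main_sum (clausen_value n * (1 / 2 ^ n * (1 - of_nat p * (rharm n / 4))))"
    by (rule cg_main_sum)
  also have "\<dots> = leg ^ 2 * (e / 2 ^ n * (1 + of_nat p * (- (rharm n / 4))))"
    by (simp add: clausen_leg e_def)
  also have "cg 2 \<dots> (((- 1) ^ M * of_nat ((2 * M) choose M) * (1 + of_nat p * g)) ^ 2 * (e / 2 ^ n * (1 + of_nat p * (- (rharm n / 4)))))"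
  proof -
    have "n div 2 = 2 * M" using n by auto
    from cg_leg_even[OF this] have "cg 2 leg ((- 1) ^ M * of_nat ((2 * M) choose M) * (1 + of_nat p * g))"
      by (simp add: g_def)
    thus ?thesis using Lg
      by (intro cg_mult_right cg_power L_mult L_add L_divide) (auto simp: e_def)
  qed
  also have "((- 1) ^ M * of_nat ((2 * M) choose M) * (1 + of_nat p * g)) ^ 2 * (e / 2 ^ n * (1 + of_nat p * (- (rharm n / 4))))
      = cb M ^ 2 * ((1 + of_nat p * g) * (1 + of_nat p * g)) * (1 + of_nat p * (- (rharm n / 4)))"
  proof -
    have c: "of_nat ((2 * M) choose M) = 4 ^ M * cb M" by (simp add: cb_eq)
    \<comment> \<open>The powers of 2 cancel exactly: the extra factor 2 of the odd Clausen case is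
      needed for \<open>n = 4 * M + 1\<close>.\<close>
    have "(4 ^ M) ^ 2 * e = (2 ^ n :: rat)"
    proof -
      have "(4 ^ M) ^ 2 = (2 ^ (4 * M) :: rat)" by (simp add: power_mult power2_eq_square flip: power_mult_distrib)
      thus ?thesis using n by (auto simp: e_def)
    qed
    hence f: "(4 ^ M) ^ 2 * (e / 2 ^ n) = (1 :: rat)" by simp
    have "((- 1) ^ M * (4 ^ M * cb M) * (1 + of_nat p * g)) ^ 2 * (e / 2 ^ n * (1 + of_nat p * (- (rharm n / 4)))) =
        ((4 ^ M) ^ 2 * (e / 2 ^ n)) * (((- 1) ^ M) ^ 2 * (cb M ^ 2 * (1 + of_nat p * g) ^ 2 * (1 + of_nat p * (- (rharm n / 4)))))"
      by (simp only: power_mult_distrib mult_ac)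
    also have "((- 1) ^ M) ^ 2 = (1 :: rat)" by (simp flip: power_mult)
    finally show ?thesis unfolding c f by (simp only: power2_eq_square mult_1_left)
  qed
  also have "cg 2 \<dots> (cb M ^ 2 * (1 + of_nat p * (g + g)) * (1 + of_nat p * (- (rharm n / 4))))"
    using Lg by (intro cg_mult_right cg_mult_left cg_one_plus L_add L_mult L_minus L_divide) auto
  also have "\<dots> = cb M ^ 2 * ((1 + of_nat p * (g + g)) * (1 + of_nat p * (- (rharm n / 4))))" by simp
  also have "cg 2 \<dots> (cb M ^ 2 * (1 + of_nat p * ((g + g) + - (rharm n / 4))))"
    using Lg by (intro cg_mult_left cg_one_plus L_add L_minus L_divide) auto
  also have "(g + g) + - (rharm n / 4) = (- oh M + h0) + (- oh M + h0)"
    by (simp add: g_def h0_def oh_def field_simps)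
  finally have "cg 2 main_sum (cb M ^ 2 * (1 + of_nat p * ((- oh M + h0) + (- oh M + h0))))" .
  thus ?thesis using J2 cg_sym cg_trans by blast
qed

text \<open>The left side is a quotient of two binomial coefficients with upper entry
  \<open>p - 1\<close>, each of them a sign modulo \<open>p\<close>. It gives the product of
  \<open>J\<close> and its conjugate.\<close>

lemma cg_choose_quotient:
  assumes "r < p"
  shows "cg 1 (fact n ^ 2 / (fact r * fact (p - 1 - r))) ((- 1) ^ r * (- 1) ^ n)"
proof -
  have "(of_nat ((p - 1) choose r) :: rat) = fact (p - 1) / (fact r * fact (p - 1 - r))"
    using assms by (intro binomial_fact) auto
  moreover have "p - 1 = 2 * n" by (simp add: p_eq)
  hence "(of_nat ((p - 1) choose n) :: rat) = fact (p - 1) / (fact n * fact n)"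
    using binomial_fact[of n "2 * n", where ?'a = rat] by simp
  ultimately have "fact n ^ 2 / (fact r * fact (p - 1 - r)) =
      (of_nat ((p - 1) choose r) / of_nat ((p - 1) choose n) :: rat)"
    by (simp add: power2_eq_square)
  also have "cg 1 \<dots> ((- 1) ^ r / (- 1) ^ n)"
    using assms n_less p_gt_0 by (intro cg_divide cg_choose_pred unit_binomial unit_power) auto
  also have "(- 1) ^ r / (- 1) ^ n = ((- 1) ^ r * (- 1) ^ n :: rat)" by (cases "even n") auto
  finally show ?thesis .
qed

lemma sum_range_K: "(\<Sum>q<n. f q) = (\<Sum>q\<le>n - 1. f q)" for f :: "nat \<Rightarrow> rat"
  using n_pos by (intro sum.cong) auto

lemma n_choose_pred: "of_nat n * of_nat ((n - 1) choose M) = (of_nat n - of_nat M) * (of_nat (n choose M) :: rat)"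
  if "M \<le> n"
proof -
  have "(n - M) * (n choose M) = n * ((n - 1) choose M)" by (rule binomial_absorb_comp)
  hence "of_nat ((n - M) * (n choose M)) = (of_nat (n * ((n - 1) choose M)) :: rat)" by (simp only:)
  thus ?thesis using that by (simp add: of_nat_diff)
qed

lemma n_choose_pred': "0 < M \<Longrightarrow> of_nat n * of_nat ((n - 1) choose (M - 1)) = (of_nat M * of_nat (n choose M) :: rat)"
  using binomial_absorption[of "M - 1" n] by (simp flip: of_nat_mult)

lemma rharm_mult: "0 < k \<Longrightarrow> of_nat k * rharm (k - 1) = of_nat k * rharm k - 1"
  using rharm_Suc[of "k - 1"] by (simp add: distrib_left del: of_nat_Suc)

lemma dvd_iff_1:
  assumes "p = D + 1" shows "D dvd c + (p * q + r) \<longleftrightarrow> D dvd c + q + r"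
proof -
  have "c + (p * q + r) = D * q + (c + q + r)" using assms by (simp add: algebra_simps)
  thus ?thesis by (simp only: dvd_add_times_triv_left_iff mult.commute[of D])
qed

text \<open>As \<open>p\<close> is 1 modulo \<open>8 * M\<close>, the index
  \<open>l = p * q + r\<close> lies in the class iff \<open>8 * M\<close> divides
  \<open>7 * M + q + r\<close>. So the only multiple of \<open>p\<close> in the class is
  \<open>p * M\<close>, and every \<open>q < n\<close> has exactly one admissible remainder.\<close>

lemma cg_jsum_1:
  assumes p: "p = 8 * M + 1"
  shows "cg 2 (of_int (jsum (- 1) (8 * M) (7 * M)))
     ((- 1) ^ M * of_nat (n choose M) * (1 + of_nat p * (of_nat n * rharm n - (of_nat n - of_nat M) * rharm (n - M)
        - of_nat M * rharm M + 1)))"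
proof -
  have nM: "n = 4 * M" and M: "0 < M" using p p_eq n_pos by auto
  define K where "K = n - 1"
  have K: "n = Suc K" using n_pos by (simp add: K_def)
  define r where "r q = (if q < M then M - q else 9 * M - q)" for q
  define f :: "nat \<Rightarrow> rat" where "f q = (- 1) ^ q * of_nat (K choose q)" for q
  have c1: "8 * M dvd 7 * M + p * q \<longleftrightarrow> q = M" if "q \<le> n" for q
  proof
    assume "8 * M dvd 7 * M + p * q"
    hence "8 * M dvd 7 * M + q + 0" using dvd_iff_1[of "8 * M" "7 * M" q 0] p by simp
    from dvd_between[OF this] show "q = M" using that M nM by auto
  next
    assume "q = M"
    thus "8 * M dvd 7 * M + p * q" using dvd_iff_1[of "8 * M" "7 * M" q 0] p by simp
  qed
  have c2: "8 * M dvd 7 * M + (p * q + s) \<longleftrightarrow> s = r q" if "q < n" "s \<in> {1..p-1}" for q s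
  proof -
    have "8 * M dvd 7 * M + q + s \<longleftrightarrow> s = r q"
    proof
      assume "8 * M dvd 7 * M + q + s"
      from dvd_between[OF this] show "s = r q" using that M nM p by (auto simp: r_def)
    next
      assume "s = r q"
      hence "7 * M + q + s = 8 * M \<or> 7 * M + q + s = 2 * (8 * M)" using that nM by (auto simp: r_def)
      thus "8 * M dvd 7 * M + q + s" by (elim disjE) (simp_all only: dvd_refl dvd_triv_right)
    qed
    thus ?thesis using dvd_iff_1[of "8 * M"] p by simp
  qed
  have rr: "r q \<in> {1..p-1}" if "q < n" for q using that nM p M by (auto simp: r_def)
  have S1: "(\<Sum>q\<le>n. if 8 * M dvd 7 * M + p * q then of_int (- 1) ^ (p * q) * of_nat (n choose q) else 0)
      = ((- 1) ^ M * of_nat (n choose M) :: rat)"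
  proof -
    have "(\<Sum>q\<le>n. if 8 * M dvd 7 * M + p * q then of_int (- 1) ^ (p * q) * of_nat (n choose q) else 0)
        = (\<Sum>q\<le>n. if q = M then ((- 1) ^ p) ^ q * of_nat (n choose q) else 0 :: rat)"
      by (intro sum.cong refl) (simp add: c1 power_mult)
    also have "\<dots> = ((- 1) ^ p) ^ M * of_nat (n choose M)" using nM by simp
    finally show ?thesis using odd_p by simp
  qed
  have "(\<Sum>q<n. \<Sum>s=1..p-1. if 8 * M dvd 7 * M + (p * q + s) then
        of_int (- 1) ^ (p * q + s) * (of_nat n * (1 / of_nat s) * (- 1) ^ (s - 1) * of_nat ((n - 1) choose q)) else 0)
      = (\<Sum>q<n. of_int (- 1) ^ (p * q + r q) * (of_nat n * (1 / of_nat (r q)) * (- 1) ^ (r q - 1) * of_nat ((n - 1) choose q)) :: rat)"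
  proof (intro sum.cong refl)
    fix q assume q: "q \<in> {..<n}"
    have "(\<Sum>s=1..p-1. if 8 * M dvd 7 * M + (p * q + s) then
        of_int (- 1) ^ (p * q + s) * (of_nat n * (1 / of_nat s) * (- 1) ^ (s - 1) * of_nat ((n - 1) choose q)) else 0) =
        (\<Sum>s=1..p-1. if s = r q then
        of_int (- 1) ^ (p * q + s) * (of_nat n * (1 / of_nat s) * (- 1) ^ (s - 1) * of_nat ((n - 1) choose q)) else 0 :: rat)"
      by (intro sum.cong refl) (use c2 q in simp)
    thus "(\<Sum>s=1..p-1. if 8 * M dvd 7 * M + (p * q + s) then
        of_int (- 1) ^ (p * q + s) * (of_nat n * (1 / of_nat s) * (- 1) ^ (s - 1) * of_nat ((n - 1) choose q)) else 0) =
        (of_int (- 1) ^ (p * q + r q) * (of_nat n * (1 / of_nat (r q)) * (- 1) ^ (r q - 1) * of_nat ((n - 1) choose q)) :: rat)"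
      using rr[of q] q by simp
  qed
  also have "\<dots> = - (of_nat n * (\<Sum>q<n. f q / of_nat (r q)))"
    unfolding sum_distrib_left sum_negf[symmetric]
  proof (intro sum.cong refl)
    fix q assume "q \<in> {..<n}"
    hence "0 < r q" using rr[of q] by auto
    from minus_one_power_odd_mult[OF odd_p this, of q "of_nat n * (1 / of_nat (r q))" "of_nat ((n - 1) choose q)"]
    show "of_int (- 1) ^ (p * q + r q) * (of_nat n * (1 / of_nat (r q)) * (- 1) ^ (r q - 1) * of_nat ((n - 1) choose q))
        = - (of_nat n * (f q / of_nat (r q)) :: rat)"
      by (simp add: f_def K_def mult_ac)
  qed
  finally have S2: "(\<Sum>q<n. \<Sum>s=1..p-1. if 8 * M dvd 7 * M + (p * q + s) then
        of_int (- 1) ^ (p * q + s) * (of_nat n * (1 / of_nat s) * (- 1) ^ (s - 1) * of_nat ((n - 1) choose q)) else 0)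
      = - (of_nat n * (\<Sum>q<n. f q / of_nat (r q)) :: rat)" .
  have "(\<Sum>q<n. f q / of_nat (r q)) = (\<Sum>q<M. f q / of_nat (r q)) + (\<Sum>q=M..K. f q / of_nat (r q))"
  proof -
    have "{..<n} = {..<M} \<union> {M..K}" "{..<M} \<inter> {M..K} = {}" using nM K M by auto
    thus ?thesis by (simp only: sum.union_disjoint finite_lessThan finite_atLeastAtMost)
  qed
  also have "(\<Sum>q<M. f q / of_nat (r q)) = logcoeff K M"
    by (simp add: logcoeff_def f_def r_def)
  \<comment> \<open>For \<open>q \<ge> M\<close> the remainder is \<open>p\<close> minus
    \<open>Suc q - M\<close>; after the reflection this part is a reversed \<open>logcoeff\<close>
    sum as well.\<close>
  also have "cg 1 (logcoeff K M + (\<Sum>q=M..K. f q / of_nat (r q))) (logcoeff K M + (\<Sum>q=M..K. f q * - (1 / of_nat (Suc q - M))))"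
  proof (intro cg_add cg_refl cg_sum)
    fix q assume q: "q \<in> {M..K}"
    hence j: "0 < Suc q - M" "Suc q - M < p" using K n_less by auto
    have "r q = p - (Suc q - M)" using q p K nM by (auto simp: r_def)
    hence "cg 1 (f q * (1 / of_nat (r q))) (f q * - (1 / of_nat (Suc q - M)))"
      using cg_inverse_reflect[OF j] by (intro cg_mult_left) (auto simp: f_def)
    thus "cg 1 (f q / of_nat (r q)) (f q * - (1 / of_nat (Suc q - M)))" by simp
  qed
  also have "(\<Sum>q=M..K. f q * - (1 / of_nat (Suc q - M))) = - ((- 1) ^ K * logcoeff K (n - M))"
    using logcoeff_rev[of M K] nM K by (simp add: f_def sum_negf)
  also have "(- 1) ^ K = (- 1 :: rat)"
  proof -
    have "odd K" using nM K by presburger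
    thus ?thesis by simp
  qed
  finally have S3: "cg 1 (\<Sum>q<n. f q / of_nat (r q)) (logcoeff K M + logcoeff K (n - M))" by simp
  have a: "logcoeff K M = - ((- 1) ^ M * of_nat (K choose M) * (rharm K - rharm (n - M - 1)))"
  proof -
    have "K - M = n - M - 1" "M \<le> K" using nM K by auto
    thus ?thesis using logcoeff_eq[of M K] by simp
  qed
  have b: "logcoeff K (n - M) = - ((- 1) ^ M * of_nat (K choose (M - 1)) * (rharm K - rharm (M - 1)))"
  proof -
    have "n - M \<le> K" "K - (n - M) = M - 1" using nM K M by auto
    moreover have "K choose (n - M) = K choose (M - 1)"
      using binomial_symmetric[of "n - M" K] calculation by simp
    moreover have "(- 1) ^ (n - M) = ((- 1) ^ M :: rat)" using nM by (cases "even M") auto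
    ultimately show ?thesis using logcoeff_eq[of "n - M" K] by simp
  qed
  have "cg 2 (of_int (jsum (- 1) (8 * M) (7 * M)))
      ((- 1) ^ M * of_nat (n choose M) + of_nat p * (- (of_nat n * (\<Sum>q<n. f q / of_nat (r q)))))"
    using cg_jsum[of "- 1" "8 * M" "7 * M"] unfolding S1 S2 .
  also have "cg 2 \<dots> ((- 1) ^ M * of_nat (n choose M) + of_nat p * (- (of_nat n * (logcoeff K M + logcoeff K (n - M)))))"
    by (intro cg_add cg_refl cg_lift cg_minus cg_mult_left S3) auto
  also have "- (of_nat n * (logcoeff K M + logcoeff K (n - M))) =
      (- 1) ^ M * ((of_nat n * of_nat ((n - 1) choose M)) * (rharm K - rharm (n - M - 1)) +
      (of_nat n * of_nat ((n - 1) choose (M - 1))) * (rharm K - rharm (M - 1)))"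
    unfolding a b unfolding K_def by (simp add: algebra_simps)
  also have "(of_nat n * of_nat ((n - 1) choose M)) * (rharm K - rharm (n - M - 1)) +
      (of_nat n * of_nat ((n - 1) choose (M - 1))) * (rharm K - rharm (M - 1)) =
      of_nat (n choose M) * (of_nat n * rharm (n - 1) - of_nat (n - M) * rharm (n - M - 1) - of_nat M * rharm (M - 1))"
    using n_choose_pred[of M] n_choose_pred'[of M] M nM by (simp add: K_def of_nat_diff algebra_simps)
  \<comment> \<open>Passing to harmonic numbers with index raised by one contributes
    \<open>- 1\<close>, \<open>+ 1\<close> and \<open>+ 1\<close>: the origin of the constant 1,
    which later cancels against the factor \<open>8 * M = p - 1\<close>.\<close>
  also have "of_nat n * rharm (n - 1) - of_nat (n - M) * rharm (n - M - 1) - of_nat M * rharm (M - 1) =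
      of_nat n * rharm n - (of_nat n - of_nat M) * rharm (n - M) - of_nat M * rharm M + 1"
    using rharm_mult[of n] rharm_mult[of "n - M"] rharm_mult[of M] n_pos M nM by (simp add: of_nat_diff)
  finally show ?thesis by (simp add: algebra_simps)
qed

text \<open>In this class no index is a multiple of \<open>p\<close>. The first-order part is an
  alternating sum over \<open>1 / (7 * M - q)\<close>, which partial fractions evaluate
  exactly.\<close>

lemma cg_jsum_1':
  assumes p: "p = 8 * M + 1"
  shows "cg 2 (of_int (jsum (- 1) (8 * M) M)) (of_nat p * (1 / of_nat ((7 * M) choose n)))"
proof -
  have nM: "n = 4 * M" and M: "0 < M" using p p_eq n_pos by auto
  define r where "r q = 7 * M - q" for q
  have c1: "\<not> 8 * M dvd M + p * q" if "q \<le> n" for q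
  proof
    assume "8 * M dvd M + p * q"
    hence "8 * M dvd M + q + 0" using dvd_iff_1[of "8 * M" M q 0] p by simp
    from dvd_between[OF this] show False using that M nM by auto
  qed
  have c2: "8 * M dvd M + (p * q + s) \<longleftrightarrow> s = r q" if "q < n" "s \<in> {1..p-1}" for q s
  proof -
    have "8 * M dvd M + q + s \<longleftrightarrow> s = r q"
    proof
      assume "8 * M dvd M + q + s"
      from dvd_between[OF this] show "s = r q" using that M nM p by (auto simp: r_def)
    next
      assume "s = r q"
      hence "M + q + s = 8 * M" using that nM by (auto simp: r_def)
      thus "8 * M dvd M + q + s" by (simp only: dvd_refl)
    qed
    thus ?thesis using dvd_iff_1[of "8 * M"] p by simp
  qed
  have rr: "r q \<in> {1..p-1}" if "q < n" for q using that nM p M by (auto simp: r_def)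
  have S1: "(\<Sum>q\<le>n. if 8 * M dvd M + p * q then of_int (- 1) ^ (p * q) * of_nat (n choose q) else 0) = (0 :: rat)"
    by (intro sum.neutral) (use c1 in auto)
  have "(\<Sum>q<n. \<Sum>s=1..p-1. if 8 * M dvd M + (p * q + s) then
        of_int (- 1) ^ (p * q + s) * (of_nat n * (1 / of_nat s) * (- 1) ^ (s - 1) * of_nat ((n - 1) choose q)) else 0)
      = (\<Sum>q<n. of_nat n * ((- 1) ^ q * of_nat ((n - 1) choose q) / (- of_nat (7 * M) + of_nat q)) :: rat)"
  proof (intro sum.cong refl)
    fix q assume q: "q \<in> {..<n}"
    have "(\<Sum>s=1..p-1. if 8 * M dvd M + (p * q + s) then
        of_int (- 1) ^ (p * q + s) * (of_nat n * (1 / of_nat s) * (- 1) ^ (s - 1) * of_nat ((n - 1) choose q)) else 0) =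
        (\<Sum>s=1..p-1. if s = r q then
        of_int (- 1) ^ (p * q + s) * (of_nat n * (1 / of_nat s) * (- 1) ^ (s - 1) * of_nat ((n - 1) choose q)) else 0 :: rat)"
      by (intro sum.cong refl) (use c2 q in simp)
    also have "\<dots> = (- 1) ^ (p * q + r q) * (of_nat n * (1 / of_nat (r q)) * (- 1) ^ (r q - 1) * of_nat ((n - 1) choose q))"
      using rr[of q] q by simp
    also have "\<dots> = - (of_nat n * (1 / of_nat (r q)) * ((- 1) ^ q * of_nat ((n - 1) choose q)))"
      using rr[of q] q by (intro minus_one_power_odd_mult odd_p) auto
    also have "(of_nat (r q) :: rat) = - (- of_nat (7 * M) + of_nat q)"
      using q nM by (simp add: r_def of_nat_diff)
    finally show "(\<Sum>s=1..p-1. if 8 * M dvd M + (p * q + s) then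
        of_int (- 1) ^ (p * q + s) * (of_nat n * (1 / of_nat s) * (- 1) ^ (s - 1) * of_nat ((n - 1) choose q)) else 0) =
        (of_nat n * ((- 1) ^ q * of_nat ((n - 1) choose q) / (- of_nat (7 * M) + of_nat q)) :: rat)"
      by (simp only: divide_minus_right minus_mult_right[symmetric] minus_mult_left[symmetric] minus_minus) simp
  qed
  also have "\<dots> = of_nat n * (\<Sum>q\<le>n-1. (- 1) ^ q * of_nat ((n - 1) choose q) / (- of_nat (7 * M) + of_nat q))"
    by (simp only: sum_range_K sum_distrib_left)
  also have "(\<Sum>q\<le>n-1. (- 1) ^ q * of_nat ((n - 1) choose q) / (- of_nat (7 * M) + of_nat q)) =
      (fact (n - 1) / pochhammer (- of_nat (7 * M)) (Suc (n - 1)) :: rat)"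
  proof (rule alternating_partial_fractions)
    fix j assume "j \<le> n - 1"
    hence "j < 7 * M" using nM M by auto
    hence "(of_nat j :: rat) < of_nat (7 * M)" by (simp only: of_nat_less_iff)
    thus "- of_nat (7 * M) + of_nat j \<noteq> (0 :: rat)" by linarith
  qed
  also have "of_nat n * (fact (n - 1) / pochhammer (- of_nat (7 * M)) (Suc (n - 1))) = (1 / of_nat ((7 * M) choose n) :: rat)"
  proof -
    have "pochhammer (- of_nat (7 * M)) n = (fact n * rising (- of_nat (7 * M)) n :: rat)" by (simp add: rising_def)
    also have "rising (- of_nat (7 * M)) n = of_nat ((7 * M) choose n)"
      unfolding rising_minus_of_nat using nM by simp
    finally have "pochhammer (- of_nat (7 * M)) (Suc (n - 1)) = (fact n * of_nat ((7 * M) choose n) :: rat)"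
      using n_pos by simp
    moreover have "(fact n :: rat) = of_nat n * fact (n - 1)" using n_pos by (simp add: fact_reduce)
    ultimately show ?thesis using n_pos by simp
  qed
  finally have S2: "(\<Sum>q<n. \<Sum>s=1..p-1. if 8 * M dvd M + (p * q + s) then
        of_int (- 1) ^ (p * q + s) * (of_nat n * (1 / of_nat s) * (- 1) ^ (s - 1) * of_nat ((n - 1) choose q)) else 0)
      = (1 / of_nat ((7 * M) choose n) :: rat)" .
  show ?thesis using cg_jsum[of "- 1" "8 * M" M] unfolding S1 S2 by simp
qed

text \<open>Here \<open>p\<close> is \<open>- 1\<close> modulo \<open>D\<close>; the natural number
  \<open>D - q\<close> stands for \<open>- q\<close>.\<close>

lemma dvd_iff_3:
  assumes "p + 1 = D" "q \<le> D" shows "D dvd c + (p * q + r) \<longleftrightarrow> D dvd c + r + (D - q)"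
proof -
  have "c + (p * q + r) + D = D * q + (c + r + (D - q))"
    using assms(2) unfolding assms(1)[symmetric] by (simp add: algebra_simps)
  hence "D dvd c + (p * q + r) + D \<longleftrightarrow> D dvd c + r + (D - q)"
    by (simp only: dvd_add_times_triv_left_iff mult.commute[of D])
  thus ?thesis by simp
qed

text \<open>As \<open>p\<close> is \<open>- 1\<close> modulo \<open>D\<close>, the remainder
  belonging to \<open>q\<close> is \<open>q - M\<close> modulo \<open>D\<close>, and again
  \<open>p * M\<close> is the only multiple of \<open>p\<close> in the class.\<close>

lemma cg_jsum_3:
  assumes p: "p = 8 * M + 3"
  shows "cg 2 (of_int (jsum 1 (8 * M + 4) M))
     (of_nat (n choose M) * (1 + of_nat p * (of_nat n * rharm n - (of_nat n - of_nat M) * rharm M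
        - of_nat M * rharm (n - M) - 1)))"
proof -
  define D where "D = 8 * M + 4"
  have nM: "n = 4 * M + 1" and pD: "p + 1 = D" using p p_eq by (auto simp: D_def)
  define K where "K = n - 1"
  have K: "n = Suc K" "K = 4 * M" using nM by (simp_all add: K_def)
  define r where "r q = (if M < q then q - M else D + q - M)" for q
  \<comment> \<open>Now \<open>D = p + 1\<close> exceeds the number of remainders:
    \<open>q = M\<close> would need remainder 0 and \<open>q = M - 1\<close> the remainder
    \<open>p\<close>, so these two blocks contain no index of the class that is prime to
    \<open>p\<close>.\<close>
  define ok where "ok q \<longleftrightarrow> M < q \<or> q + 2 \<le> M" for q
  define f :: "nat \<Rightarrow> rat" where "f q = (- 1) ^ q * of_nat (K choose q)" for q
  have c1: "D dvd M + p * q \<longleftrightarrow> q = M" if "q \<le> n" for q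
  proof -
    have "q \<le> D" using that nM by (simp add: D_def)
    hence "D dvd M + p * q \<longleftrightarrow> D dvd M + (D - q)" using dvd_iff_3[OF pD, of q M 0] by simp
    also have "\<dots> \<longleftrightarrow> q = M"
    proof
      assume d: "D dvd M + (D - q)"
      obtain e where e: "D = q + e" using le_Suc_ex[OF \<open>q \<le> D\<close>] by blast
      hence De: "D - q = e" by simp
      have "M + e = D \<or> M + e = 2 * D"
        using dvd_between[OF d[unfolded De]] e nM D_def that by linarith
      thus "q = M" using e nM D_def that by linarith
    qed (simp add: D_def)
    finally show ?thesis .
  qed
  have c2: "D dvd M + (p * q + s) \<longleftrightarrow> ok q \<and> s = r q" if "q < n" "s \<in> {1..p-1}" for q s
  proof -
    have "q \<le> D" using that nM by (simp add: D_def)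
    hence "D dvd M + (p * q + s) \<longleftrightarrow> D dvd M + s + (D - q)" using dvd_iff_3[OF pD, of q M s] by simp
    also have "\<dots> \<longleftrightarrow> ok q \<and> s = r q"
    proof
      assume d: "D dvd M + s + (D - q)"
      obtain e where e: "D = q + e" using le_Suc_ex[OF \<open>q \<le> D\<close>] by blast
      hence De: "D - q = e" by simp
      have s: "1 \<le> s" "s + 2 \<le> D" using that p by (auto simp: D_def)
      have "M + s + e = D \<or> M + s + e = 2 * D"
        using dvd_between[OF d[unfolded De]] e s nM D_def that(1) by linarith
      thus "ok q \<and> s = r q"
      proof
        assume "M + s + e = D"
        hence "q = M + s" using e by linarith
        thus ?thesis using s by (simp add: ok_def r_def)
      next
        assume "M + s + e = 2 * D"
        hence 1: "s + M = D + q" using e by linarith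
        hence 2: "q + 2 \<le> M" using s by linarith
        hence "s = D + q - M" using 1 by linarith
        thus ?thesis using 2 by (simp add: ok_def r_def)
      qed
    next
      assume "ok q \<and> s = r q"
      hence "M + s + (D - q) = D \<or> M + s + (D - q) = 2 * D" using that nM by (auto simp: D_def ok_def r_def)
      thus "D dvd M + s + (D - q)" by auto
    qed
    finally show ?thesis .
  qed
  have rr: "r q \<in> {1..p-1}" if "q < n" "ok q" for q using that nM p by (auto simp: r_def ok_def D_def)
  have S1: "(\<Sum>q\<le>n. if D dvd M + p * q then of_int 1 ^ (p * q) * of_nat (n choose q) else 0) = (of_nat (n choose M) :: rat)"
  proof -
    have "(\<Sum>q\<le>n. if D dvd M + p * q then of_int 1 ^ (p * q) * of_nat (n choose q) else 0) =
        (\<Sum>q\<le>n. if q = M then of_nat (n choose q) else 0 :: rat)"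
      by (intro sum.cong refl) (simp add: c1)
    thus ?thesis using nM by simp
  qed
  have "(\<Sum>q<n. \<Sum>s=1..p-1. if D dvd M + (p * q + s) then
        of_int 1 ^ (p * q + s) * (of_nat n * (1 / of_nat s) * (- 1) ^ (s - 1) * of_nat ((n - 1) choose q)) else 0)
      = (\<Sum>q<n. - ((- 1) ^ M * of_nat n * (if ok q then f q / of_nat (r q) else 0)) :: rat)"
  proof (intro sum.cong refl)
    fix q assume q: "q \<in> {..<n}"
    have "(\<Sum>s=1..p-1. if D dvd M + (p * q + s) then
        of_int 1 ^ (p * q + s) * (of_nat n * (1 / of_nat s) * (- 1) ^ (s - 1) * of_nat ((n - 1) choose q)) else 0) =
        (\<Sum>s=1..p-1. if s = r q then (if ok q then
        of_nat n * (1 / of_nat s) * (- 1) ^ (s - 1) * of_nat ((n - 1) choose q) else 0) else 0 :: rat)"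
      by (intro sum.cong refl) (use c2 q in simp)
    also have "\<dots> = (if ok q then of_nat n * (1 / of_nat (r q)) * (- 1) ^ (r q - 1) * of_nat ((n - 1) choose q) else 0)"
      using rr[of q] q by auto
    also have "\<dots> = - ((- 1) ^ M * of_nat n * (if ok q then f q / of_nat (r q) else 0))"
    proof (cases "ok q")
      case True
      have "(- 1) ^ (r q - 1) = (- ((- 1) ^ M * (- 1) ^ q) :: rat)"
      proof -
        have "even (r q - 1) \<longleftrightarrow> odd (M + q)"
        proof (cases "M < q")
          case True
          then obtain k where "q = Suc (M + k)" using less_imp_Suc_add by blast
          thus ?thesis by (cases "even M"; cases "even k") (simp_all add: r_def)
        next
          case False
          then obtain k where "M = Suc (q + k)" using True less_imp_Suc_add[of q M] by (auto simp: ok_def)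
          hence "r q - 1 = 8 * q + 7 * k + 10" by (simp add: r_def D_def)
          thus ?thesis using \<open>M = Suc (q + k)\<close> by (cases "even q"; cases "even k") simp_all
        qed
        thus ?thesis by (cases "even M"; cases "even q") (auto simp: minus_one_power_iff)
      qed
      thus ?thesis using True by (simp add: f_def K_def)
    qed simp
    finally show "(\<Sum>s=1..p-1. if D dvd M + (p * q + s) then
        of_int 1 ^ (p * q + s) * (of_nat n * (1 / of_nat s) * (- 1) ^ (s - 1) * of_nat ((n - 1) choose q)) else 0) =
        - ((- 1) ^ M * of_nat n * (if ok q then f q / of_nat (r q) else 0) :: rat)" .
  qed
  also have "\<dots> = - ((- 1) ^ M * of_nat n * (\<Sum>q<n. if ok q then f q / of_nat (r q) else 0))"
    by (simp only: sum_distrib_left sum_negf)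
  finally have S2: "(\<Sum>q<n. \<Sum>s=1..p-1. if D dvd M + (p * q + s) then
        of_int 1 ^ (p * q + s) * (of_nat n * (1 / of_nat s) * (- 1) ^ (s - 1) * of_nat ((n - 1) choose q)) else 0)
      = - ((- 1) ^ M * of_nat n * (\<Sum>q<n. if ok q then f q / of_nat (r q) else 0) :: rat)" .
  have "(\<Sum>q<n. if ok q then f q / of_nat (r q) else 0) =
      (\<Sum>q\<in>{..<M-1} \<union> {Suc M..K}. f q / of_nat (r q))"
    by (rule sum.mono_neutral_cong_right) (auto simp: ok_def K)
  also have "\<dots> = (\<Sum>q<M-1. f q / of_nat (r q)) + (\<Sum>q=Suc M..K. f q / of_nat (r q))"
    by (rule sum.union_disjoint) auto
  also have "(\<Sum>q=Suc M..K. f q / of_nat (r q)) = (\<Sum>q=Suc M..K. f q / of_nat (Suc q - Suc M))"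
    by (intro sum.cong refl) (simp add: r_def)
  also have "\<dots> = logcoeff K (n - 1 - M)"
    using logcoeff_rev[of "Suc M" K] K by (simp add: f_def)
  also have "cg 1 ((\<Sum>q<M-1. f q / of_nat (r q)) + logcoeff K (n - 1 - M)) ((\<Sum>q<M-1. f q * - (1 / of_nat (M - 1 - q))) + logcoeff K (n - 1 - M))"
  proof (intro cg_add cg_refl cg_sum)
    fix q assume q: "q \<in> {..<M-1}"
    hence j: "0 < M - 1 - q" "M - 1 - q < p" using p by auto
    have "r q = p - (M - 1 - q)" using q p by (auto simp: r_def D_def)
    hence "cg 1 (f q * (1 / of_nat (r q))) (f q * - (1 / of_nat (M - 1 - q)))"
      using cg_inverse_reflect[OF j] by (intro cg_mult_left) (auto simp: f_def)
    thus "cg 1 (f q / of_nat (r q)) (f q * - (1 / of_nat (M - 1 - q)))" by simp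
  qed
  also have "(\<Sum>q<M-1. f q * - (1 / of_nat (M - 1 - q))) = - logcoeff K (M - 1)"
    by (simp add: f_def logcoeff_def sum_negf)
  finally have S3: "cg 1 (\<Sum>q<n. if ok q then f q / of_nat (r q) else 0) (- logcoeff K (M - 1) + logcoeff K (n - 1 - M))" .
  have a: "logcoeff K (n - 1 - M) = - ((- 1) ^ M * of_nat (K choose M) * (rharm K - rharm M))"
  proof -
    have "n - 1 - M \<le> K" "K - (n - 1 - M) = M" using K by auto
    moreover have "K choose (n - 1 - M) = K choose M"
      using binomial_symmetric[of M K] K by simp
    moreover have "(- 1) ^ Suc (n - 1 - M) = (- ((- 1) ^ M) :: rat)" using K by (cases "even M") auto
    ultimately show ?thesis using logcoeff_eq[of "n - 1 - M" K] by simp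
  qed
  \<comment> \<open>For \<open>M = 0\<close> the truncated difference \<open>M - 1\<close> is 0, and
    both sides vanish.\<close>
  have b: "of_nat n * logcoeff K (M - 1) = (- 1) ^ M * (of_nat M * of_nat (n choose M) * (rharm K - rharm (n - M)))"
  proof (cases "M = 0")
    case False
    have "M - 1 \<le> K" "K - (M - 1) = n - M" "Suc (M - 1) = M" using K False by auto
    hence "logcoeff K (M - 1) = (- 1) ^ M * of_nat (K choose (M - 1)) * (rharm K - rharm (n - M))"
      using logcoeff_eq[of "M - 1" K] by simp
    thus ?thesis using n_choose_pred'[of M] False by (simp add: K_def mult_ac)
  qed simp
  have "cg 2 (of_int (jsum 1 D M))
      (of_nat (n choose M) + of_nat p * (- ((- 1) ^ M * of_nat n * (\<Sum>q<n. if ok q then f q / of_nat (r q) else 0))))"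
    using cg_jsum[of 1 D M] unfolding S1 S2 .
  also have "cg 2 \<dots> (of_nat (n choose M) + of_nat p * (- ((- 1) ^ M * of_nat n * (- logcoeff K (M - 1) + logcoeff K (n - 1 - M)))))"
    by (intro cg_add cg_refl cg_lift cg_minus cg_mult_left S3) auto
  also have "- ((- 1) ^ M * of_nat n * (- logcoeff K (M - 1) + logcoeff K (n - 1 - M))) =
      (- 1) ^ M * (of_nat n * logcoeff K (M - 1)) - (- 1) ^ M * of_nat n * logcoeff K (n - 1 - M)"
    by (simp add: algebra_simps)
  also have "\<dots> = ((- 1) ^ M * (- 1) ^ M) * (of_nat M * of_nat (n choose M) * (rharm K - rharm (n - M)) +
       of_nat n * of_nat ((n - 1) choose M) * (rharm K - rharm M))"
    unfolding b a unfolding K_def by (simp add: algebra_simps)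
  also have "(- 1) ^ M * (- 1) ^ M = (1 :: rat)" by (simp flip: power_mult_distrib)
  also have "1 * (of_nat M * of_nat (n choose M) * (rharm K - rharm (n - M)) +
       of_nat n * of_nat ((n - 1) choose M) * (rharm K - rharm M)) =
      of_nat (n choose M) * (of_nat n * rharm (n - 1) - (of_nat n - of_nat M) * rharm M - of_nat M * rharm (n - M))"
    using n_choose_pred[of M] nM by (simp add: K_def algebra_simps)
  also have "of_nat n * rharm (n - 1) = of_nat n * rharm n - 1" by (rule rharm_mult[OF n_pos])
  finally show ?thesis by (simp add: D_def algebra_simps)
qed

text \<open>Modulo \<open>D\<close> the class is that of \<open>- (M + 1)\<close>, so the remainder
  for \<open>q\<close> is \<open>q + M + 1\<close> and no index is a multiple of \<open>p\<close>.
  Partial fractions evaluate the first-order part exactly.\<close>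

lemma cg_jsum_3':
  assumes p: "p = 8 * M + 3"
  shows "cg 2 (of_int (jsum 1 (8 * M + 4) (7 * M + 3))) (of_nat p * ((- 1) ^ M / of_nat ((M + n) choose M)))"
proof -
  define D where "D = 8 * M + 4"
  have nM: "n = 4 * M + 1" and pD: "p + 1 = D" using p p_eq by (auto simp: D_def)
  define r where "r q = q + M + 1" for q
  have c1: "\<not> D dvd 7 * M + 3 + p * q" if "q \<le> n" for q
  proof -
    have "q \<le> D" using that nM by (simp add: D_def)
    hence e: "D dvd 7 * M + 3 + p * q \<longleftrightarrow> D dvd 7 * M + 3 + (D - q)" using dvd_iff_3[OF pD, of q "7 * M + 3" 0] by simp
    show ?thesis
    proof
      assume "D dvd 7 * M + 3 + p * q"
      hence d: "D dvd 7 * M + 3 + (D - q)" using e by simp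
      obtain e' where e': "D = q + e'" using le_Suc_ex[OF \<open>q \<le> D\<close>] by blast
      hence De: "D - q = e'" by simp
      have "7 * M + 3 + e' = D \<or> 7 * M + 3 + e' = 2 * D"
        using dvd_between[OF d[unfolded De]] e' nM D_def that by linarith
      thus False using e' nM D_def that by linarith
    qed
  qed
  have c2: "D dvd 7 * M + 3 + (p * q + s) \<longleftrightarrow> s = r q" if "q < n" "s \<in> {1..p-1}" for q s
  proof -
    have "q \<le> D" using that nM by (simp add: D_def)
    hence "D dvd 7 * M + 3 + (p * q + s) \<longleftrightarrow> D dvd 7 * M + 3 + s + (D - q)" by (rule dvd_iff_3[OF pD])
    also have "\<dots> \<longleftrightarrow> s = r q"
    proof
      assume d: "D dvd 7 * M + 3 + s + (D - q)"
      obtain e where e: "D = q + e" using le_Suc_ex[OF \<open>q \<le> D\<close>] by blast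
      hence De: "D - q = e" by simp
      have s: "1 \<le> s" "s + 2 \<le> D" using that p by (auto simp: D_def)
      have "7 * M + 3 + s + e = D \<or> 7 * M + 3 + s + e = 2 * D"
        using dvd_between[OF d[unfolded De]] e s nM D_def that(1) by linarith
      hence "s = q + M + 1" using e s nM D_def that(1) by linarith
      thus "s = r q" by (simp add: r_def)
    next
      assume "s = r q"
      hence "7 * M + 3 + s + (D - q) = 2 * D" using that nM by (auto simp: D_def r_def)
      thus "D dvd 7 * M + 3 + s + (D - q)" by simp
    qed
    finally show ?thesis .
  qed
  have rr: "r q \<in> {1..p-1}" if "q < n" for q using that nM p by (auto simp: r_def)
  have S1: "(\<Sum>q\<le>n. if D dvd 7 * M + 3 + p * q then of_int 1 ^ (p * q) * of_nat (n choose q) else 0) = (0 :: rat)"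
    by (intro sum.neutral) (use c1 in auto)
  have "(\<Sum>q<n. \<Sum>s=1..p-1. if D dvd 7 * M + 3 + (p * q + s) then
        of_int 1 ^ (p * q + s) * (of_nat n * (1 / of_nat s) * (- 1) ^ (s - 1) * of_nat ((n - 1) choose q)) else 0)
      = (\<Sum>q<n. (- 1) ^ M * of_nat n * ((- 1) ^ q * of_nat ((n - 1) choose q) / (of_nat M + 1 + of_nat q)) :: rat)"
  proof (intro sum.cong refl)
    fix q assume q: "q \<in> {..<n}"
    have "(\<Sum>s=1..p-1. if D dvd 7 * M + 3 + (p * q + s) then
        of_int 1 ^ (p * q + s) * (of_nat n * (1 / of_nat s) * (- 1) ^ (s - 1) * of_nat ((n - 1) choose q)) else 0) =
        (\<Sum>s=1..p-1. if s = r q then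
        of_nat n * (1 / of_nat s) * (- 1) ^ (s - 1) * of_nat ((n - 1) choose q) else 0 :: rat)"
      by (intro sum.cong refl) (use c2 q in simp)
    also have "\<dots> = of_nat n * (1 / of_nat (r q)) * (- 1) ^ (r q - 1) * of_nat ((n - 1) choose q)"
      using rr[of q] q by simp
    also have "\<dots> = (- 1) ^ M * of_nat n * ((- 1) ^ q * of_nat ((n - 1) choose q) / (of_nat M + 1 + of_nat q))"
      by (simp add: r_def power_add add_ac)
    finally show "(\<Sum>s=1..p-1. if D dvd 7 * M + 3 + (p * q + s) then
        of_int 1 ^ (p * q + s) * (of_nat n * (1 / of_nat s) * (- 1) ^ (s - 1) * of_nat ((n - 1) choose q)) else 0) =
        ((- 1) ^ M * of_nat n * ((- 1) ^ q * of_nat ((n - 1) choose q) / (of_nat M + 1 + of_nat q)) :: rat)" .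
  qed
  also have "\<dots> = (- 1) ^ M * of_nat n * (\<Sum>q\<le>n-1. (- 1) ^ q * of_nat ((n - 1) choose q) / (of_nat M + 1 + of_nat q))"
    by (simp only: sum_range_K sum_distrib_left)
  also have "(\<Sum>q\<le>n-1. (- 1) ^ q * of_nat ((n - 1) choose q) / (of_nat M + 1 + of_nat q)) =
      (fact (n - 1) / pochhammer (of_nat M + 1) (Suc (n - 1)) :: rat)"
    by (rule alternating_partial_fractions) (simp add: add_nonneg_eq_0_iff)
  also have "(- 1) ^ M * of_nat n * (fact (n - 1) / pochhammer (of_nat M + 1) (Suc (n - 1))) =
      ((- 1) ^ M / of_nat ((M + n) choose M) :: rat)"
  proof -
    have "pochhammer (of_nat M + 1) n = (fact n * rising (of_nat M + 1) n :: rat)" by (simp add: rising_def)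
    hence "pochhammer (of_nat M + 1) (Suc (n - 1)) = (fact n * of_nat ((M + n) choose M) :: rat)"
      unfolding rising_of_nat_Suc using n_pos by simp
    moreover have "(fact n :: rat) = of_nat n * fact (n - 1)" using n_pos by (simp add: fact_reduce)
    ultimately show ?thesis using n_pos by simp
  qed
  finally have S2: "(\<Sum>q<n. \<Sum>s=1..p-1. if D dvd 7 * M + 3 + (p * q + s) then
        of_int 1 ^ (p * q + s) * (of_nat n * (1 / of_nat s) * (- 1) ^ (s - 1) * of_nat ((n - 1) choose q)) else 0)
      = ((- 1) ^ M / of_nat ((M + n) choose M) :: rat)" .
  show ?thesis using cg_jsum[of 1 D "7 * M + 3"] unfolding S1 S2 by (simp add: D_def)
qed

end

subsection \<open>Sums over roots of unity modulo \<open>p ^ 2\<close>\<close>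

definition mcong :: "'a::comm_ring_1 \<Rightarrow> 'a \<Rightarrow> 'a \<Rightarrow> bool" where
  "mcong m x y \<longleftrightarrow> m dvd x - y"

lemma mcong_refl [simp]: "mcong m x x"
  by (simp add: mcong_def)

lemma mcong_sym: "mcong m x y \<Longrightarrow> mcong m y x"
  unfolding mcong_def by (metis dvd_minus_iff minus_diff_eq)

lemma mcong_trans [trans]: "mcong m x y \<Longrightarrow> mcong m y z \<Longrightarrow> mcong m x z"
  unfolding mcong_def using dvd_add[of m "x - y" "y - z"] by simp

lemma mcong_add: "mcong m x y \<Longrightarrow> mcong m u v \<Longrightarrow> mcong m (x + u) (y + v)"
  unfolding mcong_def using dvd_add[of m "x - y" "u - v"] by (simp add: algebra_simps)

lemma mcong_diff: "mcong m x y \<Longrightarrow> mcong m u v \<Longrightarrow> mcong m (x - u) (y - v)"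
  unfolding mcong_def using dvd_diff[of m "x - y" "u - v"] by (simp add: algebra_simps)

lemma mcong_mult: "mcong m x y \<Longrightarrow> mcong m u v \<Longrightarrow> mcong m (x * u) (y * v)"
proof -
  assume "mcong m x y" "mcong m u v"
  moreover have "x * u - y * v = (x - y) * u + y * (u - v)" by (simp add: algebra_simps)
  ultimately show ?thesis unfolding mcong_def by (simp only: dvd_add dvd_mult dvd_mult2)
qed

lemma mcong_power: "mcong m x y \<Longrightarrow> mcong m (x ^ k) (y ^ k)"
  by (induction k) (auto intro: mcong_mult)

lemma mcong_sum: "(\<And>i. i \<in> A \<Longrightarrow> mcong m (f i) (g i)) \<Longrightarrow> mcong m (sum f A) (sum g A)"
  by (induction A rule: infinite_finite_induct) (auto intro: mcong_add)

lemma mcong_dvd: "mcong m x y \<Longrightarrow> k dvd m \<Longrightarrow> mcong k x y"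
  unfolding mcong_def by (rule dvd_trans)

lemma prime_elem_square_dvd:
  fixes P :: "'a::idom"
  assumes "prime_elem P" "P ^ 2 dvd x * y" "\<not> P dvd x"
  shows "P ^ 2 dvd y"
proof -
  have nz: "P \<noteq> 0" using assms(1) by auto
  have "P dvd x * y" using assms(2) by (metis dvd_mult_left power2_eq_square)
  hence "P dvd y" using assms prime_elem_dvd_mult_iff by blast
  then obtain z where z: "y = P * z" by blast
  have "P * P dvd P * (x * z)" using assms(2) by (simp add: z power2_eq_square mult_ac)
  hence "P dvd x * z" using nz by simp
  hence "P dvd z" using assms prime_elem_dvd_mult_iff by blast
  thus ?thesis by (simp add: z power2_eq_square mult_dvd_mono)
qed

text \<open>Lagrange's bound on the number of roots, phrased without a quotient field: a root is
  split off by synthetic division, and primality of \<open>P\<close> passes divisibility on to the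
  quotient at the other roots.\<close>

lemma prime_elem_root_bound:
  fixes P :: "'a::idom"
  assumes "prime_elem P" "finite R" "degree f < card R"
    and "\<And>r. r \<in> R \<Longrightarrow> P dvd poly f r"
    and "\<And>r s. r \<in> R \<Longrightarrow> s \<in> R \<Longrightarrow> P dvd r - s \<Longrightarrow> r = s"
  shows "P dvd lead_coeff f"
  using assms(2-)
proof (induction "degree f" arbitrary: f R)
  case 0
  then obtain r where "r \<in> R" by fastforce
  moreover obtain a where "f = [:a:]" using 0 degree_eq_zeroE by metis
  ultimately show ?case using "0.prems"(3)[of r] by simp
next
  case (Suc d)
  then obtain r where r: "r \<in> R" by fastforce
  define q where "q = synthetic_div f r"
  have f: "f = [:- r, 1:] * q + [:poly f r:]"
    unfolding q_def by (rule synthetic_div_correct'[symmetric])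
  have dq: "degree q = d" using Suc.hyps(2) by (simp add: q_def degree_synthetic_div)
  have "P dvd lead_coeff q"
  proof (rule Suc.hyps(1)[of q "R - {r}"])
    show "degree q < card (R - {r})" using Suc.prems(1,2) Suc.hyps(2) r dq by simp
    fix s assume s: "s \<in> R - {r}"
    have "poly f s = (s - r) * poly q s + poly f r" by (subst f) (simp add: algebra_simps)
    hence "P dvd (s - r) * poly q s"
      using Suc.prems(3)[of s] Suc.prems(3)[of r] s r by (metis DiffD1 dvd_add_left_iff)
    moreover have "\<not> P dvd s - r" using Suc.prems(4)[of s r] s r by auto
    ultimately show "P dvd poly q s" using assms(1) prime_elem_dvd_mult_iff by blast
  next
    fix s t assume "s \<in> R - {r}" "t \<in> R - {r}" "P dvd s - t"
    thus "s = t" using Suc.prems(4)[of s t] by simp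
  qed (use Suc.prems dq in auto)
  moreover have "lead_coeff f = lead_coeff q"
  proof -
    have "coeff f (Suc d) = coeff ([:- r, 1:] * q + [:poly f r:]) (Suc d)" by (subst f) (rule refl)
    also have "\<dots> = coeff q d" using dq by (simp add: coeff_eq_0)
    finally show ?thesis using Suc.hyps(2) dq by simp
  qed
  ultimately show ?case by simp
qed

text \<open>In \<open>x ^ p - 1 = (x - 1) * (\<Sum>i<p. x ^ i)\<close> both factors are divisible by
  \<open>p\<close>. This is the lift from \<open>p\<close> to \<open>p ^ 2\<close> used
  throughout.\<close>

lemma mcong_one_power_p:
  fixes x :: "'a::comm_ring_1"
  assumes "mcong (of_nat p) x 1" shows "mcong (of_nat p ^ 2) (x ^ p) 1"
proof -
  have "mcong (of_nat p) (\<Sum>i<p. x ^ i) (\<Sum>i<p. 1 ^ i)"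
    by (intro mcong_sum mcong_power assms)
  hence "of_nat p dvd (\<Sum>i<p. x ^ i) - of_nat p" by (simp add: mcong_def)
  hence "of_nat p dvd (\<Sum>i<p. x ^ i)" using dvd_add[of "of_nat p" "(\<Sum>i<p. x ^ i) - of_nat p" "of_nat p"] by simp
  thus ?thesis using assms
    by (simp add: mcong_def power_diff_1_eq power2_eq_square mult_dvd_mono)
qed

text \<open>\<open>Z\<close> represents the \<open>N\<close>-th roots of unity modulo \<open>p ^ 2\<close>.\<close>

locale root_system =
  fixes p N :: nat and Z :: "'a::idom set"
  assumes prime_elem_p: "prime_elem (of_nat p :: 'a)"
    and finite_Z: "finite Z" and card_Z: "card Z = N" and N_pos: "N > 0"
    and incongruent: "\<And>x y. x \<in> Z \<Longrightarrow> y \<in> Z \<Longrightarrow> mcong (of_nat p) x y \<Longrightarrow> x = y"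
    and root: "\<And>z. z \<in> Z \<Longrightarrow> mcong (of_nat p ^ 2) (z ^ N) 1"
    and N_nondvd: "\<not> of_nat p dvd (of_nat N :: 'a)"
begin

abbreviation P :: 'a where "P \<equiv> of_nat p"

lemma P_dvd_sq: "P dvd P ^ 2"
  by (simp add: power2_eq_square)

lemma not_P_dvd_1: "\<not> P dvd 1"
  using prime_elem_p by (simp add: prime_elem_def)

lemma root_mod_p: "z \<in> Z \<Longrightarrow> mcong P (z ^ N) 1"
  using root mcong_dvd P_dvd_sq by blast

lemma roots_bound:
  assumes "0 < l" "finite R" "l < card R" "\<And>r. r \<in> R \<Longrightarrow> mcong P (r ^ l) 1"
    and "\<And>r s. r \<in> R \<Longrightarrow> s \<in> R \<Longrightarrow> mcong P r s \<Longrightarrow> r = s"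
  shows False
proof -
  define f :: "'a poly" where "f = monom 1 l + [:- 1:]"
  have "degree f = l" unfolding f_def using assms(1)
    by (subst degree_add_eq_left) (simp_all add: degree_monom_eq)
  moreover have "lead_coeff f = 1"
    using assms(1) \<open>degree f = l\<close> by (cases l) (simp_all add: f_def)
  moreover have "P dvd lead_coeff f"
  proof (rule prime_elem_root_bound[OF prime_elem_p assms(2)])
    show "degree f < card R" using \<open>degree f = l\<close> assms(3) by simp
    show "P dvd poly f r" if "r \<in> R" for r
      using assms(4)[OF that] by (simp add: f_def poly_monom mcong_def)
    show "r = s" if "r \<in> R" "s \<in> R" "P dvd r - s" for r s
      using assms(5)[OF that(1,2)] that(3) by (simp add: mcong_def)
  qed
  ultimately show False using not_P_dvd_1 by simp
qed

text \<open>Uniqueness in Hensel's lemma: the cofactor \<open>S\<close> of \<open>x - y\<close> in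
  \<open>x ^ N - y ^ N\<close> is modulo \<open>p\<close> the derivative of \<open>x ^ N\<close>,
  which is prime to \<open>p\<close> because \<open>N\<close> is.\<close>

lemma lift_root:
  assumes "mcong P x y" "mcong (P ^ 2) (x ^ N) 1" "mcong (P ^ 2) (y ^ N) 1"
  shows "mcong (P ^ 2) x y"
proof -
  define S where "S = (\<Sum>i<N. y ^ (N - Suc i) * x ^ i)"
  have "P ^ 2 dvd x ^ N - y ^ N"
    using mcong_trans[OF assms(2) mcong_sym[OF assms(3)]] by (simp add: mcong_def)
  hence "P ^ 2 dvd S * (x - y)" by (simp add: S_def power_diff_sumr2 mult.commute)
  moreover have "\<not> P dvd S"
  proof
    assume "P dvd S"
    have "mcong P (y * S) (\<Sum>i<N. 1)"
      unfolding S_def sum_distrib_left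
    proof (intro mcong_sum)
      fix i assume "i \<in> {..<N}"
      hence e: "Suc (N - Suc i) + i = N" by simp
      have "mcong P (y ^ Suc (N - Suc i) * x ^ i) (y ^ Suc (N - Suc i) * y ^ i)"
        by (intro mcong_mult mcong_refl mcong_power assms(1))
      also have "y ^ Suc (N - Suc i) * y ^ i = y ^ N" by (simp only: power_add[symmetric] e)
      also have "mcong P (y ^ N) 1" using mcong_dvd[OF assms(3) P_dvd_sq] .
      finally show "mcong P (y * (y ^ (N - Suc i) * x ^ i)) 1" by (simp add: mult.assoc)
    qed
    hence "P dvd y * S - of_nat N" by (simp add: mcong_def)
    moreover have "P dvd y * S" using \<open>P dvd S\<close> by simp
    ultimately have "P dvd of_nat N" using dvd_diff[of P "y * S" "y * S - of_nat N"] by simp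
    thus False using N_nondvd by simp
  qed
  ultimately have "P ^ 2 dvd x - y" by (rule prime_elem_square_dvd[OF prime_elem_p])
  thus ?thesis by (simp only: mcong_def)
qed

text \<open>Orthogonality. If \<open>N\<close> does not divide \<open>l\<close>, the root bound
  yields \<open>z0\<close> with \<open>z0 ^ l\<close> not 1 modulo \<open>p\<close>. Multiplication
  by \<open>z0\<close> permutes \<open>Z\<close> modulo \<open>p ^ 2\<close>, so the sum is
  annihilated by \<open>z0 ^ l - 1\<close>, which is prime to \<open>p\<close>.\<close>

lemma power_sum: "mcong (P ^ 2) (\<Sum>z\<in>Z. z ^ l) (if N dvd l then of_nat N else 0)"
proof (cases "N dvd l")
  case True
  then obtain k where k: "l = N * k" by blast
  have "mcong (P ^ 2) (\<Sum>z\<in>Z. (z ^ N) ^ k) (\<Sum>z\<in>Z. 1 ^ k)"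
    by (intro mcong_sum mcong_power root)
  thus ?thesis using True by (simp add: k power_mult card_Z)
next
  case False
  define l' where "l' = l mod N"
  have l': "0 < l'" "l' < N" using False N_pos by (auto simp: l'_def mod_greater_zero_iff_not_dvd)
  have red: "mcong P (z ^ l) (z ^ l')" if "z \<in> Z" for z
  proof -
    have "z ^ l = (z ^ N) ^ (l div N) * z ^ l'"
      by (simp add: l'_def flip: power_mult power_add)
    also have "mcong P \<dots> (1 ^ (l div N) * z ^ l')"
      by (intro mcong_mult mcong_power mcong_refl root_mod_p that)
    finally show ?thesis by simp
  qed
  obtain z0 where z0: "z0 \<in> Z" "\<not> mcong P (z0 ^ l) 1"
  proof (rule ccontr)
    assume "\<not> thesis"
    hence "\<And>z. z \<in> Z \<Longrightarrow> mcong P (z ^ l) 1" using that by blast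
    hence "\<And>z. z \<in> Z \<Longrightarrow> mcong P (z ^ l') 1" using red mcong_sym mcong_trans by blast
    thus False using roots_bound[OF l'(1) finite_Z] l'(2) card_Z incongruent by blast
  qed
  have "\<exists>z'\<in>Z. mcong (P ^ 2) (z0 * z) z'" if z: "z \<in> Z" for z
  proof -
    have r: "mcong (P ^ 2) ((z0 * z) ^ N) 1"
      using mcong_mult[OF root[OF z0(1)] root[OF z]] by (simp add: power_mult_distrib)
    have "\<exists>z'\<in>Z. mcong P (z0 * z) z'"
    proof (rule ccontr)
      assume no: "\<not> (\<exists>z'\<in>Z. mcong P (z0 * z) z')"
      show False
      \<comment> \<open>Otherwise \<open>z0 * z\<close> together with \<open>Z\<close> would be
        \<open>N + 1\<close> incongruent solutions of \<open>x ^ N = 1\<close> modulo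
        \<open>p\<close>.\<close>
      proof (rule roots_bound[OF N_pos, of "insert (z0 * z) Z"])
        have "z0 * z \<notin> Z" using no by (metis mcong_refl)
        thus "N < card (insert (z0 * z) Z)" using finite_Z card_Z by simp
        show "mcong P (x ^ N) 1" if "x \<in> insert (z0 * z) Z" for x
          using that root_mod_p mcong_dvd[OF r P_dvd_sq] by auto
        show "x = y" if "x \<in> insert (z0 * z) Z" "y \<in> insert (z0 * z) Z" "mcong P x y" for x y
          using that no incongruent mcong_sym by blast
      qed (use finite_Z in auto)
    qed
    thus ?thesis using lift_root r root by blast
  qed
  then obtain \<phi> where \<phi>: "\<And>z. z \<in> Z \<Longrightarrow> \<phi> z \<in> Z" "\<And>z. z \<in> Z \<Longrightarrow> mcong (P ^ 2) (z0 * z) (\<phi> z)"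
    by metis
  have z0P: "\<not> P dvd z0"
  proof
    assume "P dvd z0"
    hence "P dvd z0 ^ N" using N_pos by (simp add: dvd_power_le[of P z0 1 N, simplified])
    moreover have "P dvd z0 ^ N - 1" using root_mod_p[OF z0(1)] by (simp add: mcong_def)
    ultimately have "P dvd z0 ^ N - (z0 ^ N - 1)" by (rule dvd_diff)
    thus False using not_P_dvd_1 by simp
  qed
  have "inj_on \<phi> Z"
  proof (rule inj_onI)
    fix x y assume xy: "x \<in> Z" "y \<in> Z" "\<phi> x = \<phi> y"
    hence "mcong (P ^ 2) (z0 * x) (z0 * y)" using \<phi>(2)[of x] \<phi>(2)[of y] mcong_sym mcong_trans by metis
    hence "P dvd z0 * (x - y)" using mcong_dvd[OF _ P_dvd_sq] by (simp add: mcong_def right_diff_distrib)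
    hence "P dvd x - y" using z0P prime_elem_p prime_elem_dvd_mult_iff by blast
    thus "x = y" using incongruent xy by (simp add: mcong_def)
  qed
  hence im: "\<phi> ` Z = Z" using \<phi>(1) finite_Z by (intro endo_inj_surj) auto
  have "mcong (P ^ 2) (\<Sum>z\<in>Z. (z0 * z) ^ l) (\<Sum>z\<in>Z. \<phi> z ^ l)"
    by (intro mcong_sum mcong_power \<phi>(2))
  also have "(\<Sum>z\<in>Z. \<phi> z ^ l) = (\<Sum>z\<in>Z. z ^ l)"
    using sum.reindex[OF \<open>inj_on \<phi> Z\<close>, of "\<lambda>z. z ^ l"] im by simp
  finally have *: "mcong (P ^ 2) (\<Sum>z\<in>Z. (z0 * z) ^ l) (\<Sum>z\<in>Z. z ^ l)" .
  have "P ^ 2 dvd (z0 ^ l - 1) * (\<Sum>z\<in>Z. z ^ l)"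
  proof -
    have "(z0 ^ l - 1) * (\<Sum>z\<in>Z. z ^ l) = (\<Sum>z\<in>Z. (z0 * z) ^ l) - (\<Sum>z\<in>Z. z ^ l)"
      by (simp add: power_mult_distrib sum_distrib_left[symmetric] left_diff_distrib)
    thus ?thesis using * by (simp only: mcong_def)
  qed
  hence "P ^ 2 dvd (\<Sum>z\<in>Z. z ^ l)"
    using z0(2) unfolding mcong_def by (rule prime_elem_square_dvd[OF prime_elem_p])
  thus ?thesis using False by (simp add: mcong_def)
qed

lemma character_sum:
  "mcong (P ^ 2) (\<Sum>z\<in>Z. z ^ c * (1 + of_int \<delta> * z) ^ K)
     (of_int (int N * (\<Sum>l\<le>K. if N dvd c + l then \<delta> ^ l * int (K choose l) else 0)))"
proof -
  have "(\<Sum>z\<in>Z. z ^ c * (1 + of_int \<delta> * z) ^ K) =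
      (\<Sum>z\<in>Z. \<Sum>l\<le>K. of_int \<delta> ^ l * of_nat (K choose l) * z ^ (c + l))"
  proof (intro sum.cong refl)
    fix z :: 'a
    have "(1 + of_int \<delta> * z) ^ K = (of_int \<delta> * z + 1) ^ K" by (simp add: add.commute)
    also have "\<dots> = (\<Sum>l\<le>K. of_nat (K choose l) * (of_int \<delta> * z) ^ l)" using binomial_ring[of "of_int \<delta> * z" 1 K] by simp
    finally show "z ^ c * (1 + of_int \<delta> * z) ^ K =
        (\<Sum>l\<le>K. of_int \<delta> ^ l * of_nat (K choose l) * z ^ (c + l))"
      by (simp add: sum_distrib_left power_mult_distrib power_add mult_ac)
  qed
  also have "\<dots> = (\<Sum>l\<le>K. of_int \<delta> ^ l * of_nat (K choose l) * (\<Sum>z\<in>Z. z ^ (c + l)))"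
    unfolding sum_distrib_left by (rule sum.swap)
  also have "mcong (P ^ 2) \<dots> (\<Sum>l\<le>K. of_int \<delta> ^ l * of_nat (K choose l) * (if N dvd c + l then of_nat N else 0))"
    by (intro mcong_sum mcong_mult mcong_refl power_sum)
  also have "\<dots> = of_int (int N * (\<Sum>l\<le>K. if N dvd c + l then \<delta> ^ l * int (K choose l) else 0))"
    unfolding sum_distrib_left of_int_sum by (intro sum.cong refl) (simp add: mult_ac)
  finally show ?thesis .
qed

end

text \<open>An octic root of unity \<open>x\<close> has \<open>x + x ^ 3 \<in> {0, 2, - 2, s, - s}\<close> with \<open>s ^ 2 = - 2\<close>,
  and \<open>x ^ 5 + x ^ 7\<close> is the conjugate value.\<close>

lemma octic_trace:
  fixes P s x :: "'a::idom"
  assumes "prime_elem P" "\<not> P dvd 2" and s: "mcong (P ^ 2) (s ^ 2) (- 2)" and x: "mcong (P ^ 2) (x ^ 8) 1"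
  shows "mcong (P ^ 2) (x ^ 4) 1 \<and> (\<exists>a\<in>{-1, 0, 1 :: int}. mcong (P ^ 2) (x + x ^ 3) (2 * of_int a) \<and>
            mcong (P ^ 2) (x ^ 5 + x ^ 7) (2 * of_int a)) \<or>
         mcong (P ^ 2) (x ^ 4) (- 1) \<and> (\<exists>b\<in>{-1, 1 :: int}. mcong (P ^ 2) (x + x ^ 3) (of_int b * s) \<and>
            mcong (P ^ 2) (x ^ 5 + x ^ 7) (- (of_int b * s)))"
proof -
  \<comment> \<open>The factors differ by \<open>2 * w\<close>, so at most one is divisible by
    \<open>P\<close>, and the other one must absorb all of \<open>P ^ 2\<close>.\<close>
  have split: "P ^ 2 dvd u \<or> P ^ 2 dvd v" if "P ^ 2 dvd u * v" "u - v = 2 * w" "\<not> P dvd w" for u v w :: 'a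
  proof (cases "P dvd u")
    case False
    thus ?thesis using prime_elem_square_dvd[OF assms(1) that(1)] by blast
  next
    case True
    have "\<not> P dvd v"
    proof
      assume "P dvd v"
      hence "P dvd 2 * w" using dvd_diff[OF True] that(2) by metis
      thus False using assms(1,2) that(3) prime_elem_dvd_mult_iff by blast
    qed
    thus ?thesis using prime_elem_square_dvd[OF assms(1), of v u] that(1) by (simp add: mult.commute)
  qed
  have P1: "\<not> P dvd 1" using assms(1) by (simp add: prime_elem_def)
  have x57: "x ^ 5 + x ^ 7 = x ^ 4 * (x + x ^ 3)"
    by (simp add: eval_nat_numeral algebra_simps)
  have Psq: "P dvd P ^ 2" by (simp add: power2_eq_square)
  have "P ^ 2 dvd (x ^ 4 + 1) * (x ^ 4 - 1)"
    using x by (simp add: mcong_def algebra_simps flip: power_add)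
  hence "P ^ 2 dvd x ^ 4 + 1 \<or> P ^ 2 dvd x ^ 4 - 1"
    using split[of "x ^ 4 + 1" "x ^ 4 - 1" 1] P1 by simp
  thus ?thesis
  proof
    assume "P ^ 2 dvd x ^ 4 - 1"
    hence x4: "mcong (P ^ 2) (x ^ 4) 1" by (simp add: mcong_def)
    have "P ^ 2 dvd (x ^ 2 + 1) * (x ^ 2 - 1)"
      using x4 by (simp add: mcong_def algebra_simps flip: power_add)
    hence "P ^ 2 dvd x ^ 2 + 1 \<or> P ^ 2 dvd x ^ 2 - 1"
      using split[of "x ^ 2 + 1" "x ^ 2 - 1" 1] P1 by simp
    hence "\<exists>a\<in>{-1, 0, 1 :: int}. mcong (P ^ 2) (x + x ^ 3) (2 * of_int a)"
    proof
      assume "P ^ 2 dvd x ^ 2 + 1"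
      hence "P ^ 2 dvd x * (x ^ 2 + 1)" by simp
      moreover have "x * (x ^ 2 + 1) = x + x ^ 3" by (simp add: eval_nat_numeral algebra_simps)
      ultimately show ?thesis by (auto simp: mcong_def)
    next
      assume d: "P ^ 2 dvd x ^ 2 - 1"
      hence "P ^ 2 dvd (x + 1) * (x - 1)" by (simp add: algebra_simps power2_eq_square)
      hence "P ^ 2 dvd x + 1 \<or> P ^ 2 dvd x - 1"
        using split[of "x + 1" "x - 1" 1] P1 by simp
      moreover have "mcong (P ^ 2) (x * x ^ 2) (x * 1)" using d by (intro mcong_mult) (simp_all add: mcong_def)
      hence x3: "mcong (P ^ 2) (x + x ^ 3) (x + x)"
        by (intro mcong_add) (simp_all add: eval_nat_numeral mult.assoc)
      ultimately show ?thesis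
      proof (elim disjE)
        assume "P ^ 2 dvd x + 1"
        hence "mcong (P ^ 2) (x + x) (- 1 + - 1)" by (intro mcong_add) (simp_all add: mcong_def)
        thus ?thesis using mcong_trans[OF x3] by auto
      next
        assume "P ^ 2 dvd x - 1"
        hence "mcong (P ^ 2) (x + x) (1 + 1)" by (intro mcong_add) (simp_all add: mcong_def)
        thus ?thesis using mcong_trans[OF x3] by auto
      qed
    qed
    then obtain a where a: "a \<in> {-1, 0, 1 :: int}" "mcong (P ^ 2) (x + x ^ 3) (2 * of_int a)" by blast
    have "mcong (P ^ 2) (x ^ 5 + x ^ 7) (1 * (2 * of_int a))"
      unfolding x57 by (intro mcong_mult x4 a(2))
    thus ?thesis using a x4 by auto
  next
    assume "P ^ 2 dvd x ^ 4 + 1"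
    hence x4: "mcong (P ^ 2) (x ^ 4) (- 1)" by (simp add: mcong_def)
    define t where "t = x + x ^ 3"
    have "t ^ 2 = x ^ 2 * (1 + x ^ 4) + 2 * x ^ 4" by (simp add: t_def eval_nat_numeral algebra_simps)
    moreover have "mcong (P ^ 2) (x ^ 2 * (1 + x ^ 4) + 2 * x ^ 4) (x ^ 2 * (1 + - 1) + 2 * - 1)"
      by (intro mcong_add mcong_mult mcong_refl x4)
    ultimately have t2: "mcong (P ^ 2) (t ^ 2) (- 2)" by simp
    hence "P ^ 2 dvd t ^ 2 - s ^ 2" using mcong_trans[OF t2 mcong_sym[OF s]] by (simp add: mcong_def)
    hence "P ^ 2 dvd (t + s) * (t - s)" by (simp add: algebra_simps power2_eq_square)
    moreover have "\<not> P dvd s"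
    proof
      assume "P dvd s"
      hence "P dvd s ^ 2" by (simp add: power2_eq_square)
      moreover have "P dvd s ^ 2 + 2" using dvd_trans[OF Psq] s by (simp add: mcong_def)
      ultimately have "P dvd s ^ 2 + 2 - s ^ 2" by (intro dvd_diff)
      thus False using assms(2) by simp
    qed
    ultimately have "P ^ 2 dvd t + s \<or> P ^ 2 dvd t - s"
      using split[of "t + s" "t - s" s] by simp
    hence "\<exists>b\<in>{-1, 1 :: int}. mcong (P ^ 2) (x + x ^ 3) (of_int b * s)"
      unfolding t_def[symmetric] by (auto simp: mcong_def)
    then obtain b where b: "b \<in> {-1, 1 :: int}" "mcong (P ^ 2) (x + x ^ 3) (of_int b * s)" by blast
    have "mcong (P ^ 2) (x ^ 5 + x ^ 7) (- 1 * (of_int b * s))"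
      unfolding x57 by (intro mcong_mult x4 b(2))
    thus ?thesis using b x4 by auto
  qed
qed

text \<open>The exponents 1 and 3 form the subgroup of the units modulo 8 that fixes a square root
  of \<open>- 2\<close>; 5 and 7 form its other coset. Adding the sums in pairs thus gives
  \<open>2 * J\<close> and \<open>2 * J'\<close> as conjugate expressions in \<open>s\<close>, with
  integer coefficients bounded by the number of terms.\<close>

lemma octic_two_squares:
  fixes X :: "'b \<Rightarrow> 'a::idom" and J J' :: int
  assumes P: "prime_elem (of_nat p :: 'a)" and p: "p \<ge> 3" and fin: "finite Y"
    and card: "card Y = N - 1" "4 dvd N" "0 < N" "N \<le> p + 1"
    and inj: "\<And>k::int. (of_nat p :: 'a) ^ 2 dvd of_int k \<Longrightarrow> int p ^ 2 dvd k"
    and X8: "\<And>y. y \<in> Y \<Longrightarrow> mcong (of_nat p ^ 2) (X y ^ 8) 1"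
    and s1: "mcong (of_nat p ^ 2) (\<Sum>y\<in>Y. X y) (of_int J)"
    and s3: "mcong (of_nat p ^ 2) (\<Sum>y\<in>Y. X y ^ 3) (of_int J)"
    and s4: "mcong (of_nat p ^ 2) (\<Sum>y\<in>Y. X y ^ 4) (- 1)"
    and s5: "mcong (of_nat p ^ 2) (\<Sum>y\<in>Y. X y ^ 5) (of_int J')"
    and s7: "mcong (of_nat p ^ 2) (\<Sum>y\<in>Y. X y ^ 7) (of_int J')"
    and JJ: "int p ^ 2 dvd J * J' - int p" and odd: "odd p"
  shows "\<exists>c d :: int. c ^ 2 + 2 * d ^ 2 = int p \<and> int p ^ 2 dvd J + J' - 2 * c"
proof -
  define Q :: 'a where "Q = of_nat p ^ 2"
  note [simp] = Q_def[symmetric]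
  have small: "k = 0" if "int p ^ 2 dvd k" "\<bar>k\<bar> < int p ^ 2" for k
    using that by (metis dvd_imp_le_int not_less abs_ge_zero abs_of_nonneg zero_le_power2)
  have pp: "int p * 3 \<le> int p ^ 2" using p by (simp add: power2_eq_square)
  have not2: "\<not> (of_nat p :: 'a) dvd 2"
  proof
    assume a: "(of_nat p :: 'a) dvd 2"
    have "(of_nat p :: 'a) * of_nat p dvd 2 * 2" by (rule mult_dvd_mono[OF a a])
    hence "(of_nat p :: 'a) ^ 2 dvd of_int 4" by (simp add: power2_eq_square del: Q_def[symmetric])
    hence "int p ^ 2 dvd 4" by (rule inj)
    hence "int p ^ 2 \<le> 4" by (rule zdvd_imp_le) simp
    thus False using pp p by linarith
  qed
  define Y4 where "Y4 = {y \<in> Y. mcong Q (X y ^ 4) (- 1)}"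
  have not_both: "\<not> (mcong Q x 1 \<and> mcong Q x (- 1))" for x :: 'a
  proof
    assume "mcong Q x 1 \<and> mcong Q x (- 1)"
    hence "mcong Q 1 (- 1)" using mcong_sym mcong_trans by blast
    hence "of_nat p ^ 2 dvd (of_int 2 :: 'a)" by (simp add: mcong_def)
    hence "int p ^ 2 dvd 2" by (rule inj)
    hence "int p ^ 2 \<le> 2" by (rule zdvd_imp_le) simp
    thus False using pp p by linarith
  qed
  have x4: "mcong Q (X y ^ 4) 1 \<or> mcong Q (X y ^ 4) (- 1)" if "y \<in> Y" for y
  proof -
    have "Q dvd (X y ^ 4 - 1) * (X y ^ 4 + 1)"
      using X8[OF that] by (simp add: mcong_def algebra_simps flip: power_add)
    moreover have "\<not> (of_nat p dvd X y ^ 4 - 1 \<and> of_nat p dvd X y ^ 4 + 1)"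
    proof
      assume a: "of_nat p dvd X y ^ 4 - 1 \<and> of_nat p dvd X y ^ 4 + 1"
      have "of_nat p dvd (X y ^ 4 + 1) - (X y ^ 4 - 1)" by (rule dvd_diff) (use a in auto)
      thus False using not2 by simp
    qed
    ultimately show ?thesis
      using prime_elem_square_dvd[OF P, of "X y ^ 4 - 1" "X y ^ 4 + 1"]
        prime_elem_square_dvd[OF P, of "X y ^ 4 + 1" "X y ^ 4 - 1"]
      by (auto simp: mcong_def mult.commute)
  qed
  define h where "h = card Y4"
  have finY4: "finite Y4" "Y4 \<subseteq> Y" using fin by (auto simp: Y4_def)
  have hle: "h \<le> card Y" unfolding h_def by (rule card_mono[OF fin finY4(2)])
  \<comment> \<open>Each fourth power is 1 or \<open>- 1\<close>, and their sum is known; comparing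
    sizes with \<open>p ^ 2\<close> shows that exactly \<open>N / 2\<close> of them are
    \<open>- 1\<close>.\<close>
  have "mcong Q (\<Sum>y\<in>Y. X y ^ 4) (\<Sum>y\<in>Y. if y \<in> Y4 then - 1 else 1)"
    by (intro mcong_sum) (use x4 in \<open>auto simp: Y4_def\<close>)
  also have "(\<Sum>y\<in>Y. if y \<in> Y4 then - 1 else 1) = (of_int (int (card Y) - 2 * int h) :: 'a)"
  proof -
    have "(\<Sum>y\<in>Y. if y \<in> Y4 then - 1 else 1) = (\<Sum>y\<in>Y4. - 1) + (\<Sum>y\<in>Y - Y4. 1 :: 'a)"
      by (subst sum.subset_diff[OF finY4(2) fin]) (simp add: add.commute)
    also have "\<dots> = - of_nat h + of_nat (card Y - h)"
      using finY4 fin by (simp add: h_def card_Diff_subset)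
    also have "(of_nat (card Y - h) :: 'a) = of_nat (card Y) - of_nat h" by (rule of_nat_diff[OF hle])
    finally show ?thesis by simp
  qed
  finally have "mcong Q (of_int (int (card Y) - 2 * int h)) (- 1)"
    using s4 mcong_sym mcong_trans by (metis Q_def)
  hence "(of_nat p :: 'a) ^ 2 dvd of_int (int (card Y) - 2 * int h + 1)" by (simp add: mcong_def)
  hence d: "int p ^ 2 dvd int (card Y) - 2 * int h + 1" by (rule inj)
  have "int (card Y) - 2 * int h + 1 = 0"
    by (rule small[OF d]) (use hle card pp p in linarith)
  hence hN: "2 * h = N" using card by linarith
  hence heven: "even h" and hpos: "h > 0" using card by (auto elim!: dvdE)
  obtain y0 where y0: "y0 \<in> Y4" using hpos by (auto simp: h_def card_gt_0_iff)
  define s where "s = X y0 + X y0 ^ 3"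
  have s2: "mcong Q (s ^ 2) (- 2)"
  proof -
    have e: "mcong Q (X y0 ^ 4) (- 1)" using y0 by (simp add: Y4_def)
    have "s ^ 2 = X y0 ^ 2 * (1 + X y0 ^ 4) + 2 * X y0 ^ 4" by (simp add: s_def eval_nat_numeral algebra_simps)
    also have "mcong Q \<dots> (X y0 ^ 2 * (1 + - 1) + 2 * - 1)"
      by (intro mcong_add mcong_mult mcong_refl e)
    finally show ?thesis by simp
  qed
  have "\<exists>a b :: int. (if y \<in> Y4 then a = 0 \<and> \<bar>b\<bar> = 1 else \<bar>a\<bar> \<le> 1 \<and> b = 0) \<and>
      mcong Q (X y + X y ^ 3) (2 * of_int a + of_int b * s) \<and>
      mcong Q (X y ^ 5 + X y ^ 7) (2 * of_int a - of_int b * s)" if y: "y \<in> Y" for y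
  proof -
    from octic_trace[OF P not2, of s "X y"] s2 X8[OF y]
    have "mcong Q (X y ^ 4) 1 \<and> (\<exists>a\<in>{-1, 0, 1 :: int}. mcong Q (X y + X y ^ 3) (2 * of_int a) \<and>
            mcong Q (X y ^ 5 + X y ^ 7) (2 * of_int a)) \<or>
         mcong Q (X y ^ 4) (- 1) \<and> (\<exists>b\<in>{-1, 1 :: int}. mcong Q (X y + X y ^ 3) (of_int b * s) \<and>
            mcong Q (X y ^ 5 + X y ^ 7) (- (of_int b * s)))" by (simp only: Q_def)
    thus ?thesis
    proof (elim disjE conjE bexE)
      fix a :: int assume a: "mcong Q (X y ^ 4) 1" "a \<in> {-1, 0, 1}" "mcong Q (X y + X y ^ 3) (2 * of_int a)"
        "mcong Q (X y ^ 5 + X y ^ 7) (2 * of_int a)"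
      have "y \<notin> Y4" using a(1) not_both by (auto simp: Y4_def)
      thus ?thesis using a by (intro exI[of _ a] exI[of _ 0]) auto
    next
      fix b :: int assume b: "mcong Q (X y ^ 4) (- 1)" "b \<in> {-1, 1}" "mcong Q (X y + X y ^ 3) (of_int b * s)"
        "mcong Q (X y ^ 5 + X y ^ 7) (- (of_int b * s))"
      have "y \<in> Y4" using b(1) y by (auto simp: Y4_def)
      thus ?thesis using b by (intro exI[of _ 0] exI[of _ b]) auto
    qed
  qed
  then obtain a b :: "'b \<Rightarrow> int" where
    ab: "\<And>y. y \<in> Y \<Longrightarrow> (if y \<in> Y4 then a y = 0 \<and> \<bar>b y\<bar> = 1 else \<bar>a y\<bar> \<le> 1 \<and> b y = 0)"
    and t1: "\<And>y. y \<in> Y \<Longrightarrow> mcong Q (X y + X y ^ 3) (2 * of_int (a y) + of_int (b y) * s)"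
    and t2: "\<And>y. y \<in> Y \<Longrightarrow> mcong Q (X y ^ 5 + X y ^ 7) (2 * of_int (a y) - of_int (b y) * s)"
    by metis
  define A B where "A = (\<Sum>y\<in>Y. a y)" and "B = (\<Sum>y\<in>Y. b y)"
  \<comment> \<open>\<open>B\<close> is a sum of \<open>h\<close> signs and \<open>h = N / 2\<close>
    is even because 4 divides \<open>N\<close>; so the factor 2 can be cancelled from the
    sums.\<close>
  have "even B"
  proof -
    have "B = (\<Sum>y\<in>Y4. b y)" unfolding B_def
      by (rule sum.mono_neutral_right) (use fin finY4 ab in auto)
    also have "even \<dots> \<longleftrightarrow> even (\<Sum>y\<in>Y4. 1 :: int)"
    proof -
      have "even ((\<Sum>y\<in>Y4. b y) - (\<Sum>y\<in>Y4. 1))" unfolding sum_subtractf[symmetric]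
      proof (rule dvd_sum)
        fix y assume y: "y \<in> Y4"
        hence "\<bar>b y\<bar> = 1" using ab[of y] finY4 by auto
        thus "even (b y - 1)" by presburger
      qed
      thus ?thesis by presburger
    qed
    finally show ?thesis using heven by (simp add: h_def)
  qed
  then obtain e where e: "B = 2 * e" by blast
  have S1: "mcong Q (2 * of_int J) (2 * of_int A + of_int B * s)"
  proof -
    have m1: "mcong Q (\<Sum>y\<in>Y. X y + X y ^ 3) (\<Sum>y\<in>Y. 2 * of_int (a y) + of_int (b y) * s)"
      by (intro mcong_sum t1)
    have m2: "(\<Sum>y\<in>Y. 2 * of_int (a y) + of_int (b y) * s) = 2 * of_int A + of_int B * s"
      by (simp add: A_def B_def sum.distrib sum_distrib_left sum_distrib_right)
    have m3: "mcong Q (\<Sum>y\<in>Y. X y + X y ^ 3) (2 * of_int J)"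
      unfolding sum.distrib mult_2 using s1 s3 by (intro mcong_add) (simp_all only: Q_def)
    show ?thesis by (rule mcong_trans[OF mcong_sym[OF m3] m1[unfolded m2]])
  qed
  have S2: "mcong Q (2 * of_int J') (2 * of_int A - of_int B * s)"
  proof -
    have m1: "mcong Q (\<Sum>y\<in>Y. X y ^ 5 + X y ^ 7) (\<Sum>y\<in>Y. 2 * of_int (a y) - of_int (b y) * s)"
      by (intro mcong_sum t2)
    have m2: "(\<Sum>y\<in>Y. 2 * of_int (a y) - of_int (b y) * s) = 2 * of_int A - of_int B * s"
      by (simp add: A_def B_def sum_subtractf sum_distrib_left sum_distrib_right)
    have m3: "mcong Q (\<Sum>y\<in>Y. X y ^ 5 + X y ^ 7) (2 * of_int J')"
      unfolding sum.distrib mult_2 using s5 s7 by (intro mcong_add) (simp_all only: Q_def)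
    show ?thesis by (rule mcong_trans[OF mcong_sym[OF m3] m1[unfolded m2]])
  qed
  have cancel2: "mcong Q x y" if "mcong Q (2 * x) (2 * y)" for x y :: 'a
    using that prime_elem_square_dvd[OF P, of 2 "x - y"] not2
    by (simp add: mcong_def right_diff_distrib)
  have J1: "mcong Q (of_int J) (of_int A + of_int e * s)"
    by (rule cancel2) (use S1 in \<open>simp add: e distrib_left mult.assoc\<close>)
  have J2: "mcong Q (of_int J') (of_int A - of_int e * s)"
    by (rule cancel2) (use S2 in \<open>simp add: e right_diff_distrib mult.assoc\<close>)
  have "mcong Q (of_int J + of_int J') ((of_int A + of_int e * s) + (of_int A - of_int e * s))"
    by (intro mcong_add J1 J2)
  hence "(of_nat p :: 'a) ^ 2 dvd of_int (J + J' - 2 * A)" by (simp add: mcong_def)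
  hence sum: "int p ^ 2 dvd J + J' - 2 * A" by (rule inj)
  have "mcong Q (of_int J * of_int J') ((of_int A + of_int e * s) * (of_int A - of_int e * s))"
    by (intro mcong_mult J1 J2)
  also have "(of_int A + of_int e * s) * (of_int A - of_int e * s) = of_int (A ^ 2) - of_int (e ^ 2) * s ^ 2"
    by (simp add: power2_eq_square algebra_simps)
  also have "mcong Q \<dots> (of_int (A ^ 2) - of_int (e ^ 2) * (- 2))"
    by (intro mcong_diff mcong_mult mcong_refl s2)
  finally have "(of_nat p :: 'a) ^ 2 dvd of_int (J * J' - (A ^ 2 + 2 * e ^ 2))"
    by (simp add: mcong_def algebra_simps)
  hence "int p ^ 2 dvd J * J' - (A ^ 2 + 2 * e ^ 2)" by (rule inj)
  hence "int p ^ 2 dvd (J * J' - int p) - (J * J' - (A ^ 2 + 2 * e ^ 2))" by (rule dvd_diff[OF JJ])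
  hence norm: "int p ^ 2 dvd A ^ 2 + 2 * e ^ 2 - int p" by simp
  have "\<bar>A\<bar> + \<bar>B\<bar> \<le> (\<Sum>y\<in>Y. \<bar>a y\<bar>) + (\<Sum>y\<in>Y. \<bar>b y\<bar>)"
    unfolding A_def B_def by (intro add_mono sum_abs)
  also have "\<dots> = (\<Sum>y\<in>Y. \<bar>a y\<bar> + \<bar>b y\<bar>)" by (simp add: sum.distrib)
  also have "\<dots> \<le> (\<Sum>y\<in>Y. 1)"
  proof (rule sum_mono)
    fix y assume "y \<in> Y"
    from ab[OF this] show "\<bar>a y\<bar> + \<bar>b y\<bar> \<le> 1" by (auto split: if_splits)
  qed
  also have "\<dots> \<le> int p" using card by simp
  finally have bound: "\<bar>A\<bar> + 2 * \<bar>e\<bar> \<le> int p" by (simp add: e abs_mult)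
  have "A ^ 2 + 2 * e ^ 2 \<le> (\<bar>A\<bar> + 2 * \<bar>e\<bar>) ^ 2"
  proof -
    have "(\<bar>A\<bar> + 2 * \<bar>e\<bar>) ^ 2 = A ^ 2 + 2 * e ^ 2 + (4 * (\<bar>A\<bar> * \<bar>e\<bar>) + 2 * e ^ 2)"
      by (simp add: power2_sum power_mult_distrib)
    thus ?thesis by simp
  qed
  also have "\<dots> \<le> int p ^ 2" using bound by (intro power_mono) auto
  finally have up: "A ^ 2 + 2 * e ^ 2 \<le> int p ^ 2" .
  \<comment> \<open>The form lies between 0 and \<open>p ^ 2\<close> and is \<open>p\<close> modulo
    \<open>p ^ 2\<close>, which leaves only the value \<open>p\<close>.\<close>
  have "0 \<le> A ^ 2 + 2 * e ^ 2" by simp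
  hence "A ^ 2 + 2 * e ^ 2 - int p = 0"
    using up pp p by (intro small[OF norm]) linarith
  thus ?thesis using sum by (intro exI[of _ A] exI[of _ e]) simp
qed

lemma mcong_binomial_p:
  fixes y :: "'a::comm_ring_1"
  assumes "prime p" shows "mcong (of_nat p) ((1 + y) ^ p) (1 + y ^ p)"
proof -
  have p: "p > 0" using assms prime_gt_0_nat by blast
  have "(1 + y) ^ p = (\<Sum>k\<le>p. of_nat (p choose k) * y ^ k)"
    using binomial_ring[of y 1 p] by (simp add: add.commute)
  also have "mcong (of_nat p) \<dots> (\<Sum>k\<le>p. (if k = 0 then 1 else 0) + (if k = p then y ^ p else 0))"
  proof (intro mcong_sum)
    fix k assume "k \<in> {..p}"
    then consider "k = 0" | "k = p" | "0 < k" "k < p" by fastforce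
    thus "mcong (of_nat p) (of_nat (p choose k) * y ^ k) ((if k = 0 then 1 else 0) + (if k = p then y ^ p else 0))"
    proof cases
      case 3
      have "p dvd p choose k" using 3 assms by (intro dvd_choose_prime) auto
      hence "(of_nat p :: 'a) dvd of_nat (p choose k)" by (metis dvd_def of_nat_mult)
      thus ?thesis using 3 by (simp add: mcong_def)
    qed (use p in auto)
  qed
  also have "\<dots> = 1 + y ^ p" by (simp add: sum.distrib)
  finally show ?thesis .
qed

context root_system
begin

lemma cancel_mod_p: "\<not> P dvd x \<Longrightarrow> mcong P (x * y) (x * z) \<Longrightarrow> mcong P y z"
  unfolding mcong_def right_diff_distrib[symmetric] using prime_elem_p prime_elem_dvd_mult_iff by blast

text \<open>Here \<open>z ^ p\<close> is \<open>z\<close> modulo \<open>p\<close>, so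
  \<open>(1 - z) ^ p\<close> is \<open>1 - z\<close>; cancelling one factor and raising to the power
  \<open>p\<close> lifts the congruence.\<close>

lemma one_minus_power:
  assumes "prime p" "odd p" "N = p - 1" "z \<in> Z" "\<not> P dvd 1 + of_int (- 1) * z"
  shows "mcong (P ^ 2) ((1 + of_int (- 1) * z) ^ (p * (p - 1))) (z ^ 0)"
proof -
  define x where "x = 1 + of_int (- 1) * z"
  have p: "p = Suc (p - 1)" using assms(1) prime_gt_0_nat[of p] by simp
  have "mcong P (x ^ p) (1 + (- z) ^ p)"
    using mcong_binomial_p[OF assms(1), of "- z"] by (simp add: x_def)
  also have "1 + (- z) ^ p = 1 - z * z ^ N"
    unfolding power_minus_odd[OF assms(2)] assms(3) power_Suc[symmetric] using p by simp
  also have "mcong P \<dots> (1 - z * 1)"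
    by (intro mcong_diff mcong_mult mcong_refl root_mod_p assms(4))
  also have "1 - z * 1 = x * 1" by (simp add: x_def)
  also have "x ^ p = x * x ^ (p - 1)" by (subst p) simp
  finally have "mcong P (x ^ (p - 1)) 1" using cancel_mod_p assms(5) by (simp add: x_def)
  hence "mcong (P ^ 2) ((x ^ (p - 1)) ^ p) 1" by (rule mcong_one_power_p)
  thus ?thesis by (simp add: x_def mult.commute flip: power_mult)
qed

text \<open>Here \<open>z ^ p\<close> is the inverse of \<open>z\<close> modulo \<open>p\<close>, so
  \<open>z * (1 + z) ^ (p - 1)\<close> is 1. Its \<open>p\<close>-th power is 1 modulo
  \<open>p ^ 2\<close>, and \<open>z ^ (p + 1) = 1\<close> turns the inverse of \<open>z ^ p\<close>
  into \<open>z\<close>.\<close>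

lemma one_plus_power:
  assumes "prime p" "N = p + 1" "z \<in> Z" "\<not> P dvd 1 + of_int 1 * z"
  shows "mcong (P ^ 2) ((1 + of_int 1 * z) ^ (p * (p - 1))) (z ^ 1)"
proof -
  define x where "x = 1 + of_int 1 * z"
  have p: "p = Suc (p - 1)" using assms(1) prime_gt_0_nat[of p] by simp
  have "mcong P (z * x ^ p) (z * (1 + z ^ p))"
    using mcong_binomial_p[OF assms(1), of z] by (intro mcong_mult mcong_refl) (simp add: x_def)
  also have "z * (1 + z ^ p) = z + z ^ N" by (simp add: assms(2) distrib_left)
  also have "mcong P \<dots> (z + 1)"
    by (intro mcong_add mcong_refl root_mod_p assms(3))
  also have "z + 1 = x * 1" by (simp add: x_def)
  also have "z * x ^ p = x * (z * x ^ (p - 1))" by (subst p) simp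
  finally have "mcong P (z * x ^ (p - 1)) 1" using cancel_mod_p assms(4) by (simp add: x_def)
  hence "mcong (P ^ 2) ((z * x ^ (p - 1)) ^ p) 1" by (rule mcong_one_power_p)
  hence "mcong (P ^ 2) (z * (z * x ^ (p - 1)) ^ p) (z * 1)" by (intro mcong_mult mcong_refl)
  moreover have "z * (z * x ^ (p - 1)) ^ p = z ^ N * x ^ (p * (p - 1))"
    by (simp add: assms(2) power_mult_distrib mult.commute flip: power_mult)
  moreover have "mcong (P ^ 2) (z ^ N * x ^ (p * (p - 1))) (1 * x ^ (p * (p - 1)))"
    by (intro mcong_mult mcong_refl root assms(3))
  ultimately have "mcong (P ^ 2) (x ^ (p * (p - 1))) z"
    using mcong_trans[OF mcong_sym] by simp
  thus ?thesis by (simp add: x_def)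
qed

end

section \<open>From root systems to \<open>a ^ 2 + 2 b ^ 2\<close>, and the case
  \<open>p = 8 M + 1\<close>\<close>

lemma fermat_mcong: "prime p \<Longrightarrow> \<not> p dvd a \<Longrightarrow> mcong (int p) (int a ^ (p - 1)) 1"
  using fermat_theorem[of p a] by (simp add: mcong_def cong_iff_dvd_diff flip: cong_int_iff)

lemma fermat_mcong': "prime p \<Longrightarrow> mcong (int p) (int a ^ p) (int a)"
proof (cases "p dvd a")
  assume "prime p" "\<not> p dvd a"
  hence "mcong (int p) (int a * int a ^ (p - 1)) (int a * 1)" by (intro mcong_mult mcong_refl fermat_mcong)
  thus ?thesis using prime_gt_0_nat[OF \<open>prime p\<close>] by (simp flip: power_Suc)
next
  assume "prime p" "p dvd a"
  hence "int p dvd int a" by simp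
  moreover from this have "int p dvd int a ^ p" using prime_gt_0_nat[OF \<open>prime p\<close>] by (cases p) auto
  ultimately show ?thesis by (simp add: mcong_def)
qed

text \<open>By the composition identities for the form \<open>v ^ 2 + 2 * u ^ 2\<close>, both
  \<open>a y - b x\<close> and \<open>a y + b x\<close> occur as \<open>u\<close> in a
  representation of \<open>p ^ 2\<close>. As \<open>p\<close> divides one of them, that one is
  0.\<close>

lemma sum_two_squares_unique:
  fixes a b x y :: int
  assumes "prime p" "a ^ 2 + 2 * b ^ 2 = int p" "x ^ 2 + 2 * y ^ 2 = int p"
  shows "a ^ 2 = x ^ 2"
proof -
  have pp: "prime (int p)" "int p > 0" using assms(1) prime_gt_0_nat by auto
  have "(a * y - b * x) * (a * y + b * x) = (a ^ 2 + 2 * b ^ 2) * y ^ 2 - b ^ 2 * (x ^ 2 + 2 * y ^ 2)"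
    by (simp add: power2_eq_square algebra_simps)
  hence prod: "(a * y - b * x) * (a * y + b * x) = int p * (y ^ 2 - b ^ 2)"
    unfolding assms(2,3) by (simp add: algebra_simps)
  hence "int p dvd a * y - b * x \<or> int p dvd a * y + b * x"
    using pp(1) by (metis dvd_triv_left prime_dvd_mult_iff)
  moreover have key: "u = 0" if "int p dvd u" "v ^ 2 + 2 * u ^ 2 = int p ^ 2" for u v
  proof (rule ccontr)
    assume "u \<noteq> 0"
    hence "int p \<le> \<bar>u\<bar>" using dvd_imp_le_int[OF \<open>u \<noteq> 0\<close> that(1)] by simp
    hence "int p ^ 2 \<le> u ^ 2" using pp(2) by (metis abs_le_square_iff abs_of_pos)
    moreover have "int p ^ 2 > 0" using pp(2) by simp
    ultimately show False using that(2) zero_le_power2[of v] by linarith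
  qed
  have n1: "(a * x + 2 * b * y) ^ 2 + 2 * (a * y - b * x) ^ 2 = int p ^ 2"
    and n2: "(a * x - 2 * b * y) ^ 2 + 2 * (a * y + b * x) ^ 2 = int p ^ 2"
  proof -
    have "(a * x + 2 * b * y) ^ 2 + 2 * (a * y - b * x) ^ 2 = (a ^ 2 + 2 * b ^ 2) * (x ^ 2 + 2 * y ^ 2)"
      "(a * x - 2 * b * y) ^ 2 + 2 * (a * y + b * x) ^ 2 = (a ^ 2 + 2 * b ^ 2) * (x ^ 2 + 2 * y ^ 2)"
      by (simp_all add: power2_eq_square algebra_simps)
    thus "(a * x + 2 * b * y) ^ 2 + 2 * (a * y - b * x) ^ 2 = int p ^ 2"
      "(a * x - 2 * b * y) ^ 2 + 2 * (a * y + b * x) ^ 2 = int p ^ 2"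
      unfolding assms(2,3) by (simp_all add: power2_eq_square)
  qed
  ultimately have "(a * y - b * x) * (a * y + b * x) = 0"
    using key[OF _ n1] key[OF _ n2] by auto
  hence "y ^ 2 = b ^ 2" using prod pp(2) by simp
  thus ?thesis using assms(2,3) by simp
qed

context odd_prime
begin

text \<open>The substitution \<open>l \<mapsto> p * n - l\<close> is the symmetry
  \<open>z \<mapsto> 1 / z\<close> of the character sums.\<close>

lemma jsum_symmetric:
  assumes "D dvd c1 + c2 + p * n" "\<delta> = 1 \<or> \<delta> = - 1" "\<delta> ^ (p * n) = 1"
  shows "jsum \<delta> D c1 = jsum \<delta> D c2"
  unfolding jsum_def
proof (rule sum.reindex_bij_witness[of _ "\<lambda>l. p * n - l" "\<lambda>l. p * n - l"])
  fix l assume l: "l \<in> {..p * n}"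
  hence "c1 + c2 + p * n = (c1 + l) + (c2 + (p * n - l))" by simp
  hence "D dvd c1 + l \<longleftrightarrow> D dvd c2 + (p * n - l)"
    using assms(1) by (metis dvd_add_left_iff dvd_add_right_iff)
  moreover have "\<delta> ^ l = \<delta> ^ (p * n - l)"
  proof -
    have "\<delta> ^ l * \<delta> ^ (p * n - l) = 1" using l assms(3) by (simp flip: power_add)
    moreover have "\<delta> ^ (p * n - l) * \<delta> ^ (p * n - l) = 1" using assms(2) by (auto simp flip: power_mult_distrib)
    ultimately show ?thesis by (metis mult_cancel_right zero_neq_one mult_zero_right)
  qed
  moreover have "(p * n) choose l = (p * n) choose (p * n - l)" using l by (intro binomial_symmetric) auto
  ultimately show "(if D dvd c2 + (p * n - l) then \<delta> ^ (p * n - l) * int ((p * n) choose (p * n - l)) else 0) =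
      (if D dvd c1 + l then \<delta> ^ l * int ((p * n) choose l) else 0)" by simp
qed auto

lemma jsum_cong_mod: "c1 mod D = c2 mod D \<Longrightarrow> jsum \<delta> D c1 = jsum \<delta> D c2"
  unfolding jsum_def by (intro sum.cong refl) (metis dvd_eq_mod_eq_0 mod_add_left_eq)

text \<open>Away from \<open>- \<delta>\<close> the square of \<open>u z\<close> is a power of
  \<open>z\<close>, so every odd power of \<open>X z\<close> is again a power of \<open>z\<close>
  times \<open>u z\<close> and sums to \<open>N\<close> times a value of \<open>jsum\<close>. The
  assumptions in \<open>sym\<close> identify the exponents 1 with 3 and 5 with 7. The divisibility
  conditions on \<open>8 * c + 4 * t\<close> and \<open>4 * c + 2 * t\<close> make
  \<open>X z\<close> an eighth root of unity and fix the sum of the fourth powers.\<close>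

lemma jsum_two_squares:
  fixes Z :: "'a::idom set"
  assumes rs: "root_system p N Z"
    and \<delta>: "\<delta> = 1 \<or> \<delta> = - 1" "\<delta> ^ (p * n) = 1" "of_int (- \<delta>) \<in> Z"
    and sq: "\<And>z. z \<in> Z \<Longrightarrow> \<not> of_nat p dvd 1 + of_int \<delta> * z \<Longrightarrow>
        mcong (of_nat p ^ 2) ((1 + of_int \<delta> * z) ^ (p * (p - 1))) (z ^ t)"
    and inj: "\<And>k::int. (of_nat p :: 'a) ^ 2 dvd of_int k \<Longrightarrow> int p ^ 2 dvd k"
    and N: "N \<le> p + 1" "4 dvd N" "N dvd 8 * c + 4 * t" "\<not> N dvd 4 * c + 2 * t"
    and sym: "N dvd c + (3 * c + t) + p * n" "N dvd (5 * c + 2 * t) + c' + p * n"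
      "(7 * c + 3 * t) mod N = c' mod N"
    and JJ: "int p ^ 2 dvd (int N * jsum \<delta> N c) * (int N * jsum \<delta> N c') - int p"
  shows "\<exists>a b :: int. a ^ 2 + 2 * b ^ 2 = int p \<and> int p ^ 2 dvd int N * jsum \<delta> N c + int N * jsum \<delta> N c' - 2 * a"
proof -
  interpret root_system p N Z by (rule rs)
  define z1 :: 'a where "z1 = of_int (- \<delta>)"
  define u where "u z = (1 + of_int \<delta> * z) ^ (p * n)" for z :: 'a
  define X where "X z = z ^ c * u z" for z
  \<comment> \<open>The root \<open>z1\<close> is removed because \<open>u z1\<close> is 0 and not a
    root of unity. This costs nothing in odd powers, and it makes the number of terms
    \<open>N - 1 \<le> p\<close>.\<close>
  define Y where "Y = Z - {z1}"
  have z1: "z1 \<in> Z" using \<delta>(3) by (simp add: z1_def)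
  have dd: "of_int \<delta> * of_int \<delta> = (1 :: 'a)" using \<delta>(1) by auto
  have u1: "u z1 = 0" using dd n_pos p_gt_0 by (simp add: u_def z1_def)
  have u2: "mcong (P ^ 2) (u z ^ 2) (z ^ t)" if z: "z \<in> Y" for z
  proof -
    have "\<not> P dvd 1 + of_int \<delta> * z"
    proof
      assume "P dvd 1 + of_int \<delta> * z"
      hence "P dvd of_int \<delta> * (1 + of_int \<delta> * z)" by simp
      also have "of_int \<delta> * (1 + of_int \<delta> * z) = z - z1"
        by (simp add: distrib_left z1_def dd flip: mult.assoc)
      finally have "mcong P z z1" by (simp add: mcong_def)
      thus False using incongruent[of z z1] z z1 by (auto simp: Y_def)
    qed
    moreover have "u z ^ 2 = (1 + of_int \<delta> * z) ^ (p * (p - 1))"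
    proof -
      have "p * (p - 1) = p * n * 2" by (simp add: p_eq)
      thus ?thesis by (simp only: u_def power_mult)
    qed
    ultimately show ?thesis using sq z by (simp add: Y_def)
  qed
  have Xodd: "mcong (P ^ 2) (X z ^ (2 * j + 1)) (z ^ ((2 * j + 1) * c + t * j) * u z)" if "z \<in> Y" for z j
  proof -
    have "X z ^ (2 * j + 1) = (z ^ c) ^ (2 * j + 1) * u z ^ (2 * j + 1)"
      by (simp only: X_def power_mult_distrib)
    also have "(z ^ c) ^ (2 * j + 1) = z ^ ((2 * j + 1) * c)" by (simp only: power_mult[symmetric] mult.commute)
    also have "u z ^ (2 * j + 1) = (u z ^ 2) ^ j * u z" by (simp only: power_add power_mult power_one_right)
    also have "mcong (P ^ 2) (z ^ ((2 * j + 1) * c) * ((u z ^ 2) ^ j * u z)) (z ^ ((2 * j + 1) * c) * ((z ^ t) ^ j * u z))"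
      by (intro mcong_mult mcong_refl mcong_power u2 that)
    also have "\<dots> = z ^ ((2 * j + 1) * c + t * j) * u z" by (simp only: power_add power_mult mult.assoc)
    finally show ?thesis .
  qed
  have Xeven: "mcong (P ^ 2) (X z ^ (2 * j)) (z ^ (2 * j * c + t * j))" if "z \<in> Y" for z j
  proof -
    have "X z ^ (2 * j) = (z ^ c) ^ (2 * j) * u z ^ (2 * j)"
      by (simp only: X_def power_mult_distrib)
    also have "(z ^ c) ^ (2 * j) = z ^ (2 * j * c)" by (simp only: power_mult[symmetric] mult.commute)
    also have "u z ^ (2 * j) = (u z ^ 2) ^ j" by (simp only: power_mult)
    also have "mcong (P ^ 2) (z ^ (2 * j * c) * (u z ^ 2) ^ j) (z ^ (2 * j * c) * (z ^ t) ^ j)"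
      by (intro mcong_mult mcong_refl mcong_power u2 that)
    also have "\<dots> = z ^ (2 * j * c + t * j)" by (simp only: power_add power_mult)
    finally show ?thesis .
  qed
  have Xsum: "mcong (P ^ 2) (\<Sum>z\<in>Y. X z ^ (2 * j + 1)) (of_int (int N * jsum \<delta> N ((2 * j + 1) * c + t * j)))" for j
  proof -
    have "mcong (P ^ 2) (\<Sum>z\<in>Y. X z ^ (2 * j + 1)) (\<Sum>z\<in>Y. z ^ ((2 * j + 1) * c + t * j) * u z)"
      by (intro mcong_sum Xodd)
    also have "(\<Sum>z\<in>Y. z ^ ((2 * j + 1) * c + t * j) * u z) = (\<Sum>z\<in>Z. z ^ ((2 * j + 1) * c + t * j) * u z)"
      using finite_Z z1 u1 by (intro sum.mono_neutral_left) (auto simp: Y_def)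
    also have "mcong (P ^ 2) \<dots> (of_int (int N * jsum \<delta> N ((2 * j + 1) * c + t * j)))"
      unfolding u_def jsum_def by (rule character_sum)
    finally show ?thesis .
  qed
  have J3: "jsum \<delta> N (3 * c + t) = jsum \<delta> N c" using jsum_symmetric[OF sym(1) \<delta>(1,2)] ..
  have J5: "jsum \<delta> N (5 * c + 2 * t) = jsum \<delta> N c'" by (rule jsum_symmetric[OF sym(2) \<delta>(1,2)])
  have J7: "jsum \<delta> N (7 * c + 3 * t) = jsum \<delta> N c'" by (rule jsum_cong_mod[OF sym(3)])
  show ?thesis
  proof (rule octic_two_squares[where X = X and Y = Y])
    show "finite Y" using finite_Z by (simp add: Y_def)
    show "card Y = N - 1" using finite_Z card_Z z1 by (simp add: Y_def)
    show "mcong (P ^ 2) (\<Sum>z\<in>Y. X z) (of_int (int N * jsum \<delta> N c))" using Xsum[of 0] by simp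
    show "mcong (P ^ 2) (\<Sum>z\<in>Y. X z ^ 3) (of_int (int N * jsum \<delta> N c))"
      using Xsum[of 1] J3 by (simp add: eval_nat_numeral)
    show "mcong (P ^ 2) (\<Sum>z\<in>Y. X z ^ 5) (of_int (int N * jsum \<delta> N c'))"
      using Xsum[of 2] J5 by (simp add: mult.commute[of t])
    show "mcong (P ^ 2) (\<Sum>z\<in>Y. X z ^ 7) (of_int (int N * jsum \<delta> N c'))"
      using Xsum[of 3] J7 by (simp add: mult.commute[of t])
    show "mcong (P ^ 2) (X z ^ 8) 1" if z: "z \<in> Y" for z
    proof -
      obtain k where k: "8 * c + 4 * t = N * k" using N(3) by blast
      have "mcong (P ^ 2) (X z ^ 8) (z ^ (8 * c + 4 * t))"
        using Xeven[OF z, of 4] by (simp add: mult.commute[of t])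
      also have "z ^ (8 * c + 4 * t) = (z ^ N) ^ k" by (simp only: k power_mult)
      also have "mcong (P ^ 2) \<dots> (1 ^ k)" using z by (intro mcong_power root) (simp add: Y_def)
      finally show ?thesis by simp
    qed
    show "mcong (P ^ 2) (\<Sum>z\<in>Y. X z ^ 4) (- 1)"
    proof -
      have "mcong (P ^ 2) (\<Sum>z\<in>Y. X z ^ 4) (\<Sum>z\<in>Y. z ^ (4 * c + 2 * t))"
        using Xeven[of _ 2] by (intro mcong_sum) (simp add: mult.commute[of t])
      also have "(\<Sum>z\<in>Y. z ^ (4 * c + 2 * t)) = (\<Sum>z\<in>Z. z ^ (4 * c + 2 * t)) - z1 ^ (4 * c + 2 * t)"
        using finite_Z z1 by (simp add: Y_def sum_diff1)
      also have "z1 ^ (4 * c + 2 * t) = 1"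
      proof -
        have "z1 ^ (4 * c + 2 * t) = (z1 * z1) ^ (2 * c + t)" by (simp flip: power_mult power2_eq_square add: distrib_left)
        thus ?thesis by (simp add: z1_def dd)
      qed
      also have "mcong (P ^ 2) ((\<Sum>z\<in>Z. z ^ (4 * c + 2 * t)) - 1) (0 - 1)"
        using power_sum[of "4 * c + 2 * t"] N(4) by (intro mcong_diff mcong_refl) simp
      finally show ?thesis by simp
    qed
  qed (use prime_elem_p p_ge_3 N N_pos inj JJ odd_p in auto)
qed

lemma product_criterion:
  assumes "cg 1 (of_nat N ^ 2) 1" "cg 1 (of_int j) y" "cg 2 (of_int j') (of_nat p * x)" "cg 1 (x * y) 1" "x \<in> L"
  shows "int p ^ 2 dvd (int N * j) * (int N * j') - int p"
proof -
  have "cg 2 (of_nat N ^ 2 * of_int j * of_int j') (of_nat N ^ 2 * of_int j * (of_nat p * x))"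
    by (intro cg_mult_left assms(3)) auto
  also have "\<dots> = of_nat p * (of_nat N ^ 2 * (x * of_int j))" by simp
  also have "cg 2 \<dots> (of_nat p * (1 * (x * y)))"
    using assms(5) cg_L[OF assms(2)] by (intro cg_lift cg_mult cg_mult_left assms(1,2)) auto
  also have "cg 2 \<dots> (of_nat p * (1 * 1))"
    by (intro cg_lift cg_mult_left assms(4)) auto
  finally have "cg 2 (of_int ((int N * j) * (int N * j'))) (of_int (int p))"
    by (simp add: power2_eq_square mult_ac)
  thus ?thesis unfolding cg_of_int_iff .
qed

lemma cg_main_sum_two_squares:
  assumes J: "cg 2 (of_int J ^ 2) main_sum" and JJ: "int p ^ 2 dvd J * J' - int p" and J': "int p dvd J'"
    and a: "int p ^ 2 dvd J + J' - 2 * a"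
  shows "cg 2 main_sum (of_int (4 * a ^ 2 - 2 * int p))"
proof -
  have "int p ^ 2 dvd J' ^ 2" using J' by (simp add: power2_eq_square mult_dvd_mono)
  hence "int p ^ 2 dvd (J + J' - 2 * a) * (J + J' + 2 * a) - J' ^ 2 - 2 * (J * J' - int p)"
    by (intro dvd_diff[OF dvd_diff[OF dvd_mult2[OF a]] dvd_mult[OF JJ]])
  also have "(J + J' - 2 * a) * (J + J' + 2 * a) - J' ^ 2 - 2 * (J * J' - int p) = J ^ 2 - (4 * a ^ 2 - 2 * int p)"
    by (simp add: power2_eq_square algebra_simps)
  finally have "cg 2 (of_int (J ^ 2)) (of_int (4 * a ^ 2 - 2 * int p))" unfolding cg_of_int_iff .
  moreover have "cg 2 main_sum (of_int (J ^ 2))" using cg_sym[OF J] by simp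
  ultimately show ?thesis by (rule cg_trans[rotated])
qed

text \<open>Modulo \<open>p\<close> the weights \<open>n\<close> and \<open>M\<close> are constants,
  and \<open>cg_rharm_shift\<close> removes \<open>rharm (n - M)\<close>. The two statements belong
  to \<open>p = 8 M + 1\<close> and \<open>p = 8 M + 3\<close>, where \<open>M\<close> and
  \<open>n - M\<close> exchange roles.\<close>

lemma cg_exponent:
  assumes "cg 1 (of_nat M) \<mu>" "\<mu> \<in> L" "2 * M \<le> n"
  shows "cg 1 (of_nat n * rharm n - (of_nat n - of_nat M) * rharm (n - M) - of_nat M * rharm M)
     (- (1/2) * rharm n - (- (1/2) - \<mu>) * (rharm n + 2 * oh M) - \<mu> * rharm M)"
    and "cg 1 (of_nat n * rharm n - (of_nat n - of_nat M) * rharm M - of_nat M * rharm (n - M))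
     (- (1/2) * rharm n - (- (1/2) - \<mu>) * rharm M - \<mu> * (rharm n + 2 * oh M))"
proof -
  have n: "cg 1 (of_nat n) (- (1/2))"
    using cg_sym[OF cg_minus[OF cg_half]] by (simp only: minus_minus)
  have "2 * M < p" using assms(3) n_less by linarith
  hence L: "rharm M \<in> L" "rharm n + 2 * oh M \<in> L"
    using n_less by (intro L_rharm L_add L_mult L_numeral L_oh; linarith)+
  show "cg 1 (of_nat n * rharm n - (of_nat n - of_nat M) * rharm (n - M) - of_nat M * rharm M)
     (- (1/2) * rharm n - (- (1/2) - \<mu>) * (rharm n + 2 * oh M) - \<mu> * rharm M)"
    "cg 1 (of_nat n * rharm n - (of_nat n - of_nat M) * rharm M - of_nat M * rharm (n - M))
     (- (1/2) * rharm n - (- (1/2) - \<mu>) * rharm M - \<mu> * (rharm n + 2 * oh M))"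
    using L by (intro cg_diff cg_mult n cg_refl assms(1) cg_rharm_shift assms(3); simp)+
qed

lemma cg_8_inverse: "8 * M + k = p \<Longrightarrow> cg 1 (of_nat M) (- (of_nat k / 8))"
proof -
  assume "8 * M + k = p"
  hence "(of_nat p :: rat) = 8 * of_nat M + of_nat k" by (metis of_nat_add of_nat_mult of_nat_numeral)
  hence "of_nat M = - (of_nat k / 8) + of_nat p ^ 1 * (1/8 :: rat)" by (simp add: field_simps)
  thus ?thesis by (rule cg_I) (auto intro: L_divide)
qed

lemma main_sum_1:
  assumes p: "p = 8 * M + 1"
  shows "\<exists>a b :: int. a ^ 2 + 2 * b ^ 2 = int p \<and> cg 2 main_sum (of_int (4 * a ^ 2 - 2 * int p))"
proof -
  have nM: "n = 4 * M" and M: "0 < M" and Mp: "M < p" using p p_eq n_pos by auto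
  have pr: "(of_nat p :: rat) = 8 * of_nat M + 1" using p by simp
  \<comment> \<open>Teichmueller representatives modulo \<open>p ^ 2\<close>: \<open>a ^ p\<close>
    is congruent to \<open>a\<close> modulo \<open>p\<close>, and its power \<open>p - 1\<close> is
    1 modulo \<open>p ^ 2\<close>.\<close>
  define Z where "Z = (\<lambda>a. int a ^ p) ` {1..p-1}"
  have inc: "a = b" if "a \<in> {1..p-1}" "b \<in> {1..p-1}" "mcong (int p) (int a ^ p) (int b ^ p)" for a b
  proof -
    have "mcong (int p) (int a) (int b)"
      by (rule mcong_trans[OF mcong_sym[OF fermat_mcong'[OF prime_p]] mcong_trans[OF that(3) fermat_mcong'[OF prime_p]]])
    hence "int p dvd int a - int b" by (simp add: mcong_def)
    moreover have "\<bar>int a - int b\<bar> < int p" using that by auto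
    ultimately have "int a - int b = 0" by (metis dvd_imp_le_int not_less abs_of_nat)
    thus ?thesis by simp
  qed
  have rs: "root_system p (8 * M) Z"
  proof
    show "prime_elem (of_nat p :: int)" using prime_p by simp
    show "finite Z" by (simp add: Z_def)
    have "inj_on (\<lambda>a. int a ^ p) {1..p-1}" using inc by (intro inj_onI) (metis mcong_refl)
    thus "card Z = 8 * M" unfolding Z_def using p by (simp add: card_image)
    show "0 < 8 * M" using M by simp
    show "x = y" if "x \<in> Z" "y \<in> Z" "mcong (of_nat p) x y" for x y
    proof -
      obtain a b where "a \<in> {1..p-1}" "b \<in> {1..p-1}" "x = int a ^ p" "y = int b ^ p"
        using \<open>x \<in> Z\<close> \<open>y \<in> Z\<close> by (auto simp: Z_def)
      thus ?thesis using inc that(3) by blast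
    qed
    show "mcong (of_nat p ^ 2) (z ^ (8 * M)) 1" if "z \<in> Z" for z
    proof -
      obtain a where a: "a \<in> {1..p-1}" "z = int a ^ p" using \<open>z \<in> Z\<close> by (auto simp: Z_def)
      have "8 * M = p - 1" using p by simp
      hence "z ^ (8 * M) = int a ^ (p * (p - 1))" by (simp only: a(2) power_mult)
      also have "\<dots> = (int a ^ (p - 1)) ^ p" by (subst mult.commute) (rule power_mult)
      finally have "z ^ (8 * M) = (int a ^ (p - 1)) ^ p" .
      moreover have "\<not> p dvd a" using a(1) by (auto dest: dvd_imp_le)
      ultimately show ?thesis using mcong_one_power_p[of p "int a ^ (p - 1)"] fermat_mcong[OF prime_p] by simp
    qed
    show "\<not> of_nat p dvd (of_nat (8 * M) :: int)"
      using p M by (simp only: of_nat_dvd_iff) (auto dest: dvd_imp_le)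
  qed
  define y where "y = ((- 1) ^ M * of_nat (n choose M) :: rat)"
  define x where "x = (1 / of_nat ((7 * M) choose n) :: rat)"
  define h where "h = of_nat n * rharm n - (of_nat n - of_nat M) * rharm (n - M) - of_nat M * rharm M"
  have Lh: "h \<in> L" unfolding h_def using nM n_less by (intro L_diff L_mult L_rharm L_of_nat) auto
  have Lx: "x \<in> L" unfolding x_def by (intro L_divide L_1 unit_binomial) (use p nM in auto)
  have Ly: "y \<in> L" unfolding y_def by auto
  have j: "cg 2 (of_int (jsum (- 1) (8 * M) (7 * M))) (y * (1 + of_nat p * (h + 1)))"
    using cg_jsum_1[OF p] by (simp only: y_def h_def)
  have N1: "cg 1 (of_nat (8 * M)) (- 1)" by (rule cg_I[of _ _ _ 1]) (auto simp: pr)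
  have xy: "cg 1 (x * y) 1"
  proof -
    have "n - M = 3 * M" "7 * M - n = 3 * M" "p - 1 - M = 7 * M" using nM p by auto
    hence "x * y = (- 1) ^ M * (fact n ^ 2 / (fact M * fact (p - 1 - M)))"
      using nM by (simp add: x_def y_def binomial_fact power2_eq_square mult_ac)
    also have "cg 1 \<dots> ((- 1) ^ M * ((- 1) ^ M * (- 1) ^ n))"
      by (intro cg_mult_left cg_choose_quotient Mp) auto
    also have "(- 1) ^ M * ((- 1) ^ M * (- 1) ^ n) = (1 :: rat)" using nM by (cases "even M") auto
    finally show ?thesis .
  qed
  have JJ: "int p ^ 2 dvd (int (8 * M) * jsum (- 1) (8 * M) (7 * M)) * (int (8 * M) * jsum (- 1) (8 * M) M) - int p"
  proof (rule product_criterion[OF _ _ _ xy Lx])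
    show "cg 1 (of_nat (8 * M) ^ 2) 1" using cg_power[OF N1, of 2] by simp
    have "cg 1 (y * (1 + of_nat p * (h + 1))) (y * (1 + 0))"
      using Ly Lh by (intro cg_mult_left cg_add cg_refl cg_p) auto
    thus "cg 1 (of_int (jsum (- 1) (8 * M) (7 * M))) y" using cg_trans[OF cg_2_1[OF j]] by simp
    show "cg 2 (of_int (jsum (- 1) (8 * M) M)) (of_nat p * x)" unfolding x_def by (rule cg_jsum_1'[OF p])
  qed
  have "\<exists>a b :: int. a ^ 2 + 2 * b ^ 2 = int p \<and>
      int p ^ 2 dvd int (8 * M) * jsum (- 1) (8 * M) (7 * M) + int (8 * M) * jsum (- 1) (8 * M) M - 2 * a"
  proof (rule jsum_two_squares[OF rs, where t = 0])
    interpret root_system p "8 * M" Z by (rule rs)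
    show "(- 1 :: int) ^ (p * n) = 1" using nM by simp
    show "of_int (- (- 1)) \<in> Z" unfolding Z_def using p_ge_3 by (intro image_eqI[of _ _ 1]) auto
    show "mcong (of_nat p ^ 2) ((1 + of_int (- 1) * z) ^ (p * (p - 1))) (z ^ 0)"
      if "z \<in> Z" "\<not> of_nat p dvd 1 + of_int (- 1) * z" for z
      using one_minus_power[OF prime_p odd_p _ that] p by simp
    show "8 * M dvd 7 * M + (3 * (7 * M) + 0) + p * n"
      by (rule dvdI[of _ _ "4 * M + 4"]) (simp add: p nM algebra_simps)
    show "8 * M dvd (5 * (7 * M) + 2 * 0) + M + p * n"
      by (rule dvdI[of _ _ "4 * M + 5"]) (simp add: p nM algebra_simps)
    have "7 * (7 * M) + 3 * 0 = M + 6 * (8 * M)" by simp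
    thus "(7 * (7 * M) + 3 * 0) mod (8 * M) = M mod (8 * M)" by (simp only: mod_mult_self1)
    show "8 * M dvd 8 * (7 * M) + 4 * 0" by simp
    show "\<not> 8 * M dvd 4 * (7 * M) + 2 * 0"
    proof
      assume "8 * M dvd 4 * (7 * M) + 2 * 0"
      hence "8 * M dvd 4 * M + 3 * (8 * M)" by simp
      hence "8 * M dvd 4 * M" by (simp only: dvd_add_times_triv_right_iff)
      thus False using M by (auto dest: dvd_imp_le)
    qed
    show "int p ^ 2 dvd int (8 * M) * jsum (- 1) (8 * M) (7 * M) * (int (8 * M) * jsum (- 1) (8 * M) M) - int p"
      by (rule JJ)
  qed (use p in auto)
  then obtain a b :: int where ab: "a ^ 2 + 2 * b ^ 2 = int p"
    "int p ^ 2 dvd int (8 * M) * jsum (- 1) (8 * M) (7 * M) + int (8 * M) * jsum (- 1) (8 * M) M - 2 * a" by blast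
  have "cg 2 main_sum (of_int (4 * a ^ 2 - 2 * int p))"
  proof (rule cg_main_sum_two_squares[OF _ JJ _ ab(2)])
    have "cg 1 (of_int (jsum (- 1) (8 * M) M)) (of_int 0)"
      using cg_trans[OF cg_2_1[OF cg_jsum_1'[OF p]] cg_p[OF Lx[unfolded x_def]]] by simp
    hence "int p dvd jsum (- 1) (8 * M) M" unfolding cg_of_int_iff by simp
    thus "int p dvd int (8 * M) * jsum (- 1) (8 * M) M" by simp
    show "cg 2 (of_int (int (8 * M) * jsum (- 1) (8 * M) (7 * M)) ^ 2) main_sum"
    proof (rule cg_square_main_sum[where s = "- ((- 1) ^ M)" and h = h and M = M])
      have "cg 2 (of_nat (8 * M) * of_int (jsum (- 1) (8 * M) (7 * M))) (of_nat (8 * M) * (y * (1 + of_nat p * (h + 1))))"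
        by (intro cg_mult_left j) auto
      \<comment> \<open>The factor \<open>8 * M = p - 1\<close> equals \<open>- (1 - p)\<close>,
        which supplies the sign in \<open>s\<close> and lowers \<open>h + 1\<close> to
        \<open>h\<close>.\<close>
      also have "cg 2 \<dots> (- ((- 1) ^ M) * of_nat (n choose M) * (1 + of_nat p * h))"
        by (rule cg_I[of _ _ _ "y * (h + 1)"])
           (use Ly Lh in \<open>auto simp: y_def pr power2_eq_square algebra_simps\<close>)
      finally show "cg 2 (of_int (int (8 * M) * jsum (- 1) (8 * M) (7 * M))) (- ((- 1) ^ M) * of_nat (n choose M) * (1 + of_nat p * h))"
        by simp
      show "cg 1 h (- (1/8) * rharm n + 3/4 * oh M + 1/8 * rharm M)"
      proof -
        have "cg 1 (of_nat M) (- (of_nat 1 / 8))" using p by (intro cg_8_inverse) simp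
        moreover have "- (of_nat 1 / 8) \<in> L" by (intro L_minus L_divide) auto
        ultimately have "cg 1 h (- (1/2) * rharm n - (- (1/2) - - (of_nat 1 / 8)) * (rharm n + 2 * oh M) - - (of_nat 1 / 8) * rharm M)"
          unfolding h_def using nM by (intro cg_exponent) auto
        also have "- (1/2) * rharm n - (- (1/2) - - (of_nat 1 / 8)) * (rharm n + 2 * oh M) - - (of_nat 1 / 8) * rharm M = - (1/8) * rharm n + 3/4 * oh M + 1/8 * rharm M"
          by (simp add: field_simps)
        finally show ?thesis .
      qed
    qed (use nM in \<open>auto simp flip: power_mult\<close>)
  qed
  thus ?thesis using ab(1) by blast
qed

end

subsection \<open>Roots of unity in the Gaussian integers\<close>

datatype gauss_int = GI (gre: int) (gim: int)

lemma gauss_int_eq_iff: "x = y \<longleftrightarrow> gre x = gre y \<and> gim x = gim y"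
  by (cases x; cases y) simp

instantiation gauss_int :: comm_ring_1
begin

definition "0 = GI 0 0"
definition "1 = GI 1 0"
definition "x + y = GI (gre x + gre y) (gim x + gim y)"
definition "- x = GI (- gre x) (- gim x)"
definition "x - y = GI (gre x - gre y) (gim x - gim y)"
definition "x * y = GI (gre x * gre y - gim x * gim y) (gre x * gim y + gim x * gre y)"

instance
  by standard (simp_all add: zero_gauss_int_def one_gauss_int_def plus_gauss_int_def uminus_gauss_int_def
      minus_gauss_int_def times_gauss_int_def algebra_simps gauss_int_eq_iff)

end

lemma gauss_int_sel [simp]:
  "gre 0 = 0" "gim 0 = 0" "gre 1 = 1" "gim 1 = 0"
  "gre (x + y) = gre x + gre y" "gim (x + y) = gim x + gim y"
  "gre (- x) = - gre x" "gim (- x) = - gim x"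
  "gre (x - y) = gre x - gre y" "gim (x - y) = gim x - gim y"
  "gre (x * y) = gre x * gre y - gim x * gim y" "gim (x * y) = gre x * gim y + gim x * gre y"
  by (simp_all add: zero_gauss_int_def one_gauss_int_def plus_gauss_int_def uminus_gauss_int_def
      minus_gauss_int_def times_gauss_int_def)

definition gnorm :: "gauss_int \<Rightarrow> int" where
  "gnorm x = gre x ^ 2 + gim x ^ 2"

lemma gnorm_mult: "gnorm (x * y) = gnorm x * gnorm y"
  by (simp add: gnorm_def power2_eq_square algebra_simps)

lemma gnorm_eq_0_iff: "gnorm x = 0 \<longleftrightarrow> x = 0"
  by (simp add: gnorm_def gauss_int_eq_iff sum_power2_eq_zero_iff)

instance gauss_int :: idom
proof
  fix x y :: gauss_int
  assume "x \<noteq> 0" "y \<noteq> 0"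
  thus "x * y \<noteq> 0" unfolding gnorm_eq_0_iff[symmetric] gnorm_mult by simp
qed

lemma gauss_int_of_nat [simp]: "gre (of_nat k) = int k" "gim (of_nat k) = 0"
  by (induction k) simp_all

lemma gauss_int_of_int [simp]: "gre (of_int k) = k" "gim (of_int k) = 0"
  by (cases k rule: int_cases2; simp)+

lemma of_int_dvd_gauss_int_iff: "of_int k dvd z \<longleftrightarrow> k dvd gre z \<and> k dvd gim z"
proof
  assume "of_int k dvd z"
  thus "k dvd gre z \<and> k dvd gim z" by (auto simp: dvd_def)
next
  assume "k dvd gre z \<and> k dvd gim z"
  then obtain a b where "gre z = k * a" "gim z = k * b" by (auto simp: dvd_def)
  hence "z = of_int k * GI a b" by (simp add: gauss_int_eq_iff)
  thus "of_int k dvd z" by simp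
qed

lemma of_nat_dvd_gauss_int_iff: "of_nat k dvd z \<longleftrightarrow> int k dvd gre z \<and> int k dvd gim z"
  using of_int_dvd_gauss_int_iff[of "int k" z] by simp

text \<open>The number \<open>- 1\<close> is not a square modulo \<open>p\<close>: raising
  \<open>a ^ 2 = - b ^ 2\<close> to the odd power \<open>(p - 1) div 2\<close> would give
  \<open>1 = - 1\<close> by Fermat.\<close>

lemma prime_dvd_sum_squares:
  fixes a b :: nat
  assumes "prime p" "p mod 4 = 3" "p dvd a ^ 2 + b ^ 2" shows "p dvd a"
proof (rule ccontr)
  assume a: "\<not> p dvd a"
  have b: "\<not> p dvd b"
  proof
    assume "p dvd b"
    hence "p dvd b ^ 2" by (simp add: power2_eq_square)
    hence "p dvd a ^ 2" using assms(3) by (simp add: dvd_add_left_iff)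
    thus False using a assms(1) prime_dvd_power by blast
  qed
  define m where "m = (p - 1) div 2"
  have m: "p - 1 = 2 * m" "odd m" using assms(2) unfolding m_def by presburger+
  have "int p dvd int (a ^ 2 + b ^ 2)" using assms(3) by (simp only: of_nat_dvd_iff)
  hence "mcong (int p) (int a ^ 2) (- (int b ^ 2))" by (simp add: mcong_def)
  hence "mcong (int p) ((int a ^ 2) ^ m) ((- (int b ^ 2)) ^ m)" by (rule mcong_power)
  hence ab: "mcong (int p) (int a ^ (p - 1)) (- (int b ^ (p - 1)))"
    unfolding m(1) power_mult power_minus_odd[OF m(2)] .
  have "mcong (int p) (0 - int b ^ (p - 1)) (0 - 1)"
    by (intro mcong_diff mcong_refl fermat_mcong assms(1) b)
  hence "mcong (int p) (- (int b ^ (p - 1))) (- 1)" by simp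
  from mcong_trans[OF ab this] have "mcong (int p) 1 (- 1)"
    by (rule mcong_trans[OF mcong_sym[OF fermat_mcong[OF assms(1) a]]])
  hence "int p dvd 2" by (simp add: mcong_def)
  hence "int p \<le> 2" by (rule zdvd_imp_le) simp
  thus False using assms(2) by (cases "p = 0 \<or> p = 1 \<or> p = 2") auto
qed

text \<open>The norm is multiplicative, and by \<open>prime_dvd_sum_squares\<close> a norm divisible
  by \<open>p\<close> forces both components to be divisible by \<open>p\<close>.\<close>

lemma prime_elem_gauss_int:
  assumes p: "prime p" "p mod 4 = 3" shows "prime_elem (of_nat p :: gauss_int)"
  unfolding prime_elem_def
proof (intro conjI allI impI)
  have p1: "p > 1" using prime_gt_1_nat[OF p(1)] .
  show "of_nat p \<noteq> (0 :: gauss_int)" using p1 by (simp add: gauss_int_eq_iff)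
  show "\<not> (of_nat p :: gauss_int) dvd 1" using p1 by (auto simp: of_nat_dvd_gauss_int_iff zdvd1_eq)
  fix x y :: gauss_int
  assume "of_nat p dvd x * y"
  then obtain z where "x * y = of_nat p * z" by blast
  hence "gnorm x * gnorm y = gnorm (of_nat p) * gnorm z" by (simp only: gnorm_mult[symmetric])
  also have "gnorm (of_nat p) = int p * int p" by (simp add: gnorm_def power2_eq_square)
  finally have "int p dvd gnorm x * gnorm y" by simp
  hence "int p dvd gnorm x \<or> int p dvd gnorm y" using p(1) by (simp add: prime_dvd_mult_iff)
  moreover have "of_nat p dvd x" if "int p dvd gnorm x" for x
  proof -
    have n: "gnorm x = int (nat \<bar>gre x\<bar> ^ 2 + nat \<bar>gim x\<bar> ^ 2)" by (simp add: gnorm_def)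
    have d: "p dvd nat \<bar>gre x\<bar> ^ 2 + nat \<bar>gim x\<bar> ^ 2" using that unfolding n of_nat_dvd_iff .
    have "p dvd nat \<bar>gre x\<bar>" by (rule prime_dvd_sum_squares[OF p d])
    moreover have "p dvd nat \<bar>gim x\<bar>"
      by (rule prime_dvd_sum_squares[OF p d[unfolded add.commute[of "nat \<bar>gre x\<bar> ^ 2"]]])
    ultimately show ?thesis by (simp add: of_nat_dvd_gauss_int_iff flip: of_nat_dvd_iff[where 'a = int])
  qed
  ultimately show "of_nat p dvd x \<or> of_nat p dvd y" by blast
qed

text \<open>For \<open>p\<close> congruent to 3 modulo 4 one has \<open>i ^ p = - i\<close>, so the
  Frobenius map is complex conjugation.\<close>

lemma gauss_int_power_p:
  assumes "prime p" "p mod 4 = 3"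
  shows "mcong (of_nat p) (GI 1 (int b) ^ p) (GI 1 (- int b))"
    and "mcong (of_nat p) (GI 1 (- int b) ^ p) (GI 1 (int b))"
proof -
  define i where "i = GI 0 1"
  have i2: "i ^ 2 = - 1" by (simp add: gauss_int_eq_iff i_def power2_eq_square)
  have ip: "i ^ p = - i"
  proof -
    have "p = 2 * (2 * (p div 4) + 1) + 1" using assms(2) by presburger
    hence "i ^ p = (i ^ 2) ^ (2 * (p div 4) + 1) * i" by (metis power_add power_mult power_one_right)
    thus ?thesis by (simp add: i2)
  qed
  have odd: "odd p" using assms(2) by presburger
  have bp: "mcong (of_nat p) ((of_nat b :: gauss_int) ^ p) (of_nat b)"
    using fermat_mcong'[OF assms(1), of b]
    by (simp add: mcong_def of_nat_dvd_gauss_int_iff flip: of_nat_power)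
  have e: "mcong (of_nat p) ((1 + c * i) ^ p) (1 - c * i)" if "c = of_nat b \<or> c = - of_nat b" for c
  proof -
    have "mcong (of_nat p) (c ^ p) c"
      using that
    proof
      assume "c = - of_nat b"
      thus ?thesis using mcong_diff[OF mcong_refl bp, of 0] by (simp add: power_minus_odd[OF odd])
    qed (use bp in simp)
    hence "mcong (of_nat p) (1 + c ^ p * i ^ p) (1 + c * i ^ p)" by (intro mcong_add mcong_mult mcong_refl)
    moreover have "mcong (of_nat p) ((1 + c * i) ^ p) (1 + (c * i) ^ p)" by (rule mcong_binomial_p[OF assms(1)])
    ultimately show ?thesis using mcong_trans by (simp add: power_mult_distrib ip) blast
  qed
  have w: "1 + of_nat b * i = GI 1 (int b)" "1 - of_nat b * i = GI 1 (- int b)" 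
    by (simp_all add: gauss_int_eq_iff i_def)
  show "mcong (of_nat p) (GI 1 (int b) ^ p) (GI 1 (- int b))"
    using e[of "of_nat b"] unfolding w by simp
  show "mcong (of_nat p) (GI 1 (- int b) ^ p) (GI 1 (int b))"
    using e[of "- of_nat b"] w by simp
qed

text \<open>Modulo \<open>p\<close> the power of \<open>w = 1 + b i\<close> is \<open>w\<close>
  divided by its conjugate, the rational parametrization of the norm-one group. It takes
  \<open>p\<close> different values and misses only \<open>- 1\<close>, the point at infinity, which
  is inserted by hand. The additional exponent \<open>p\<close> makes the equation
  \<open>z ^ (p + 1) = 1\<close> hold modulo \<open>p ^ 2\<close>.\<close>

lemma root_system_gauss_int:
  assumes p: "prime p" "p mod 4 = 3"
  shows "root_system p (p + 1) (insert (- 1) ((\<lambda>b. GI 1 (int b) ^ (p * (p - 1))) ` {..<p}))"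
proof -
  define w where "w b = GI 1 (int b)" for b
  define v where "v b = GI 1 (- int b)" for b
  define z where "z b = w b ^ (p * (p - 1))" for b
  have p3: "p \<ge> 3" using p(2) by (cases "p = 0 \<or> p = 1 \<or> p = 2") auto
  have p1: "p = Suc (p - 1)" using p3 by simp
  have prime: "prime_elem (of_nat p :: gauss_int)" by (rule prime_elem_gauss_int[OF p])
  have cancel: "mcong (of_nat p) y y'" if "mcong (of_nat p) (w b * y) (w b * y')" for b y y'
  proof -
    have "\<not> of_nat p dvd w b" using p3 by (auto simp: of_nat_dvd_gauss_int_iff w_def dest: zdvd_imp_le)
    moreover have "of_nat p dvd w b * (y - y')" using that by (simp add: mcong_def right_diff_distrib)
    ultimately show ?thesis using prime prime_elem_dvd_mult_iff by (auto simp: mcong_def)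
  qed
  have wp2: "mcong (of_nat p) (w b ^ (p * p)) (w b)" for b
  proof -
    have "mcong (of_nat p) ((w b ^ p) ^ p) (v b ^ p)"
      unfolding w_def v_def by (intro mcong_power gauss_int_power_p p)
    also have "mcong (of_nat p) (v b ^ p) (w b)" unfolding w_def v_def by (rule gauss_int_power_p[OF p])
    finally show ?thesis by (simp only: power_mult)
  qed
  have zv: "mcong (of_nat p) (z b * v b) (w b)" for b
  proof -
    have "mcong (of_nat p) (z b * v b) (z b * w b ^ p)"
      unfolding w_def v_def by (intro mcong_mult mcong_refl mcong_sym[OF gauss_int_power_p(1)] p)
    also have "z b * w b ^ p = w b ^ (p * p)"
    proof -
      have "p * (p - 1) + p = p * p" using p3 by (simp add: algebra_simps)
      thus ?thesis by (simp only: z_def power_add[symmetric])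
    qed
    finally show ?thesis using mcong_trans wp2 by blast
  qed
  have root: "mcong (of_nat p ^ 2) (z b ^ (p + 1)) 1" for b
  proof -
    have e: "p * p = Suc ((p - 1) * (p + 1))" using p3 by (simp add: algebra_simps)
    have "w b ^ (p * p) = w b * w b ^ ((p - 1) * (p + 1))" unfolding e by simp
    hence "mcong (of_nat p) (w b * w b ^ ((p - 1) * (p + 1))) (w b * 1)" using wp2[of b] by simp
    hence "mcong (of_nat p) (w b ^ ((p - 1) * (p + 1))) 1" by (rule cancel)
    hence "mcong (of_nat p ^ 2) ((w b ^ ((p - 1) * (p + 1))) ^ p) 1" by (rule mcong_one_power_p)
    moreover have "(w b ^ ((p - 1) * (p + 1))) ^ p = z b ^ (p + 1)"
    proof -
      have "(p - 1) * (p + 1) * p = p * (p - 1) * (p + 1)" by (simp only: mult_ac)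
      thus ?thesis by (simp only: z_def power_mult[symmetric])
    qed
    ultimately show ?thesis by simp
  qed
  have inc: "b = c" if "b < p" "c < p" "mcong (of_nat p) (z b) (z c)" for b c
  proof -
    have "mcong (of_nat p) (w b * v c) (z b * v b * v c)" by (intro mcong_mult mcong_refl mcong_sym[OF zv])
    also have "mcong (of_nat p) \<dots> (z c * v b * v c)" by (intro mcong_mult mcong_refl that)
    also have "z c * v b * v c = (z c * v c) * v b" by (simp only: mult_ac)
    also have "mcong (of_nat p) \<dots> (w c * v b)" by (intro mcong_mult mcong_refl zv)
    finally have "int p dvd gim (w b * v c - w c * v b)" by (simp only: mcong_def of_nat_dvd_gauss_int_iff)
    hence "int p dvd 2 * (int b - int c)" by (simp add: w_def v_def algebra_simps)
    moreover have "\<not> int p dvd 2" using p3 by (auto dest: zdvd_imp_le)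
    ultimately have d: "int p dvd int b - int c"
      using p(1) prime_dvd_mult_iff[of "int p" 2 "int b - int c"] by (simp del: prime_dvd_mult_iff)
    show "b = c"
    proof (rule ccontr)
      assume "b \<noteq> c"
      thus False using dvd_imp_le_int[OF _ d] that(1,2) by auto
    qed
  qed
  have minus1: "\<not> mcong (of_nat p) (z b) (- 1)" for b
  proof
    assume "mcong (of_nat p) (z b) (- 1)"
    hence "mcong (of_nat p) (z b * v b) (- 1 * v b)" by (intro mcong_mult mcong_refl)
    hence "mcong (of_nat p) (w b) (- 1 * v b)" by (rule mcong_trans[OF mcong_sym[OF zv]])
    hence "int p dvd gre (w b - - 1 * v b)" by (simp only: mcong_def of_nat_dvd_gauss_int_iff)
    hence "int p dvd 2" by (simp add: w_def v_def)
    thus False using p3 by (auto dest: zdvd_imp_le)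
  qed
  have "root_system p (p + 1) (insert (- 1) (z ` {..<p}))"
  proof
    show "prime_elem (of_nat p :: gauss_int)" by (rule prime)
    have "inj_on z {..<p}" using inc by (intro inj_onI) auto
    moreover have "- 1 \<notin> z ` {..<p}" using minus1 mcong_refl by (metis imageE)
    ultimately show "card (insert (- 1) (z ` {..<p})) = p + 1" by (simp add: card_image)
    show "x = y" if "x \<in> insert (- 1) (z ` {..<p})" "y \<in> insert (- 1) (z ` {..<p})" "mcong (of_nat p) x y" for x y
      using that inc minus1 mcong_sym by (elim insertE imageE) (blast | simp)+
    have "even (p + 1)" using p(2) by presburger
    thus "mcong (of_nat p ^ 2) (x ^ (p + 1)) 1" if "x \<in> insert (- 1) (z ` {..<p})" for x
      using that root by (elim insertE imageE) (simp_all del: power_Suc)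
    show "\<not> of_nat p dvd (of_nat (p + 1) :: gauss_int)"
      using p3 by (auto simp: of_nat_dvd_gauss_int_iff)
  qed auto
  thus ?thesis by (simp only: z_def[abs_def] w_def)
qed

context odd_prime
begin

lemma main_sum_3:
  assumes p: "p = 8 * M + 3"
  shows "\<exists>a b :: int. a ^ 2 + 2 * b ^ 2 = int p \<and> cg 2 main_sum (of_int (4 * a ^ 2 - 2 * int p))"
proof -
  have nM: "n = 4 * M + 1" using p p_eq by auto
  have Mn: "M \<le> M + n" "M + n < p" using p nM by auto
  define N where "N = 8 * M + 4"
  have Np: "N = p + 1" by (simp add: N_def p)
  define Z where "Z = insert (- 1) ((\<lambda>b. GI 1 (int b) ^ (p * (p - 1))) ` {..<p})"
  have "p mod 4 = 3" unfolding p by presburger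
  hence rs: "root_system p N Z" unfolding Z_def Np by (intro root_system_gauss_int prime_p)
  define y where "y = (of_nat (n choose M) :: rat)"
  define x where "x = ((- 1) ^ M / of_nat ((M + n) choose M) :: rat)"
  define h where "h = of_nat n * rharm n - (of_nat n - of_nat M) * rharm M - of_nat M * rharm (n - M)"
  have Lh: "h \<in> L" unfolding h_def using nM n_less by (intro L_diff L_mult L_rharm L_of_nat) auto
  have Lx: "x \<in> L" unfolding x_def by (intro L_divide unit_binomial Mn) auto
  have Ly: "y \<in> L" unfolding y_def by auto
  have j: "cg 2 (of_int (jsum 1 N M)) (y * (1 + of_nat p * (h - 1)))"
    using cg_jsum_3[OF p] by (simp only: y_def h_def N_def)
  have j': "cg 2 (of_int (jsum 1 N (7 * M + 3))) (of_nat p * x)"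
    unfolding x_def N_def by (rule cg_jsum_3'[OF p])
  have N1: "cg 1 (of_nat N) 1" by (rule cg_I[of _ _ _ 1]) (auto simp: Np)
  have xy: "cg 1 (x * y) 1"
  proof -
    have "p - 1 - (n - M) = n + M" "M \<le> n" and r: "n - M < p" using nM p_eq by auto
    hence "x * y = (- 1) ^ M * (fact n ^ 2 / (fact (n - M) * fact (p - 1 - (n - M))))"
      by (simp add: x_def y_def binomial_fact power2_eq_square mult_ac add.commute)
    also have "cg 1 \<dots> ((- 1) ^ M * ((- 1) ^ (n - M) * (- 1) ^ n))"
      by (intro cg_mult_left cg_choose_quotient r) auto
    also have "(- 1) ^ M * ((- 1) ^ (n - M) * (- 1) ^ n) = ((- 1) ^ (M + (n - M) + n) :: rat)"
      by (simp only: power_add mult.assoc)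
    also have "\<dots> = 1" using \<open>M \<le> n\<close> by simp
    finally show ?thesis .
  qed
  have JJ: "int p ^ 2 dvd (int N * jsum 1 N M) * (int N * jsum 1 N (7 * M + 3)) - int p"
  proof (rule product_criterion[OF _ _ j' xy Lx])
    show "cg 1 (of_nat N ^ 2) 1" using cg_power[OF N1, of 2] by simp
    have "cg 1 (y * (1 + of_nat p * (h - 1))) (y * (1 + 0))"
      using Ly Lh by (intro cg_mult_left cg_add cg_refl cg_p) auto
    thus "cg 1 (of_int (jsum 1 N M)) y" using cg_trans[OF cg_2_1[OF j]] by simp
  qed
  have "\<exists>a b :: int. a ^ 2 + 2 * b ^ 2 = int p \<and>
      int p ^ 2 dvd int N * jsum 1 N M + int N * jsum 1 N (7 * M + 3) - 2 * a"
  proof (rule jsum_two_squares[OF rs, where t = 1])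
    interpret root_system p N Z by (rule rs)
    show "of_int (- 1) \<in> Z" by (simp add: Z_def)
    show "mcong (of_nat p ^ 2) ((1 + of_int 1 * z) ^ (p * (p - 1))) (z ^ 1)"
      if "z \<in> Z" "\<not> of_nat p dvd 1 + of_int 1 * z" for z
      by (rule one_plus_power[OF prime_p Np that])
    show "int p ^ 2 dvd k" if "(of_nat p :: gauss_int) ^ 2 dvd of_int k" for k :: int
      using that of_nat_dvd_gauss_int_iff[of "p ^ 2" "of_int k"] by simp
    show "N dvd M + (3 * M + 1) + p * n"
      by (rule dvdI[of _ _ "4 * M + 1"]) (simp add: N_def p nM algebra_simps)
    show "N dvd (5 * M + 2 * 1) + (7 * M + 3) + p * n"
      by (rule dvdI[of _ _ "4 * M + 2"]) (simp add: N_def p nM algebra_simps)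
    show "\<not> N dvd 4 * M + 2 * 1" unfolding N_def by (auto dest: dvd_imp_le)
    show "N dvd 8 * M + 4 * 1" by (simp add: N_def)
    show "4 dvd N" unfolding N_def by presburger
    show "int p ^ 2 dvd int N * jsum 1 N M * (int N * jsum 1 N (7 * M + 3)) - int p" by (rule JJ)
  qed (use Np in auto)
  then obtain a b :: int where ab: "a ^ 2 + 2 * b ^ 2 = int p"
    "int p ^ 2 dvd int N * jsum 1 N M + int N * jsum 1 N (7 * M + 3) - 2 * a" by blast
  have "cg 2 main_sum (of_int (4 * a ^ 2 - 2 * int p))"
  proof (rule cg_main_sum_two_squares[OF _ JJ _ ab(2)])
    have "cg 1 (of_int (jsum 1 N (7 * M + 3))) (of_int 0)"
      using cg_trans[OF cg_2_1[OF j'] cg_p[OF Lx]] by simp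
    hence "int p dvd jsum 1 N (7 * M + 3)" unfolding cg_of_int_iff by simp
    thus "int p dvd int N * jsum 1 N (7 * M + 3)" by simp
    show "cg 2 (of_int (int N * jsum 1 N M) ^ 2) main_sum"
    proof (rule cg_square_main_sum[where s = 1 and h = h and M = M])
      have "cg 2 (of_nat N * of_int (jsum 1 N M)) (of_nat N * (y * (1 + of_nat p * (h - 1))))"
        by (intro cg_mult_left j) auto
      also have "cg 2 \<dots> (1 * of_nat (n choose M) * (1 + of_nat p * h))"
        by (rule cg_I[of _ _ _ "y * (h - 1)"])
           (use Ly Lh in \<open>auto simp: Np power2_eq_square algebra_simps simp flip: y_def\<close>)
      finally show "cg 2 (of_int (int N * jsum 1 N M)) (1 * of_nat (n choose M) * (1 + of_nat p * h))"
        by simp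
      show "cg 1 h (- (1/8) * rharm n + 3/4 * oh M + 1/8 * rharm M)"
      proof -
        have "cg 1 (of_nat M) (- (of_nat 3 / 8))" using p by (intro cg_8_inverse) simp
        moreover have "- (of_nat 3 / 8) \<in> L" by (intro L_minus L_divide) auto
        ultimately have "cg 1 h (- (1/2) * rharm n - (- (1/2) - - (of_nat 3 / 8)) * rharm M - - (of_nat 3 / 8) * (rharm n + 2 * oh M))"
          unfolding h_def using nM by (intro cg_exponent) auto
        also have "- (1/2) * rharm n - (- (1/2) - - (of_nat 3 / 8)) * rharm M - - (of_nat 3 / 8) * (rharm n + 2 * oh M) = - (1/8) * rharm n + 3/4 * oh M + 1/8 * rharm M"
          by (simp add: field_simps)
        finally show ?thesis .
      qed
    qed (use nM in auto)
  qed
  thus ?thesis using ab(1) by blast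
qed

text \<open>The Clausen value contains the square of \<open>leg\<close>, so vanishing of
  \<open>leg\<close> modulo \<open>p\<close> suffices for the modulus \<open>p ^ 2\<close>.\<close>

lemma cg_main_sum_0:
  assumes "odd (n div 2)" shows "cg 2 main_sum 0"
proof -
  have leg: "cg 1 leg 0" by (rule cg_leg_odd[OF assms])
  hence L: "leg \<in> L" using cg_L by fastforce
  have sq: "cg 2 (leg ^ 2) 0" unfolding power2_eq_square by (rule cg_2_0[OF L L leg leg])
  have "cg 2 (clausen_value n) 0"
    using sq cg_mult_left[OF _ sq, of 2] by (simp add: clausen_leg)
  moreover have "1 / 2 ^ n * (1 - of_nat p * (rharm n / 4)) \<in> L"
    by (intro L_mult L_diff L_divide unit_power L_rharm) (use n_less in auto)
  ultimately have "cg 2 (1 / 2 ^ n * (1 - of_nat p * (rharm n / 4)) * clausen_value n) (1 / 2 ^ n * (1 - of_nat p * (rharm n / 4)) * 0)"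
    by (intro cg_mult_left)
  thus ?thesis using cg_trans[OF cg_main_sum] by (simp add: mult.commute)
qed

lemma cg_main_sum_octic:
  assumes "p mod 8 = 1 \<or> p mod 8 = 3" "x ^ 2 + 2 * y ^ 2 = int p"
  shows "cg 2 main_sum (of_int (4 * x ^ 2 - 2 * int p))"
proof -
  have "p = 8 * (p div 8) + 1 \<or> p = 8 * (p div 8) + 3" using assms(1) by presburger
  then obtain a b where ab: "a ^ 2 + 2 * b ^ 2 = int p" "cg 2 main_sum (of_int (4 * a ^ 2 - 2 * int p))"
    using main_sum_1[of "p div 8"] main_sum_3[of "p div 8"] by blast
  thus ?thesis using sum_two_squares_unique[OF prime_p ab(1) assms(2)] by simp
qed

end

theorem theorem2p4:
  fixes p :: nat
  assumes "prime p" and "odd p"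
  shows "(\<forall>x y :: int. ([p = 1] (mod 8) \<or> [p = 3] (mod 8)) \<and> int p = x\<^sup>2 + 2 * y\<^sup>2 \<longrightarrow>
            local_cong p (\<Sum>n=0..p-1. of_nat (((2 * n) choose n) * G n) / 128 ^ n)
              (of_int (4 * x\<^sup>2 - 2 * int p)) (of_nat (p\<^sup>2)))
       \<and> ([p = 5] (mod 8) \<or> [p = 7] (mod 8) \<longrightarrow>
            local_cong p (\<Sum>n=0..p-1. of_nat (((2 * n) choose n) * G n) / 128 ^ n)
              0 (of_nat (p\<^sup>2)))
       \<and> local_cong p (\<Sum>n=0..p-1. of_nat (((2 * n) choose n) * n * G n) / 128 ^ n)
            0 (of_nat (p\<^sup>2))"
proof -
  interpret odd_prime p "(p - 1) div 2"
    using assms by unfold_locales auto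
  \<comment> \<open>With \<open>p = 8 k + 5\<close> or \<open>p = 8 k + 7\<close> one has
    \<open>n = 4 k + 2\<close> or \<open>n = 4 k + 3\<close>, and
    \<open>n div 2 = 2 k + 1\<close>.\<close>
  have zero: "odd ((p - 1) div 2 div 2)" if "[p = 5] (mod 8) \<or> [p = 7] (mod 8)"
  proof -
    have "p mod 8 = 5 \<or> p mod 8 = 7" using that by (simp add: cong_def)
    thus ?thesis by presburger
  qed
  show ?thesis
    unfolding main_sum_def[symmetric] second_sum_def[symmetric] local_cong_iff
  proof (intro conjI allI impI)
    fix x y :: int
    assume "([p = 1] (mod 8) \<or> [p = 3] (mod 8)) \<and> int p = x\<^sup>2 + 2 * y\<^sup>2"
    thus "cg 2 main_sum (of_int (4 * x\<^sup>2 - 2 * int p))"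
      by (intro cg_main_sum_octic[of x y]) (auto simp: cong_def)
  next
    assume "[p = 5] (mod 8) \<or> [p = 7] (mod 8)"
    thus "cg 2 main_sum 0" by (intro cg_main_sum_0 zero)
  qed (auto intro: cg_second_sum L_main_sum L_second_sum)
qed

end
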